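(* For each element of $G$ there is a unique word $f y_{s_1}^{t_1}\cdots y_{s_n}^{t_n}$ representing it such that: (1) $f y_{s_1}^{t_1}\cdots y_{s_n}^{t_n}$ is a standard form with no potential contractions and no potential cancellations; (2) $f\in F$ is an $X$-word in $F$-normal form. Moreover, given any word that represents this element of $G$, it can be converted into the word $f y_{s_1}^{t_1}\cdots y_{s_n}^{t_n}$ using a sequence of moves from the list (M1)–(M5) in the context.
   Context: Let $2^{\mathbf N}$ and $2^{<\mathbf N}$ be the sets of infinite and of finite binary sequences. All actions are right actions. Define homeomorphisms $x,y$ of $2^{\mathbf N}$ by $00\eta\cdot x=0\eta$, $01\eta\cdot x=10\eta$, $1\eta\cdot x=11\eta$ and, recursively, $00\eta\cdot y=0(\eta\cdot y)$, $01\eta\cdot y=10(\eta\cdot y^{-1})$, $1\eta\cdot y=11(\eta\cdot y)$. For $s\in 2^{<\mathbf N}$ let $x_s$ (resp. $y_s$) map $s\eta\mapsto s(\eta\cdot x)$ (resp. $s(\eta\cdot y)$) and fix sequences not extending $s$; $x=x_\emptyset$. $G$ is the group generated by all $x_s$ ($s\in2^{<\mathbf N}$) and all $y_s$ with $s\ne\emptyset,0^k,1^k$; $F\le G$ is the subgroup generated by all $x_s$ (Thompson's group $F$). An element $f\in F$ acts on $s\in2^{<\mathbf N}$ (i.e. $s\cdot f$ is defined) if for some $s'=:s\cdot f$ in $2^{<\mathbf N}$ one has $(s\xi)\cdot f=s'\xi$ for all $\xi\in 2^{\mathbf N}$. An $X$-word is a word in the letters $x_s^{t}$, a $Y$-word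 is a word in the letters $y_s^{t}$ ($s\neq\emptyset,0^k,1^k$), and an $S$-word (or simply word) is a word in both kinds of letters ($t\in\mathbf Z$). Write $s\subset t$ if $s$ is a proper prefix of $t$; $s,t$ are independent if neither is a prefix of the other. Write $s<t$ if $t\subset s$, or if $s,t$ are independent and $s(i)<t(i)$ at the first index $i$ where they differ. A standard form is an $X$-word $f$ followed by a $Y$-word $y_{s_1}^{t_1}\cdots y_{s_n}^{t_n}$ (with all $t_i\neq 0$) such that $s_i<s_j$ whenever $i<j$. A weak standard form is defined in the same way but requiring only that $s_j\subset s_i$ implies $i<j$. Potential cancellation: given a (weak) standard form $fy_{s_1}^{t_1}\cdots y_{s_n}^{t_n}$ and $\tau\in 2^{\mathbf N}$, the calculation of $y_{s_1}^{t_1}\cdots y_{s_n}^{t_n}$ on $\tau$ is the infinite string in $0,1,y,y^{-1}$ obtained from $\tau$ by inserting, for each $i$ with $s_i$ a prefix of $\tau$, the string $y^{t_i}$ ($|t_i|$ copies of $y^{\pm1}$) immediately after the prefix $s_i$. Allowed substitutions are $y00\to0y$, $y01\to10y^{-1}$, $y1\to11y$, $y^{-1}0\to00y^{-1}$, $y^{-1}10\to01y$, $y^{-1}11\to1y^{-1}$. A potential cancellation in a string is a substring $y^{\epsilon_1}\sigma y^{\epsilon_2}$ with $\sigma\in2^{<\mathbf N}$, $\epsilon_i\in\{\pm1\}$, such that performing a finite set of substitutions on it yields a substring $yy^{-1}$ or $y^{-1}y$. The (weak) standard form has a potential cancellation if for some $\tau\in2^{\mathbf N}$ the calculation of $y_{s_1}^{t_1}\cdots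 y_{s_n}^{t_n}$ on $\tau$ contains one. Potential contraction: a weak standard form contains a potential contraction if either (i) it contains an occurrence of a subword of the form $y_{s0}y_{s10}^{-1}y_{s11}$ but no occurrences of $y_{s1}^{\pm}$; or (ii) it contains an occurrence of a subword of the form $y_{s00}^{-1}y_{s01}y_{s1}^{-1}$ but no occurrences of $y_{s0}^{\pm}$. $F$-normal form: the empty word (for the identity), or a word $x^{-b_0}x_1^{-b_1}x_{1^2}^{-b_2}\cdots x_{1^n}^{-b_n}x_{1^n}^{a_n}\cdots x_1^{a_1}x^{a_0}$ with all $a_i,b_i\ge0$, exactly one of $a_n,b_n$ nonzero, and such that if $a_k,b_k>0$ for some $0\le k\le n-1$ then $a_{k+1}>0$ or $b_{k+1}>0$. Moves on words: (M1) Rearranging: $y_t^i x_s^{\pm1}\to x_s^{\pm1}y_{t\cdot x_s^{\pm1}}^i$, where $s,t\in2^{<\mathbf N}$ are such that $t\cdot x_s^{\pm1}$ is defined. (M2) Expansion: $y_s\to x_sy_{s0}y_{s10}^{-1}y_{s11}$ and $y_s^{-1}\to x_s^{-1}y_{s00}^{-1}y_{s01}y_{s1}^{-1}$. (M3) Commuting: $y_uy_v\leftrightarrow y_vy_u$ for $u,v\in2^{<\mathbf N}$ independent. (M4) Cancellation: delete an occurrence of $y_s^iy_s^{-i}$. (M5) ER move (expansion followed by rearrangement), applied to a (weak) standard form $f(y_{s_1}^{t_1}\cdots y_{s_n}^{t_n})y_u^v(y_{p_1}^{q_1}\cdots y_{p_m}^{q_m})$: if $v=1$ and $x_u$ acts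 on each of $s_1,\dots,s_n$, replace it by $fx_u(y_{s_1\cdot x_u}^{t_1}\cdots y_{s_n\cdot x_u}^{t_n})(y_{u0}y_{u10}^{-1}y_{u11})(y_{p_1}^{q_1}\cdots y_{p_m}^{q_m})$; if $v=-1$ and $x_u^{-1}$ acts on each of $s_1,\dots,s_n$, replace it by $fx_u^{-1}(y_{s_1\cdot x_u^{-1}}^{t_1}\cdots y_{s_n\cdot x_u^{-1}}^{t_n})(y_{u00}^{-1}y_{u01}y_{u1}^{-1})(y_{p_1}^{q_1}\cdots y_{p_m}^{q_m})$.
   Formalization: F-normal form is read in the reverse order (positive powers first), as right actions require; X-words equal in F may be exchanged; expansion (M2) may also be undone; "subword" in potential contractions means scattered subword. The literal claim fails otherwise. *)

theory Defs
  imports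
    "HOL-Library.Stream"
    "HOL-Library.Sublist"
    "HOL-Library.BNF_Corec"
    "HOL-Algebra.Bij"
    "HOL-Algebra.Generated_Groups"
begin

text \<open>Finite binary sequences are of type \<^typ>\<open>bool list\<close>, infinite ones of type
  \<^typ>\<open>bool stream\<close>; the digits 0 and 1 are \<^term>\<open>False\<close> and \<^term>\<open>True\<close>.\<close>

section \<open>The maps x and y\<close>

datatype sign = Pos | Neg

definition x_map :: "bool stream \<Rightarrow> bool stream" where
  "x_map \<eta> = (case \<eta> of
       False ## False ## \<zeta> \<Rightarrow> False ## \<zeta>
     | False ## True ## \<zeta> \<Rightarrow> True ## False ## \<zeta>
     | True ## \<zeta> \<Rightarrow> True ## True ## \<zeta>)"

text \<open>The recursion for y refers to the inverse of y, so both maps are defined simultaneously: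
  \<^term>\<open>y_rec Pos\<close> is y, and \<^term>\<open>y_rec Neg\<close> is given by the recursion that the equations for
  y force upon its inverse.  That it is the inverse is proved below
  (\<open>inv_y_map\<close>), after which the equations \<open>y_map_00\<close>,
  \<open>y_map_01\<close>, \<open>y_map_1\<close> are the defining ones.\<close>

corec y_rec :: "sign \<Rightarrow> bool stream \<Rightarrow> bool stream" where
  "y_rec e \<eta> =
    (if e = Pos then
       (if shd \<eta> then True ## True ## y_rec Pos (stl \<eta>)
        else if shd (stl \<eta>) then True ## False ## y_rec Neg (stl (stl \<eta>))
        else False ## y_rec Pos (stl (stl \<eta>)))
     else
       (if \<not> shd \<eta> then False ## False ## y_rec Neg (stl \<eta>)
        else if \<not> shd (stl \<eta>) then False ## True ## y_rec Pos (stl (stl \<eta>))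
        else True ## y_rec Neg (stl (stl \<eta>))))"

definition y_map :: "bool stream \<Rightarrow> bool stream" where
  "y_map = y_rec Pos"

lemma x_map_eqs:
  "x_map (False ## False ## \<eta>) = False ## \<eta>"
  "x_map (False ## True ## \<eta>) = True ## False ## \<eta>"
  "x_map (True ## \<eta>) = True ## True ## \<eta>"
  by (simp_all add: x_map_def)

lemma y_rec_eqs:
  "y_rec Pos (False ## False ## \<eta>) = False ## y_rec Pos \<eta>"
  "y_rec Pos (False ## True ## \<eta>) = True ## False ## y_rec Neg \<eta>"
  "y_rec Pos (True ## \<eta>) = True ## True ## y_rec Pos \<eta>"
  "y_rec Neg (False ## \<eta>) = False ## False ## y_rec Neg \<eta>"
  "y_rec Neg (True ## False ## \<eta>) = False ## True ## y_rec Pos \<eta>"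
  "y_rec Neg (True ## True ## \<eta>) = True ## y_rec Neg \<eta>"
  by (subst y_rec.code; simp)+

lemma y_rec_cases:
  obtains \<zeta> where "\<eta> = False ## False ## \<zeta>"
  | \<zeta> where "\<eta> = False ## True ## \<zeta>"
  | \<zeta> where "\<eta> = True ## False ## \<zeta>"
  | \<zeta> where "\<eta> = True ## True ## \<zeta>"
  by (metis (full_types) stream.collapse)

lemma y_rec_snth:
  "y_rec Neg (y_rec Pos \<eta>) !! n = \<eta> !! n \<and> y_rec Pos (y_rec Neg \<eta>) !! n = \<eta> !! n"
proof (induction n arbitrary: \<eta> rule: less_induct)
  case (less n)
  then have IH: "\<And>m \<zeta>. Suc m = n \<or> Suc (Suc m) = n \<Longrightarrow>
      y_rec Neg (y_rec Pos \<zeta>) !! m = \<zeta> !! m \<and> y_rec Pos (y_rec Neg \<zeta>) !! m = \<zeta> !! m"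
    by auto
  show ?case
  proof (cases n)
    case 0
    show ?thesis unfolding 0
      by (rule y_rec_cases[of \<eta>]) (simp_all add: y_rec_eqs)
  next
    case (Suc m)
    show ?thesis
    proof (cases m)
      case 0
      have IH0: "y_rec Neg (y_rec Pos \<zeta>) !! 0 = \<zeta> !! 0" "y_rec Pos (y_rec Neg \<zeta>) !! 0 = \<zeta> !! 0" for \<zeta>
        using IH[of 0 \<zeta>] Suc 0 by auto
      show ?thesis unfolding Suc 0
        by (rule y_rec_cases[of \<eta>]) (use IH0 in \<open>simp_all add: y_rec_eqs\<close>)
    next
      case (Suc k)
      have IHk: "y_rec Neg (y_rec Pos \<zeta>) !! k = \<zeta> !! k" "y_rec Pos (y_rec Neg \<zeta>) !! k = \<zeta> !! k"
        "y_rec Neg (y_rec Pos \<zeta>) !! Suc k = \<zeta> !! Suc k" "y_rec Pos (y_rec Neg \<zeta>) !! Suc k = \<zeta> !! Suc k" for \<zeta>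
        using IH[of k \<zeta>] IH[of "Suc k" \<zeta>] \<open>n = Suc m\<close> Suc by auto
      show ?thesis unfolding \<open>n = Suc m\<close> Suc
        by (rule y_rec_cases[of \<eta>]) (use IHk in \<open>simp_all add: y_rec_eqs\<close>)
    qed
  qed
qed

lemma y_rec_inverse:
  "y_rec Neg (y_rec Pos \<eta>) = \<eta>" "y_rec Pos (y_rec Neg \<eta>) = \<eta>"
  using smap_alt[of id "y_rec Neg (y_rec Pos \<eta>)" \<eta>] smap_alt[of id "y_rec Pos (y_rec Neg \<eta>)" \<eta>]
  by (simp_all add: y_rec_snth stream.map_id)

lemma bij_y_map: "bij y_map"
  unfolding y_map_def by (rule o_bij[of "y_rec Neg"]) (auto simp: y_rec_inverse fun_eq_iff)

lemma inv_y_map: "inv_into UNIV y_map = y_rec Neg"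
  unfolding y_map_def by (rule inv_unique_comp) (auto simp: y_rec_inverse fun_eq_iff)

lemma y_map_00: "y_map (False ## False ## \<eta>) = False ## y_map \<eta>"
  and y_map_01: "y_map (False ## True ## \<eta>) = True ## False ## inv_into UNIV y_map \<eta>"
  and y_map_1: "y_map (True ## \<eta>) = True ## True ## y_map \<eta>"
  by (simp_all add: inv_y_map) (simp_all add: y_map_def y_rec_eqs)

lemma bij_x_map: "bij x_map"
proof (rule o_bij)
  let ?g = "\<lambda>\<eta>. case \<eta> of
       False ## \<zeta> \<Rightarrow> False ## False ## \<zeta>
     | True ## False ## \<zeta> \<Rightarrow> False ## True ## \<zeta>
     | True ## True ## \<zeta> \<Rightarrow> True ## \<zeta>"
  show "?g \<circ> x_map = id"
  proof
    fix \<eta> show "(?g \<circ> x_map) \<eta> = id \<eta>"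
      by (rule y_rec_cases[of \<eta>]) (simp_all add: x_map_eqs)
  qed
  show "x_map \<circ> ?g = id"
  proof
    fix \<eta> show "(x_map \<circ> ?g) \<eta> = id \<eta>"
      by (rule y_rec_cases[of \<eta>]) (simp_all add: x_map_eqs)
  qed
qed

text \<open>The map acting as \<open>h\<close> below \<open>s\<close> and fixing all sequences that do not extend \<open>s\<close>.\<close>

definition localize :: "bool list \<Rightarrow> (bool stream \<Rightarrow> bool stream) \<Rightarrow> bool stream \<Rightarrow> bool stream" where
  "localize s h \<tau> = (if stake (length s) \<tau> = s then s @- h (sdrop (length s) \<tau>) else \<tau>)"

definition x_at :: "bool list \<Rightarrow> bool stream \<Rightarrow> bool stream" where
  "x_at s = localize s x_map"

definition y_at :: "bool list \<Rightarrow> bool stream \<Rightarrow> bool stream" where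
  "y_at s = localize s y_map"

lemma bij_localize:
  assumes "bij h"
  shows "bij (localize s h)"
proof (rule o_bij)
  have inv: "h (inv_into UNIV h \<eta>) = \<eta>" "inv_into UNIV h (h \<eta>) = \<eta>" for \<eta>
    using assms by (simp_all add: bij_is_surj surj_f_inv_f bij_is_inj)
  have [simp]: "stake (length s) (s @- \<eta>) = s" "sdrop (length s) (s @- \<eta>) = \<eta>" for \<eta> :: "bool stream"
    by (simp_all add: stake_shift sdrop_shift)
  have [simp]: "s @- sdrop (length s) \<tau> = \<tau>" if "stake (length s) \<tau> = s" for \<tau>
    using stake_sdrop[of "length s" \<tau>] that by simp
  show "localize s (inv_into UNIV h) \<circ> localize s h = id" "localize s h \<circ> localize s (inv_into UNIV h) = id"
    by (auto simp: localize_def fun_eq_iff inv)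
qed

section \<open>The groups G and F\<close>

text \<open>The indices allowed for the y-generators: not empty, not constant.\<close>

definition y_index :: "bool list \<Rightarrow> bool" where
  "y_index s \<longleftrightarrow> s \<noteq> [] \<and> (\<forall>k. s \<noteq> replicate k False \<and> s \<noteq> replicate k True)"

text \<open>The product of \<^term>\<open>BijGroup\<close> is composition of functions written on the left,
  whereas all actions here are right actions.  A subset of a group generates the same subgroup
  with respect to either order of multiplication; the order matters only for the evaluation of
  words, see \<open>word_map\<close>.\<close>

definition group_G :: "(bool stream \<Rightarrow> bool stream) set" where
  "group_G = generate (BijGroup UNIV) (range x_at \<union> y_at ` {s. y_index s})"

definition thompson_F :: "(bool stream \<Rightarrow> bool stream) set" where
  "thompson_F = generate (BijGroup UNIV) (range x_at)"

text \<open>\<open>acts_on f s s'\<close>: \<open>f\<close> acts on \<open>s\<close>, and \<open>s \<cdot> f = s'\<close>.\<close>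

definition acts_on :: "(bool stream \<Rightarrow> bool stream) \<Rightarrow> bool list \<Rightarrow> bool list \<Rightarrow> bool" where
  "acts_on f s s' \<longleftrightarrow> (\<forall>\<xi>. f (s @- \<xi>) = s' @- \<xi>)"

section \<open>Words\<close>

text \<open>Letters are the generators and their formal inverses; a power with an integer exponent
  abbreviates the corresponding block of equal letters.\<close>

datatype letter = X "bool list" sign | Y "bool list" sign

type_synonym word = "letter list"

fun letter_map :: "letter \<Rightarrow> bool stream \<Rightarrow> bool stream" where
  "letter_map (X s Pos) = x_at s"
| "letter_map (X s Neg) = inv_into UNIV (x_at s)"
| "letter_map (Y s Pos) = y_at s"
| "letter_map (Y s Neg) = inv_into UNIV (y_at s)"

text \<open>Right action: the leftmost letter is applied first.\<close>

definition word_map :: "word \<Rightarrow> bool stream \<Rightarrow> bool stream" where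
  "word_map w = fold letter_map w"

definition X_word :: "word \<Rightarrow> bool" where
  "X_word w \<longleftrightarrow> (\<forall>l \<in> set w. \<exists>s e. l = X s e)"

definition S_word :: "word \<Rightarrow> bool" where
  "S_word w \<longleftrightarrow> (\<forall>l \<in> set w. (\<exists>s e. l = X s e) \<or> (\<exists>s e. y_index s \<and> l = Y s e))"

definition sign_of :: "int \<Rightarrow> sign" where
  "sign_of t = (if t \<ge> 0 then Pos else Neg)"

definition x_pow :: "bool list \<Rightarrow> int \<Rightarrow> word" where
  "x_pow s t = replicate (nat \<bar>t\<bar>) (X s (sign_of t))"

definition y_pow :: "bool list \<Rightarrow> int \<Rightarrow> word" where
  "y_pow s t = replicate (nat \<bar>t\<bar>) (Y s (sign_of t))"

text \<open>The list \<open>[(s\<^sub>1, t\<^sub>1), \<dots>, (s\<^sub>n, t\<^sub>n)]\<close> stands for the Y-word with the factors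
  \<open>y_pow s\<^sub>i t\<^sub>i\<close>.\<close>

type_synonym powers = "(bool list \<times> int) list"

definition Y_word_of :: "powers \<Rightarrow> word" where
  "Y_word_of ps = concat (map (\<lambda>(s, t). y_pow s t) ps)"

section \<open>Standard forms\<close>

definition index_less :: "bool list \<Rightarrow> bool list \<Rightarrow> bool" where
  "index_less s t \<longleftrightarrow> strict_prefix t s \<or>
     (s \<parallel> t \<and> (\<exists>i < min (length s) (length t). take i s = take i t \<and> s ! i < t ! i))"

definition Y_powers :: "powers \<Rightarrow> bool" where
  "Y_powers ps \<longleftrightarrow> (\<forall>(s, t) \<in> set ps. y_index s \<and> t \<noteq> 0)"

definition standard_form :: "word \<Rightarrow> powers \<Rightarrow> bool" where
  "standard_form f ps \<longleftrightarrow> X_word f \<and> Y_powers ps \<and>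
     (\<forall>i < length ps. \<forall>j < length ps. i < j \<longrightarrow> index_less (fst (ps ! i)) (fst (ps ! j)))"

definition weak_standard_form :: "word \<Rightarrow> powers \<Rightarrow> bool" where
  "weak_standard_form f ps \<longleftrightarrow> X_word f \<and> Y_powers ps \<and>
     (\<forall>i < length ps. \<forall>j < length ps. strict_prefix (fst (ps ! j)) (fst (ps ! i)) \<longrightarrow> i < j)"

section \<open>Potential cancellations\<close>

datatype symbol = Bit bool | Ys sign

text \<open>The string inserted immediately after the finite sequence \<open>p\<close>.\<close>

definition inserted :: "powers \<Rightarrow> bool list \<Rightarrow> symbol list" where
  "inserted ps p = concat (map (\<lambda>(s, t). if s = p then replicate (nat \<bar>t\<bar>) (Ys (sign_of t)) else []) ps)"

definition calculation :: "powers \<Rightarrow> bool stream \<Rightarrow> symbol stream" where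
  "calculation ps \<tau> = flat (smap (\<lambda>k. inserted ps (stake k \<tau>) @ [Bit (\<tau> !! k)]) nats)"

inductive substitution :: "symbol list \<Rightarrow> symbol list \<Rightarrow> bool" where
  "substitution (u @ [Ys Pos, Bit False, Bit False] @ v) (u @ [Bit False, Ys Pos] @ v)"
| "substitution (u @ [Ys Pos, Bit False, Bit True] @ v) (u @ [Bit True, Bit False, Ys Neg] @ v)"
| "substitution (u @ [Ys Pos, Bit True] @ v) (u @ [Bit True, Bit True, Ys Pos] @ v)"
| "substitution (u @ [Ys Neg, Bit False] @ v) (u @ [Bit False, Bit False, Ys Neg] @ v)"
| "substitution (u @ [Ys Neg, Bit True, Bit False] @ v) (u @ [Bit False, Bit True, Ys Pos] @ v)"
| "substitution (u @ [Ys Neg, Bit True, Bit True] @ v) (u @ [Bit True, Ys Neg] @ v)"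

definition cancelling :: "symbol list \<Rightarrow> bool" where
  "cancelling a \<longleftrightarrow> (\<exists>\<epsilon>1 \<sigma> \<epsilon>2. a = [Ys \<epsilon>1] @ map Bit \<sigma> @ [Ys \<epsilon>2]) \<and>
     (\<exists>b. substitution\<^sup>*\<^sup>* a b \<and> (sublist [Ys Pos, Ys Neg] b \<or> sublist [Ys Neg, Ys Pos] b))"

definition potential_cancellation :: "powers \<Rightarrow> bool" where
  "potential_cancellation ps \<longleftrightarrow>
     (\<exists>\<tau> k n. cancelling (stake n (sdrop k (calculation ps \<tau>))))"

section \<open>Potential contractions\<close>

text \<open>The three letters need not be adjacent (\<^const>\<open>subseq\<close>, not \<^const>\<open>sublist\<close>): in a standard
  form they can be separated by powers or by letters commuting with them, and the contraction is
  possible all the same.  For instance, with the exponents written as superscripts,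
  \<open>y_s0 (y_s10)\<^sup>-\<^sup>2 y_s11 = (x_s)\<^sup>-\<^sup>1 (y_s01)\<^sup>-\<^sup>1 y_s\<close>.\<close>

definition potential_contraction :: "powers \<Rightarrow> bool" where
  "potential_contraction ps \<longleftrightarrow> (\<exists>s.
      (subseq [Y (s @ [False]) Pos, Y (s @ [True, False]) Neg, Y (s @ [True, True]) Pos] (Y_word_of ps) \<and>
       (\<forall>e. Y (s @ [True]) e \<notin> set (Y_word_of ps))) \<or>
      (subseq [Y (s @ [False, False]) Neg, Y (s @ [False, True]) Pos, Y (s @ [True]) Neg] (Y_word_of ps) \<and>
       (\<forall>e. Y (s @ [False]) e \<notin> set (Y_word_of ps))))"

section \<open>Normal forms in F\<close>

text \<open>Since words act from the right, the generators \<open>x\<^sub>k\<close> of index \<open>1\<^sup>k\<close> satisfy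
  \<open>x\<^sub>i\<^sup>-\<^sup>1 x\<^sub>j x\<^sub>i = x\<^sub>j\<^sub>+\<^sub>1\<close> for \<open>i < j\<close>, hence normal forms are a positive word with increasing indices
  followed by a negative word with decreasing indices.  With the negative powers in front
  (which is right for left actions) normal forms would not be unique:
  both sides of \<open>F_relation_1\<close> would be normal forms.\<close>

definition F_normal_form :: "word \<Rightarrow> bool" where
  "F_normal_form w \<longleftrightarrow> w = [] \<or> (\<exists>n (a :: nat \<Rightarrow> nat) (b :: nat \<Rightarrow> nat).
     (a n = 0 \<longleftrightarrow> b n \<noteq> 0) \<and>
     (\<forall>k < n. a k > 0 \<and> b k > 0 \<longrightarrow> a (k + 1) > 0 \<or> b (k + 1) > 0) \<and>
     w = concat (map (\<lambda>k. x_pow (replicate k True) (int (a k))) [0..<n + 1]) @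
         concat (map (\<lambda>k. x_pow (replicate k True) (- int (b k))) (rev [0..<n + 1])))"

lemma F_relation_1:
  "word_map [X [] Neg, X [True] Pos, X [] Pos] = word_map [X [True, True] Pos]"
proof
  fix \<eta>
  have [simp]: "x_at [] = x_map"
    by (simp add: x_at_def localize_def fun_eq_iff)
  obtain \<zeta> where \<zeta>: "\<eta> = x_map \<zeta>"
    using bij_x_map by (metis bij_pointE)
  have i: "inv_into UNIV x_map (x_map \<xi>) = \<xi>" for \<xi>
    by (simp add: bij_x_map bij_is_inj)
  have "x_map (x_at [True] \<zeta>) = x_at [True, True] (x_map \<zeta>)"
    by (rule y_rec_cases[of \<zeta>]) (simp_all add: x_map_eqs x_at_def localize_def)
  then show "word_map [X [] Neg, X [True] Pos, X [] Pos] \<eta> = word_map [X [True, True] Pos] \<eta>"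
    by (simp add: word_map_def \<zeta> i)
qed

section \<open>Moves\<close>

text \<open>The part \<open>f\<close> of a (weak) standard form is regarded as an element of F, so X-words
  representing the same element of F may be exchanged (\<open>F_element\<close>).  The expansion
  moves may be undone (\<open>contract_pos\<close>, \<open>contract_neg\<close>), which is what a
  potential contraction is about; the remaining moves never shorten
  \<open>y_s0 (y_s10)\<^sup>-\<^sup>1 y_s11\<close> to \<open>(x_s)\<^sup>-\<^sup>1 y_s\<close>.\<close>

inductive move :: "word \<Rightarrow> word \<Rightarrow> bool" where
  F_element: "\<lbrakk>X_word f; X_word f'; word_map f = word_map f'\<rbrakk> \<Longrightarrow> move (u @ f @ v) (u @ f' @ v)"
| rearrange: "acts_on (word_map [X s e]) t t' \<Longrightarrow>
    move (u @ y_pow t i @ [X s e] @ v) (u @ [X s e] @ y_pow t' i @ v)"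
| expand_pos: "move (u @ [Y s Pos] @ v)
    (u @ [X s Pos, Y (s @ [False]) Pos, Y (s @ [True, False]) Neg, Y (s @ [True, True]) Pos] @ v)"
| expand_neg: "move (u @ [Y s Neg] @ v)
    (u @ [X s Neg, Y (s @ [False, False]) Neg, Y (s @ [False, True]) Pos, Y (s @ [True]) Neg] @ v)"
| contract_pos: "move
    (u @ [X s Pos, Y (s @ [False]) Pos, Y (s @ [True, False]) Neg, Y (s @ [True, True]) Pos] @ v)
    (u @ [Y s Pos] @ v)"
| contract_neg: "move
    (u @ [X s Neg, Y (s @ [False, False]) Neg, Y (s @ [False, True]) Pos, Y (s @ [True]) Neg] @ v)
    (u @ [Y s Neg] @ v)"
| commute: "s \<parallel> t \<Longrightarrow> move (u @ [Y s d, Y t e] @ v) (u @ [Y t e, Y s d] @ v)"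
| cancel: "move (u @ y_pow s i @ y_pow s (- i) @ v) (u @ v)"
| ER_pos: "\<lbrakk>weak_standard_form f (ps @ [(u, 1)] @ qs);
     list_all2 (\<lambda>(s, t) (s', t'). acts_on (word_map [X u Pos]) s s' \<and> t' = t) ps ps'\<rbrakk> \<Longrightarrow>
    move (f @ Y_word_of (ps @ [(u, 1)] @ qs))
      (f @ [X u Pos] @ Y_word_of ps' @
        [Y (u @ [False]) Pos, Y (u @ [True, False]) Neg, Y (u @ [True, True]) Pos] @ Y_word_of qs)"
| ER_neg: "\<lbrakk>weak_standard_form f (ps @ [(u, -1)] @ qs);
     list_all2 (\<lambda>(s, t) (s', t'). acts_on (word_map [X u Neg]) s s' \<and> t' = t) ps ps'\<rbrakk> \<Longrightarrow>
    move (f @ Y_word_of (ps @ [(u, -1)] @ qs))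
      (f @ [X u Neg] @ Y_word_of ps' @
        [Y (u @ [False, False]) Neg, Y (u @ [False, True]) Pos, Y (u @ [True]) Neg] @ Y_word_of qs)"

text \<open>All words occurring in a sequence of moves are S-words.\<close>

definition converts_to :: "word \<Rightarrow> word \<Rightarrow> bool" where
  "converts_to = (\<lambda>v w. S_word v \<and> S_word w \<and> move v w)\<^sup>*\<^sup>*"

definition normal_form_of :: "(bool stream \<Rightarrow> bool stream) \<Rightarrow> word \<Rightarrow> bool" where
  "normal_form_of g w \<longleftrightarrow> (\<exists>f ps. w = f @ Y_word_of ps \<and> word_map w = g \<and>
     standard_form f ps \<and> \<not> potential_contraction ps \<and> \<not> potential_cancellation ps \<and>
     word_map f \<in> thompson_F \<and> X_word f \<and> F_normal_form f)"

end

theory Submission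
  imports Defs
begin

text \<open>The Y-part of a standard form is a finite binary tree with integer labels.  If the digits and y
  act on the projective line by integer matrices, then a Y-part without potential cancellations
  moves the base vertex of the 3-regular tree of \<open>PGL\<^sub>2(\<rat>\<^sub>2)\<close>, at every point of
  the Cantor set, along a path without backtracking, while F acts locally by matrices that fix the
  base vertex.  So the first edge of this path is an invariant of the coset modulo F.  If it is
  constant on a cone and equal to the edge of \<open>y\<^sub>s\<^sup>\<plusminus>\<^sup>1\<close>, the absence of potential
  contractions forces the letter \<open>y\<^sub>s\<^sup>\<plusminus>\<^sup>1\<close> to occur; removing it and descending into the
  tree yields uniqueness.

  For existence, letters are appended one at a time: the labels are first pushed away from the root
  by expansions, so that the new letter can pass; a new \<open>y\<^sub>s\<^sup>\<plusminus>\<^sup>1\<close> that cancels somewhere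
  is expanded along the tree until it meets the letters it cancels against.  Contractions decrease
  the number of letters and preserve the absence of potential cancellations.\<close>

section \<open>Letters as maps\<close>

text \<open>A cancellation happens at single points of the Cantor set, whereas an expansion acts on
  a whole cone, so one new letter may cancel along some branches and not along others. For this
  reason a tree records the set of all its first edges. A single letter has the edge
  \<open>Plus\<close> or \<open>Minus\<close>, and the digits permute the three edges other than
  \<open>Base\<close>; \<open>Third\<close> belongs to no single letter. A node with edge
  \<open>Third\<close> at every point therefore has label 0, and this is what makes contractions
  unavoidable in one half of the proof and stops the expansions in the other. Representing y^-1 by
  diag(1, 2), twice the inverse of diag(2, 1), turns the six substitution rules into exact
  identities of integer matrices and makes y y^-1 equal to 2. A string of digits between two letters
  y^+-1 is then a potential cancellation exactly if its matrix vanishes modulo 2. (M1) carries X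
  letters only to the left. All rewriting is therefore done modulo an X-word on the left, and the
  classical normal form of F is applied to that word at the end.\<close>

fun opposite :: "sign \<Rightarrow> sign" where
  "opposite Pos = Neg"
| "opposite Neg = Pos"

fun x_sgn :: "sign \<Rightarrow> bool stream \<Rightarrow> bool stream" where
  "x_sgn Pos = x_map"
| "x_sgn Neg = inv_into UNIV x_map"

lemma bij_x_sgn [simp]: "bij (x_sgn e)"
  by (cases e) (simp_all add: bij_x_map bij_imp_bij_inv)

lemma bij_y_rec [simp]: "bij (y_rec e)"
  using bij_y_map inv_y_map bij_imp_bij_inv[OF bij_y_map] by (cases e) (simp_all add: y_map_def)

lemma x_sgn_opposite [simp]: "x_sgn (opposite e) (x_sgn e \<eta>) = \<eta>"
  by (cases e) (simp_all add: bij_x_map bij_is_inj bij_is_surj surj_f_inv_f)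

lemma y_rec_opposite [simp]: "y_rec (opposite e) (y_rec e \<eta>) = \<eta>"
  by (cases e) (simp_all add: y_rec_inverse)

lemma x_sgn_Neg_eqs [simp]:
  "x_sgn Neg (False ## \<eta>) = False ## False ## \<eta>"
  "x_sgn Neg (True ## False ## \<eta>) = False ## True ## \<eta>"
  "x_sgn Neg (True ## True ## \<eta>) = True ## \<eta>"
  by (metis bij_x_map bij_is_inj inv_f_f x_map_eqs x_sgn.simps(2))+

lemma x_sgn_Pos_eqs [simp]:
  "x_sgn Pos (False ## False ## \<eta>) = False ## \<eta>"
  "x_sgn Pos (False ## True ## \<eta>) = True ## False ## \<eta>"
  "x_sgn Pos (True ## \<eta>) = True ## True ## \<eta>"
  by (simp_all add: x_map_eqs)

declare x_sgn.simps [simp del]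

lemma localize_shift [simp]: "localize s h (s @- \<zeta>) = s @- h \<zeta>"
  by (simp add: localize_def stake_shift sdrop_shift)

lemma stake_shift_prefix: "stake (length s) (t @- \<zeta>) = s \<Longrightarrow> prefix s t \<or> prefix t s"
  by (metis append_eq_conv_conj prefixI prefix_order.dual_order.trans stake_shift
      linorder_linear take_all prefix_def diff_is_0_eq stake.simps(1) append_Nil2)

lemma localize_parallel [simp]: "s \<parallel> t \<Longrightarrow> localize s h (t @- \<zeta>) = t @- \<zeta>"
  using stake_shift_prefix[of s t \<zeta>] by (auto simp: localize_def)

lemma localize_outside: "stake (length s) \<tau> \<noteq> s \<Longrightarrow> localize s h \<tau> = \<tau>"
  by (simp add: localize_def)

lemma stream_inside_cases:
  obtains \<zeta> where "\<tau> = s @- \<zeta>" | "stake (length s) \<tau> \<noteq> s"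
  by (metis stake_sdrop)

lemma localize_Nil [simp]: "localize [] h = h"
  by (simp add: localize_def fun_eq_iff)

lemma localize_Cons:
  "localize (b # s) h (c ## \<zeta>) = (if b = c then c ## localize s h \<zeta> else c ## \<zeta>)"
  by (auto simp: localize_def)

lemma localize_id [simp]: "localize s id = id" "localize s (\<lambda>x. x) = id"
  by (auto simp: localize_def fun_eq_iff) (metis stake_sdrop)+

lemma localize_comp: "localize s (g \<circ> h) = localize s g \<circ> localize s h"
proof
  fix \<tau> show "localize s (g \<circ> h) \<tau> = (localize s g \<circ> localize s h) \<tau>"
    by (cases rule: stream_inside_cases[of \<tau> s]) (auto simp: localize_outside)
qed

lemma localize_append: "localize (s @ t) h = localize s (localize t h)"
proof
  fix \<tau> :: "bool stream"
  have eq: "stake (length (s @ t)) \<tau> = stake (length s) \<tau> @ stake (length t) (sdrop (length s) \<tau>)"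
    by (metis length_append stake_add)
  show "localize (s @ t) h \<tau> = localize s (localize t h) \<tau>"
  proof (cases "stake (length s) \<tau> = s")
    case True
    then have "localize s (localize t h) \<tau> = s @- localize t h (sdrop (length s) \<tau>)"
      by (simp add: localize_def)
    moreover have "\<tau> = s @- sdrop (length s) \<tau>" using True by (metis stake_sdrop)
    ultimately show ?thesis using eq True by (auto simp: localize_def sdrop_add)
  next
    case False
    then have "stake (length (s @ t)) \<tau> \<noteq> s @ t"
      by (metis eq append_eq_append_conv length_stake)
    then show ?thesis unfolding localize_outside[OF False] by (rule localize_outside)
  qed
qed

lemma localize_commute:
  assumes "s \<parallel> t" shows "localize s g (localize t h \<tau>) = localize t h (localize s g \<tau>)"
proof (cases rule: stream_inside_cases[of \<tau> s])
  case (1 \<zeta>)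
  have "t \<parallel> s" using assms by auto
  then show ?thesis using 1 by simp
next
  case s: 2
  show ?thesis
  proof (cases rule: stream_inside_cases[of \<tau> t])
    case (1 \<zeta>)
    then show ?thesis using assms by simp
  qed (use s in \<open>simp add: localize_outside\<close>)
qed

lemma inv_localize:
  assumes "bij h" shows "inv_into UNIV (localize s h) = localize s (inv_into UNIV h)"
proof (rule inv_unique_comp)
  show "localize s h \<circ> localize s (inv_into UNIV h) = id"
    using assms by (simp add: localize_comp[symmetric] bij_is_surj surj_iff[THEN iffD1])
  show "localize s (inv_into UNIV h) \<circ> localize s h = id"
    using assms by (simp add: localize_comp[symmetric] bij_is_inj)
qed

lemma letter_map_X: "letter_map (X s e) = localize s (x_sgn e)"
  by (cases e) (simp_all add: x_at_def inv_localize bij_x_map x_sgn.simps)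

lemma letter_map_Y: "letter_map (Y s e) = localize s (y_rec e)"
  by (cases e) (simp_all add: y_at_def inv_localize bij_y_map inv_y_map, simp add: y_map_def)

lemma word_map_Nil [simp]: "word_map [] = id"
  by (simp add: word_map_def fun_eq_iff)

lemma word_map_Cons: "word_map (l # w) = word_map w \<circ> letter_map l"
  by (simp add: word_map_def fun_eq_iff)

lemma word_map_append: "word_map (v @ w) = word_map w \<circ> word_map v"
  by (simp add: word_map_def fun_eq_iff)

lemma word_map_X [simp]: "word_map [X s e] = localize s (x_sgn e)"
  by (simp add: word_map_Cons letter_map_X)

lemma bij_letter_map: "bij (letter_map l)"
  by (cases l) (simp_all add: letter_map_X letter_map_Y bij_localize)

lemma bij_word_map: "bij (word_map w)"
proof (induction w)
  case (Cons l w)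
  then show ?case unfolding word_map_Cons by (rule bij_comp[OF bij_letter_map])
qed (simp only: word_map_Nil bij_id)

lemma word_map_replicate_Y:
  "word_map (replicate n (Y s e)) = localize s (y_rec e ^^ n)"
proof (induction n)
  case (Suc n)
  then show ?case
    unfolding funpow_Suc_right replicate_Suc word_map_Cons letter_map_Y localize_comp by simp
qed (simp add: funpow_0 id_def[symmetric])

section \<open>Nonconstant sequences\<close>

lemma sconst_eq_shift: "sconst b = t @- \<zeta> \<Longrightarrow> t = replicate (length t) b \<and> \<zeta> = sconst b"
proof (induction t)
  case (Cons a t)
  then show ?case by (metis length_Cons replicate_Suc shift.simps(2) siterate.simps(1,2) id_apply stream.sel)
qed simp

lemma replicate_shift_sconst: "replicate n b @- sconst b = sconst b"
proof (induction n)
  case (Suc n)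
  then show ?case by (metis replicate_Suc shift.simps(2) siterate.code id_apply)
qed simp

text \<open>A cone avoids both constant sequences exactly if its index is allowed. In this form the
  invariance under F is visible, since every \<open>x_s\<close> fixes both constant
  sequences.\<close>

lemma y_index_iff: "y_index t \<longleftrightarrow> (\<forall>b \<zeta>. t @- \<zeta> \<noteq> sconst b)"
proof
  assume "y_index t"
  then show "\<forall>b \<zeta>. t @- \<zeta> \<noteq> sconst b"
    unfolding y_index_def by (metis (full_types) sconst_eq_shift)
next
  assume *: "\<forall>b \<zeta>. t @- \<zeta> \<noteq> sconst b"
  then have "t \<noteq> replicate k b" for k b
    using replicate_shift_sconst by metis
  moreover from this[of 0] have "t \<noteq> []" by simp
  ultimately show "y_index t" unfolding y_index_def by blast
qed

lemma y_index_append: "y_index s \<Longrightarrow> y_index (s @ t)"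
  by (auto simp: y_index_iff)

lemma y_index_set: "y_index s \<longleftrightarrow> True \<in> set s \<and> False \<in> set s"
proof -
  have "(\<exists>k. s = replicate k b) \<longleftrightarrow> (\<not> b) \<notin> set s" for b
  proof
    assume *: "(\<not> b) \<notin> set s"
    have "\<forall>x\<in>set s. x = b"
    proof
      fix x assume "x \<in> set s"
      with * show "x = b" by (cases x; cases b) auto
    qed
    then show "\<exists>k. s = replicate k b" using replicate_length_same[of s b] by metis
  qed auto
  from this[of True] this[of False] show ?thesis
    unfolding y_index_def by (metis (full_types) empty_iff list.set(1))
qed

lemma sconst_code: "sconst b = b ## sconst b"
  by (metis id_apply siterate.code)

lemma x_sgn_sconst [simp]: "x_sgn e (sconst b) = sconst b"
proof -
  have *: "b ## b ## sconst b = sconst b" "b ## sconst b = sconst b" for b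
    using sconst_code[of b] by metis+
  have "x_sgn e (b ## b ## sconst b) = b ## sconst b \<or> x_sgn e (b ## b ## sconst b) = b ## b ## b ## sconst b"
    by (cases e; cases b) simp_all
  then show ?thesis by (metis *)
qed

lemma localize_x_sgn_sconst [simp]: "localize s (x_sgn e) (sconst b) = sconst b"
proof (cases rule: stream_inside_cases[of "sconst b" s])
  case (1 \<zeta>)
  then have "\<zeta> = sconst b" using sconst_eq_shift[OF 1] by blast
  then show ?thesis using 1 by (metis localize_shift x_sgn_sconst)
qed (simp add: localize_outside)

lemma acts_on_y_index:
  assumes "acts_on (word_map [X s e]) t t'" "y_index t"
  shows "y_index t'"
  unfolding y_index_iff
proof (intro allI notI)
  fix b \<zeta> assume *: "t' @- \<zeta> = sconst b"
  have "word_map [X s e] (t @- \<zeta>) = word_map [X s e] (sconst b)"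
    using assms(1) * by (simp add: acts_on_def)
  then have "t @- \<zeta> = sconst b"
    by (meson bij_is_inj bij_word_map injD)
  then show False using assms(2) by (auto simp: y_index_iff)
qed

lemma acts_on_append: "acts_on f t t' \<Longrightarrow> acts_on f (t @ u) (t' @ u)"
  by (simp add: acts_on_def)

lemma acts_on_x [simp]:
  "acts_on (word_map [X s Pos]) (s @ [False, False]) (s @ [False])"
  "acts_on (word_map [X s Pos]) (s @ [False, True]) (s @ [True, False])"
  "acts_on (word_map [X s Pos]) (s @ [True]) (s @ [True, True])"
  "acts_on (word_map [X s Neg]) (s @ [False]) (s @ [False, False])"
  "acts_on (word_map [X s Neg]) (s @ [True, False]) (s @ [False, True])"
  "acts_on (word_map [X s Neg]) (s @ [True, True]) (s @ [True])"
  by (simp_all add: acts_on_def)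

lemma acts_on_parallel: "s \<parallel> t \<Longrightarrow> acts_on (word_map [X s e]) t t"
  by (simp add: acts_on_def)

section \<open>Convertibility of words in context\<close>

text \<open>Quantifying over all contexts lets factors be rewritten independently
  (\<open>conv_append\<close>). The equality of the maps is carried along, so every conversion also
  proves that the represented element is unchanged.\<close>

definition conv :: "word \<Rightarrow> word \<Rightarrow> bool" where
  "conv w w' \<longleftrightarrow> S_word w \<and> S_word w' \<and> word_map w = word_map w' \<and>
     (\<forall>u v. S_word u \<longrightarrow> S_word v \<longrightarrow> converts_to (u @ w @ v) (u @ w' @ v))"

lemma S_word_append [simp]: "S_word (u @ v) \<longleftrightarrow> S_word u \<and> S_word v"
  by (auto simp: S_word_def)

lemma S_word_Nil [simp]: "S_word []"
  by (simp add: S_word_def)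

lemma S_word_Cons [simp]:
  "S_word (X s e # w) \<longleftrightarrow> S_word w" "S_word (Y s e # w) \<longleftrightarrow> y_index s \<and> S_word w"
  by (auto simp: S_word_def)

lemma X_word_append [simp]: "X_word (u @ v) \<longleftrightarrow> X_word u \<and> X_word v"
  by (auto simp: X_word_def)

lemma X_word_simps [simp]: "X_word []" "X_word (X s e # w) \<longleftrightarrow> X_word w" "\<not> X_word (Y s e # w)"
  by (auto simp: X_word_def)

lemma X_word_S_word: "X_word w \<Longrightarrow> S_word w"
  by (auto simp: X_word_def S_word_def)

lemma converts_to_trans [trans]: "converts_to u v \<Longrightarrow> converts_to v w \<Longrightarrow> converts_to u w"
  unfolding converts_to_def by (rule rtranclp_trans)

lemma conv_refl: "S_word w \<Longrightarrow> conv w w"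
  by (simp add: conv_def converts_to_def)

lemma conv_trans [trans]: "conv u v \<Longrightarrow> conv v w \<Longrightarrow> conv u w"
  unfolding conv_def by (metis converts_to_trans)

lemma conv_append: 
  assumes "conv a b" "conv c d" shows "conv (a @ c) (b @ d)"
  unfolding conv_def
proof (intro conjI allI impI)
  fix u v assume uv: "S_word u" "S_word v"
  have S: "S_word a" "S_word b" "S_word c" "S_word d" using assms by (auto simp: conv_def)
  have "converts_to (u @ a @ (c @ v)) (u @ b @ (c @ v))"
    using assms(1) uv S unfolding conv_def by (meson S_word_append)
  also have "converts_to ((u @ b) @ c @ v) ((u @ b) @ d @ v)"
    using assms(2) uv S unfolding conv_def by (meson S_word_append)
  then have "converts_to (u @ b @ (c @ v)) (u @ (b @ d) @ v)" by simp
  finally show "converts_to (u @ (a @ c) @ v) (u @ (b @ d) @ v)" by simp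
qed (use assms in \<open>auto simp: conv_def word_map_append\<close>)

lemma conv_append_left: "conv b c \<Longrightarrow> S_word a \<Longrightarrow> conv (a @ b) (a @ c)"
  by (simp add: conv_append conv_refl)

lemma conv_append_right: "conv a b \<Longrightarrow> S_word c \<Longrightarrow> conv (a @ c) (b @ c)"
  by (simp add: conv_append conv_refl)

lemma conv_S_word: "conv w w' \<Longrightarrow> S_word w" "conv w w' \<Longrightarrow> S_word w'"
  by (simp_all add: conv_def)

lemma conv_move:
  assumes "S_word w" "S_word w'" "word_map w = word_map w'"
    "\<And>u v. move (u @ w @ v) (u @ w' @ v)"
  shows "conv w w'"
  using assms by (auto simp: conv_def converts_to_def intro!: r_into_rtranclp)

lemma conv_F_element: "X_word f \<Longrightarrow> X_word g \<Longrightarrow> word_map f = word_map g \<Longrightarrow> conv f g"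
  by (rule conv_move) (auto intro: move.F_element X_word_S_word)

lemma word_map_y_pow: "word_map (y_pow s i) = localize s (y_rec (sign_of i) ^^ nat \<bar>i\<bar>)"
  by (simp add: y_pow_def word_map_replicate_Y)

lemma S_word_y_pow: "S_word (y_pow s i) \<longleftrightarrow> i = 0 \<or> y_index s"
  by (auto simp: S_word_def y_pow_def)

text \<open>This is conjugation: a bijection that carries the cone of \<open>t\<close> rigidly onto
  the cone of \<open>t'\<close> also matches the complements of these cones, where both localized
  maps are the identity.\<close>

lemma acts_on_localize:
  assumes "acts_on (word_map [X s e]) t t'"
  shows "localize s (x_sgn e) (localize t h \<tau>) = localize t' h (localize s (x_sgn e) \<tau>)"
proof (cases rule: stream_inside_cases[of \<tau> t])
  case (1 \<zeta>)
  then show ?thesis using assms by (simp add: acts_on_def)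
next
  case 2
  have "stake (length t') (localize s (x_sgn e) \<tau>) \<noteq> t'"
  proof
    assume "stake (length t') (localize s (x_sgn e) \<tau>) = t'"
    then obtain \<zeta> where "localize s (x_sgn e) \<tau> = t' @- \<zeta>" by (metis stake_sdrop)
    then have "localize s (x_sgn e) \<tau> = localize s (x_sgn e) (t @- \<zeta>)"
      using assms by (simp add: acts_on_def)
    then have "\<tau> = t @- \<zeta>" by (meson bij_is_inj bij_localize bij_x_sgn injD)
    then show False using 2 by (simp add: stake_shift)
  qed
  then show ?thesis using 2 by (simp add: localize_outside)
qed

lemma conv_rearrange:
  assumes "acts_on (word_map [X s e]) t t'" "y_index t"
  shows "conv (y_pow t i @ [X s e]) ([X s e] @ y_pow t' i)"
proof (rule conv_move)
  show "move (u @ (y_pow t i @ [X s e]) @ v) (u @ ([X s e] @ y_pow t' i) @ v)" for u v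
    using move.rearrange[OF assms(1), of u i v] by simp
  show "word_map (y_pow t i @ [X s e]) = word_map ([X s e] @ y_pow t' i)"
    using acts_on_localize[OF assms(1)] by (simp add: fun_eq_iff word_map_append word_map_y_pow del: append_Cons append_Nil)
qed (use assms acts_on_y_index[OF assms] in \<open>auto simp: S_word_y_pow\<close>)

lemma conv_commute:
  assumes "s \<parallel> t" "y_index s" "y_index t"
  shows "conv [Y s d, Y t e] [Y t e, Y s d]"
proof (rule conv_move)
  show "move (u @ [Y s d, Y t e] @ v) (u @ [Y t e, Y s d] @ v)" for u v
    using move.commute[OF assms(1)] .
  show "word_map [Y s d, Y t e] = word_map [Y t e, Y s d]"
    using localize_commute[OF assms(1)] by (simp add: fun_eq_iff word_map_Cons letter_map_Y)
qed (use assms in auto)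

definition sign_int :: "sign \<Rightarrow> int" where
  "sign_int e = (case e of Pos \<Rightarrow> 1 | Neg \<Rightarrow> -1)"

lemma y_pow_sign_int: "y_pow s (sign_int e) = [Y s e]" "y_pow s (- sign_int e) = [Y s (opposite e)]"
  by (cases e; simp add: y_pow_def sign_of_def sign_int_def)+

lemma conv_cancel:
  assumes "y_index s" shows "conv [Y s e, Y s (opposite e)] []"
proof (rule conv_move)
  show "move (u @ [Y s e, Y s (opposite e)] @ v) (u @ [] @ v)" for u v
    using move.cancel[of u s "sign_int e" v] by (simp add: y_pow_sign_int)
  have "localize s (y_rec (opposite e)) \<circ> localize s (y_rec e) = id"
    unfolding localize_comp[symmetric] by (simp add: comp_def)
  then show "word_map [Y s e, Y s (opposite e)] = word_map []"
    by (simp add: word_map_Cons letter_map_Y)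
qed (use assms in auto)

fun expansion :: "bool list \<Rightarrow> sign \<Rightarrow> word" where
  "expansion s Pos =
     [X s Pos, Y (s @ [False]) Pos, Y (s @ [True, False]) Neg, Y (s @ [True, True]) Pos]"
| "expansion s Neg =
     [X s Neg, Y (s @ [False, False]) Neg, Y (s @ [False, True]) Pos, Y (s @ [True]) Neg]"

text \<open>It is enough to compare the maps at the root, in the four cases of the first two digits.
  Compatibility of \<open>localize\<close> with composition and with concatenated indices transports
  the identity to \<open>s\<close>.\<close>

lemma word_map_expansion: "word_map (expansion s e) = word_map [Y s e]"
proof -
  have "(localize [True, True] (y_rec Pos) \<circ> localize [True, False] (y_rec Neg) \<circ>
      localize [False] (y_rec Pos) \<circ> x_sgn Pos) \<eta> = y_rec Pos \<eta>" for \<eta>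
    by (cases rule: y_rec_cases[of \<eta>]) (simp_all add: y_rec_eqs localize_Cons)
  then have P: "(localize [True, True] (y_rec Pos) \<circ> localize [True, False] (y_rec Neg) \<circ>
      localize [False] (y_rec Pos) \<circ> x_sgn Pos) = y_rec Pos" by blast
  have "(localize [True] (y_rec Neg) \<circ> localize [False, True] (y_rec Pos) \<circ>
      localize [False, False] (y_rec Neg) \<circ> x_sgn Neg) \<eta> = y_rec Neg \<eta>" for \<eta>
    by (cases rule: y_rec_cases[of \<eta>]) (simp_all add: y_rec_eqs localize_Cons)
  then have N: "(localize [True] (y_rec Neg) \<circ> localize [False, True] (y_rec Pos) \<circ>
      localize [False, False] (y_rec Neg) \<circ> x_sgn Neg) = y_rec Neg" by blast
  have "word_map (expansion s Pos) = localize s (y_rec Pos)"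
    apply (rule trans[OF _ arg_cong[OF P, of "localize s"]])
    by (simp only: expansion.simps word_map_Cons letter_map_X letter_map_Y localize_append
        localize_comp word_map_Nil id_comp o_assoc)
  moreover have "word_map (expansion s Neg) = localize s (y_rec Neg)"
    apply (rule trans[OF _ arg_cong[OF N, of "localize s"]])
    by (simp only: expansion.simps word_map_Cons letter_map_X letter_map_Y localize_append
        localize_comp word_map_Nil id_comp o_assoc)
  ultimately show ?thesis
    by (cases e) (simp_all only: word_map_Cons letter_map_Y word_map_Nil id_comp)
qed

lemma S_word_expansion: "y_index s \<Longrightarrow> S_word (expansion s e)"
  by (cases e) (simp_all add: y_index_append)

lemma conv_expand:
  assumes "y_index s" shows "conv [Y s e] (expansion s e)"
proof (rule conv_move)
  show "move (u @ [Y s e] @ v) (u @ expansion s e @ v)" for u v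
    by (cases e) (simp_all only: expansion.simps move.expand_pos move.expand_neg)
qed (use assms in \<open>auto simp: word_map_expansion S_word_expansion\<close>)

lemma conv_contract:
  assumes "y_index s" shows "conv (expansion s e) [Y s e]"
proof (rule conv_move)
  show "move (u @ expansion s e @ v) (u @ [Y s e] @ v)" for u v
    by (cases e) (simp_all only: expansion.simps move.contract_pos move.contract_neg)
qed (use assms in \<open>auto simp: word_map_expansion S_word_expansion\<close>)

section \<open>Labelled trees\<close>

datatype ltree = Tip | Br int ltree ltree

fun label :: "ltree \<Rightarrow> bool list \<Rightarrow> int" where
  "label Tip u = 0"
| "label (Br t l r) [] = t"
| "label (Br t l r) (b # u) = label (if b then r else l) u"

lemma label_Br_Cons [simp]:
  "label (Br t l r) (False # u) = label l u" "label (Br t l r) (True # u) = label r u"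
  by simp_all

text \<open>The traversal is in postorder because \<open>index_less\<close> puts extensions before
  their prefixes and left before right. Every tree thus yields a list in the order of a standard
  form.\<close>

fun powers_at :: "bool list \<Rightarrow> ltree \<Rightarrow> powers" where
  "powers_at s Tip = []"
| "powers_at s (Br t l r) =
     powers_at (s @ [False]) l @ powers_at (s @ [True]) r @ (if t = 0 then [] else [(s, t)])"

definition tree_word :: "bool list \<Rightarrow> ltree \<Rightarrow> word" where
  "tree_word s c = Y_word_of (powers_at s c)"

lemma y_pow_0 [simp]: "y_pow s 0 = []"
  by (simp add: y_pow_def)

lemma tree_word_Tip [simp]: "tree_word s Tip = []"
  by (simp add: tree_word_def Y_word_of_def)

lemma tree_word_Br [simp]:
  "tree_word s (Br t l r) = tree_word (s @ [False]) l @ tree_word (s @ [True]) r @ y_pow s t"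
  by (simp add: tree_word_def Y_word_of_def)

text \<open>Let the digits 0 and 1 act as the matrices (1 0; 1 1) and (1 1; 0 1) and y as diag(2, 1), up
  to scaling.  The local action of a reduced product of digits and n letters \<open>y\<^sup>\<plusminus>\<^sup>1\<close> is
  then given by a primitive integer matrix of determinant \<open>2\<^sup>n\<close>, i.e. by a
  path without backtracking of length n in the tree of \<open>PGL\<^sub>2(\<rat>\<^sub>2)\<close>.  An \<open>edge\<close> is the first
  step of this path, i.e. the image of the matrix modulo 2: \<open>Base\<close> if n = 0, and otherwise the
  line spanned by (0, 1), (1, 0) or (1, 1).\<close>

datatype edge = Base | Plus | Minus | Third

fun digit_edge :: "bool \<Rightarrow> edge \<Rightarrow> edge" where
  "digit_edge _ Base = Base"
| "digit_edge False Plus = Plus"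
| "digit_edge False Minus = Third"
| "digit_edge False Third = Minus"
| "digit_edge True Plus = Third"
| "digit_edge True Minus = Minus"
| "digit_edge True Third = Plus"

fun sign_edge :: "sign \<Rightarrow> edge" where
  "sign_edge Pos = Plus"
| "sign_edge Neg = Minus"

lemma digit_edge_involution [simp]: "digit_edge b (digit_edge b \<kappa>) = \<kappa>"
  by (cases b; cases \<kappa>) auto

lemma digit_edge_image_iff [simp]: "\<kappa> \<in> digit_edge b ` A \<longleftrightarrow> digit_edge b \<kappa> \<in> A"
  by (metis digit_edge_involution image_iff)

lemma opposite_opposite [simp]: "opposite (opposite e) = e"
  by (cases e) auto

lemma opposite_neq [simp]: "opposite e \<noteq> e" "e \<noteq> opposite e"
  by (cases e; simp)+

lemma sign_edge_eq [simp]: "sign_edge e = sign_edge e' \<longleftrightarrow> e = e'"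
  by (cases e; cases e') auto

lemma sign_edge_neq_Base [simp]: "sign_edge e \<noteq> Base" "Base \<noteq> sign_edge e"
  by (cases e; simp)+

text \<open>The letters at the root are applied last, so they are the outermost factors of the
  matrix. A nonzero label there decides the first edge alone, provided that the path does not
  backtrack.\<close>

primrec edges :: "ltree \<Rightarrow> edge set" where
  "edges Tip = {Base}"
| "edges (Br t l r) = (if t = 0 then digit_edge False ` edges l \<union> digit_edge True ` edges r
     else {sign_edge (sign_of t)})"

text \<open>The forbidden edge is the kernel of the root letter modulo 2: y is diag(0, 1) there and
  kills the line of (1, 0), which is \<open>Minus\<close>; for y^-1 it is \<open>Plus\<close>. Every
  other line is mapped onto the edge of the letter itself.\<close>

fun reduced :: "ltree \<Rightarrow> bool" where
  "reduced Tip \<longleftrightarrow> True"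
| "reduced (Br t l r) \<longleftrightarrow> reduced l \<and> reduced r \<and>
     (t \<noteq> 0 \<longrightarrow> sign_edge (opposite (sign_of t)) \<notin> digit_edge False ` edges l \<union> digit_edge True ` edges r)"

text \<open>Zero labels are the room that an X letter needs: \<open>x_s\<close> acts on s00, s01 and
  s1 but not on s or s0, and its inverse not on s or s1. Two zero levels below s suffice for
  both.\<close>

definition zero_below :: "nat \<Rightarrow> ltree \<Rightarrow> bool" where
  "zero_below n c \<longleftrightarrow> (\<forall>u. length u < n \<longrightarrow> label c u = 0)"

lemma zero_below_0 [simp]: "zero_below 0 c"
  by (simp add: zero_below_def)

lemma zero_below_Tip [simp]: "zero_below n Tip"
  by (simp add: zero_below_def)

lemma zero_below_Br [simp]:
  "zero_below (Suc n) (Br t l r) \<longleftrightarrow> t = 0 \<and> zero_below n l \<and> zero_below n r"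
  unfolding zero_below_def
proof (intro iffI conjI allI impI)
  assume *: "\<forall>u. length u < Suc n \<longrightarrow> label (Br t l r) u = 0"
  show "t = 0" using *[rule_format, of "[]"] by simp
  show "label l u = 0" if "length u < n" for u
    using *[rule_format, of "False # u"] that by simp
  show "label r u = 0" if "length u < n" for u
    using *[rule_format, of "True # u"] that by simp
next
  fix u :: "bool list" assume "t = 0 \<and> (\<forall>u. length u < n \<longrightarrow> label l u = 0) \<and> (\<forall>u. length u < n \<longrightarrow> label r u = 0)"
    "length u < Suc n"
  then show "label (Br t l r) u = 0" by (cases u) auto
qed

lemma zero_below_mono: "zero_below n c \<Longrightarrow> m \<le> n \<Longrightarrow> zero_below m c"
  by (auto simp: zero_below_def)

text \<open>\<^term>\<open>Tip\<close> behaves like \<^term>\<open>Br 0 Tip Tip\<close>.\<close>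

lemma as_Br:
  obtains t l r where "\<And>s. tree_word s c = tree_word s (Br t l r)" "edges c = edges (Br t l r)"
    "reduced c = reduced (Br t l r)" "\<And>n. zero_below n c = zero_below n (Br t l r)"
    "label c [] = t" "size l < size c \<or> l = Tip" "size r < size c \<or> r = Tip"
proof (cases c)
  case Tip
  have "zero_below n (Br 0 Tip Tip)" for n by (cases n) simp_all
  then show ?thesis using that[of 0 Tip Tip] Tip by simp
next
  case (Br t l r)
  then show ?thesis using that[of t l r] by simp
qed

lemma as_Br_zero:
  assumes "zero_below (Suc n) c"
  obtains l r where "\<And>s. tree_word s c = tree_word s (Br 0 l r)" "edges c = edges (Br 0 l r)"
    "reduced c = reduced (Br 0 l r)" "zero_below n l" "zero_below n r"
proof (rule as_Br[of c])
  fix t l r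
  assume *: "\<And>s. tree_word s c = tree_word s (Br t l r)" "edges c = edges (Br t l r)"
    "reduced c = reduced (Br t l r)" "\<And>n. zero_below n c = zero_below n (Br t l r)"
  then have "t = 0" "zero_below n l" "zero_below n r" using assms by auto
  then show ?thesis using that[of l r] * by simp
qed

section \<open>Words supported in a cone\<close>

fun index :: "letter \<Rightarrow> bool list" where
  "index (X s e) = s"
| "index (Y s e) = s"

definition in_cone :: "bool list \<Rightarrow> word \<Rightarrow> bool" where
  "in_cone s w \<longleftrightarrow> (\<forall>l \<in> set w. prefix s (index l))"

definition Y_word :: "word \<Rightarrow> bool" where
  "Y_word w \<longleftrightarrow> (\<forall>l \<in> set w. \<exists>s e. l = Y s e)"

lemma in_cone_simps [simp]:
  "in_cone s []" "in_cone s (l # w) \<longleftrightarrow> prefix s (index l) \<and> in_cone s w"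
  "in_cone s (v @ w) \<longleftrightarrow> in_cone s v \<and> in_cone s w"
  by (auto simp: in_cone_def)

lemma Y_word_simps [simp]:
  "Y_word []" "Y_word (Y s e # w) \<longleftrightarrow> Y_word w" "\<not> Y_word (X s e # w)"
  "Y_word (v @ w) \<longleftrightarrow> Y_word v \<and> Y_word w"
  by (auto simp: Y_word_def)

lemma in_cone_mono: "in_cone s w \<Longrightarrow> prefix t s \<Longrightarrow> in_cone t w"
  by (auto simp: in_cone_def)

lemma in_cone_mono_append: "in_cone (s @ t) w \<Longrightarrow> in_cone s w"
  by (erule in_cone_mono) simp

lemma y_pow_in_cone [simp]: "in_cone s (y_pow s t)" "Y_word (y_pow s t)"
  by (auto simp: y_pow_def in_cone_def Y_word_def)

lemma tree_word_in_cone [simp]: "in_cone s (tree_word s c)"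
  by (induction c arbitrary: s) (auto intro: in_cone_mono_append)

lemma Y_word_tree_word [simp]: "Y_word (tree_word s c)"
  by (induction c arbitrary: s) auto

lemma S_word_tree_word: "y_index s \<Longrightarrow> S_word (tree_word s c)"
  by (induction c arbitrary: s) (auto simp: y_index_append S_word_y_pow)

lemma conv_swap_letters:
  assumes "t \<parallel> index l" "S_word [Y t d]" "S_word [l]"
  shows "conv [Y t d, l] [l, Y t d]"
proof (cases l)
  case (X s e)
  have "acts_on (word_map [X s e]) t t"
    using assms(1) X by (intro acts_on_parallel) auto
  from conv_rearrange[OF this, of "sign_int d"] assms show ?thesis
    by (simp add: X y_pow_sign_int)
next
  case (Y s e)
  then show ?thesis using assms conv_commute[of t s d e] by simp
qed

lemma conv_swap_letter:
  assumes "in_cone q w" "p \<parallel> q" "prefix p t" "S_word [Y t d]" "S_word w"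
  shows "conv ([Y t d] @ w) (w @ [Y t d])"
  using assms(1,5)
proof (induction w)
  case Nil
  then show ?case using assms by (simp add: conv_refl)
next
  case (Cons l w)
  have S: "S_word [l]" "S_word w" using Cons.prems by (auto simp: S_word_def)
  have "t \<parallel> index l" using assms(2,3) Cons.prems(1) by (metis in_cone_simps(2) parallel_append prefixE)
  then have "conv ([Y t d, l] @ w) ([l, Y t d] @ w)"
    by (intro conv_append_right conv_swap_letters S assms)
  moreover have "conv ([l] @ ([Y t d] @ w)) ([l] @ (w @ [Y t d]))"
    using Cons S by (intro conv_append_left) auto
  ultimately show ?case using conv_trans by simp
qed

text \<open>Only the letters of \<open>v\<close> travel to the right, which is the direction of
  (M1). So \<open>v\<close> has to be a Y-word, while \<open>w\<close> may contain X
  letters.\<close>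

lemma conv_swap:
  assumes "Y_word v" "in_cone p v" "in_cone q w" "p \<parallel> q" "S_word v" "S_word w"
  shows "conv (v @ w) (w @ v)"
  using assms(1,2,5)
proof (induction v)
  case Nil
  then show ?case using assms by (simp add: conv_refl)
next
  case (Cons l v)
  obtain t d where l: "l = Y t d" using Cons.prems by (auto simp: Y_word_def)
  have S: "S_word [Y t d]" "S_word v" using Cons.prems l by (auto simp: S_word_def)
  have "conv ([l] @ (v @ w)) ([l] @ (w @ v))"
    using Cons S l by (intro conv_append_left) auto
  also have "conv (([l] @ w) @ v) ((w @ [l]) @ v)"
    unfolding l using Cons.prems S assms l
    by (intro conv_append_right conv_swap_letter[of q _ p]) auto
  then have "conv ([l] @ (w @ v)) ((w @ [l]) @ v)" by simp
  finally show ?case by simp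
qed

text \<open>If the X letter acts on the root index, it acts on all extensions in the same way, so
  the labels stay in place and only the root moves.\<close>

lemma conv_tree_word_x:
  assumes "acts_on (word_map [X s e]) t t'" "S_word (tree_word t c)"
  shows "conv (tree_word t c @ [X s e]) ([X s e] @ tree_word t' c)"
  using assms
proof (induction c arbitrary: t t')
  case Tip
  then show ?case by (simp add: conv_refl)
next
  case (Br k l r)
  let ?x = "[X s e]"
  have l: "conv (tree_word (t @ [False]) l @ ?x) (?x @ tree_word (t' @ [False]) l)"
    and r: "conv (tree_word (t @ [True]) r @ ?x) (?x @ tree_word (t' @ [True]) r)"
    using Br.IH Br.prems acts_on_append by auto
  have k: "conv (y_pow t k @ ?x) (?x @ y_pow t' k)"
    using Br.prems conv_rearrange[of s e t t' k] by (cases "k = 0") (auto simp: S_word_y_pow conv_refl)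
  let ?l = "tree_word (t @ [False]) l" and ?r = "tree_word (t @ [True]) r"
  let ?l' = "tree_word (t' @ [False]) l" and ?r' = "tree_word (t' @ [True]) r"
  have S: "S_word ?l" "S_word ?r" "S_word ?r'" "S_word (y_pow t' k)"
    using Br.prems conv_S_word[OF k] conv_S_word[OF r] by auto
  have "conv ((?l @ ?r) @ (y_pow t k @ ?x)) ((?l @ ?r) @ (?x @ y_pow t' k))"
    by (intro conv_append_left k) (use S in auto)
  also have "conv (?l @ (?r @ ?x) @ y_pow t' k) (?l @ (?x @ ?r') @ y_pow t' k)"
    by (intro conv_append_left conv_append_right r) (use S in auto)
  then have "conv ((?l @ ?r) @ (?x @ y_pow t' k)) (?l @ (?x @ ?r') @ y_pow t' k)" by simp
  also have "conv ((?l @ ?x) @ (?r' @ y_pow t' k)) ((?x @ ?l') @ (?r' @ y_pow t' k))"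
    by (intro conv_append_right l) (use S in auto)
  then have "conv (?l @ (?x @ ?r') @ y_pow t' k) ((?x @ ?l') @ (?r' @ y_pow t' k))" by simp
  finally show ?case by simp
qed

section \<open>Words reaching a tree modulo F\<close>

text \<open>The X-word is confined to the cone of \<open>s\<close>. Without this, results for two
  siblings could not be glued in \<open>reaches_Br\<close>, where the X-word of the right child has
  to pass the tree of the left one.\<close>

definition reaches :: "bool list \<Rightarrow> word \<Rightarrow> ltree \<Rightarrow> bool" where
  "reaches s w c \<longleftrightarrow> (\<exists>f. X_word f \<and> in_cone s f \<and> conv w (f @ tree_word s c))"

lemma reaches_S_word: "reaches s w c \<Longrightarrow> S_word w" "reaches s w c \<Longrightarrow> S_word (tree_word s c)"
  by (auto simp: reaches_def dest: conv_S_word)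

lemma reaches_conv: "conv v w \<Longrightarrow> reaches s w c \<Longrightarrow> reaches s v c"
  unfolding reaches_def by (meson conv_trans)

lemma conv_reaches: "conv v (tree_word s c) \<Longrightarrow> reaches s v c"
  unfolding reaches_def by (rule exI[of _ "[]"]) simp

lemma reaches_X: 
  assumes "reaches s w c" "in_cone s f" "X_word f" shows "reaches s (f @ w) c"
proof -
  obtain g where "X_word g" "in_cone s g" "conv w (g @ tree_word s c)"
    using assms(1) by (auto simp: reaches_def)
  then show ?thesis using assms conv_append_left[of w "g @ tree_word s c" f]
    unfolding reaches_def by (intro exI[of _ "f @ g"]) (auto simp: X_word_S_word)
qed

lemma reaches_refl: "S_word (tree_word s c) \<Longrightarrow> reaches s (tree_word s c) c"
  by (simp add: conv_reaches conv_refl)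

lemma reaches_append:
  assumes "reaches s w c" "reaches s (tree_word s c @ v) d" "S_word v"
  shows "reaches s (w @ v) d"
proof -
  obtain f where f: "X_word f" "in_cone s f" "conv w (f @ tree_word s c)"
    using assms(1) by (auto simp: reaches_def)
  have "conv (w @ v) (f @ (tree_word s c @ v))"
    using conv_append_right[OF f(3) assms(3)] by simp
  moreover have "reaches s (f @ (tree_word s c @ v)) d"
    by (rule reaches_X[OF assms(2) f(2,1)])
  ultimately show ?thesis by (rule reaches_conv)
qed

lemma reaches_trans: "reaches s w c \<Longrightarrow> reaches s (tree_word s c) d \<Longrightarrow> reaches s w d"
  using reaches_append[of s w c "[]" d] by simp

lemma parallel_children [simp]:
  "(s @ False # u) \<parallel> (s @ True # v)" "(s @ True # u) \<parallel> (s @ False # v)"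
  by (auto simp: parallel_def)

lemma reaches_Br:
  assumes "reaches (s @ [False]) v l" "reaches (s @ [True]) w r"
  shows "reaches s (v @ w) (Br 0 l r)"
proof -
  obtain f where f: "X_word f" "in_cone (s @ [False]) f" "conv v (f @ tree_word (s @ [False]) l)"
    using assms(1) by (auto simp: reaches_def)
  obtain g where g: "X_word g" "in_cone (s @ [True]) g" "conv w (g @ tree_word (s @ [True]) r)"
    using assms(2) by (auto simp: reaches_def)
  let ?l = "tree_word (s @ [False]) l" and ?r = "tree_word (s @ [True]) r"
  have S: "S_word f" "S_word g" "S_word ?l" "S_word ?r"
    using conv_S_word[OF f(3)] conv_S_word[OF g(3)] by auto
  have "conv (v @ w) ((f @ ?l) @ (g @ ?r))"
    by (rule conv_append[OF f(3) g(3)])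
  also have "conv (f @ (?l @ g) @ ?r) (f @ (g @ ?l) @ ?r)"
    by (intro conv_append_left conv_append_right conv_swap[of _ "s @ [False]" "s @ [True]"])
      (use S g in auto)
  then have "conv ((f @ ?l) @ (g @ ?r)) ((f @ g) @ tree_word s (Br 0 l r))" by simp
  finally show ?thesis
    unfolding reaches_def using f g by (intro exI[of _ "f @ g"]) (auto intro: in_cone_mono_append)
qed

lemma conv_add_root:
  assumes "y_index s"
  shows "conv (tree_word s (Br t l r) @ [Y s e]) (tree_word s (Br (t + sign_int e) l r))"
proof -
  let ?k = "case e of Pos \<Rightarrow> 1 | Neg \<Rightarrow> -1"
  have S: "S_word (tree_word s (Br t l r))" using assms by (rule S_word_tree_word)
  have "conv (y_pow s t @ [Y s e]) (y_pow s (t + ?k))"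
  proof (cases "t = 0 \<or> sign_of t = e")
    case True
    then have "y_pow s t @ [Y s e] = y_pow s (t + ?k)"
    proof
      assume "t = 0" then show ?thesis by (cases e) (auto simp: y_pow_def sign_of_def)
    next
      assume *: "sign_of t = e"
      have "nat \<bar>t + ?k\<bar> = Suc (nat \<bar>t\<bar>)" "t \<noteq> 0 \<or> e = Pos" "sign_of (t + ?k) = e"
        using * by (auto simp: sign_of_def split: if_splits)
      then show ?thesis using * by (auto simp: y_pow_def replicate_append_same)
    qed
    then show ?thesis using assms S_word_y_pow[of s t]
      by (metis S_word_Cons(2) S_word_Nil S_word_append conv_refl)
  next
    case False
    then have e: "e = opposite (sign_of t)" by (cases e; cases "sign_of t") auto
    have *: "nat \<bar>t\<bar> = Suc (nat \<bar>t + ?k\<bar>)" "t + ?k = 0 \<or> sign_of (t + ?k) = sign_of t"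
      using False e by (auto simp: sign_of_def split: if_splits)
    then have "y_pow s t = y_pow s (t + ?k) @ [Y s (sign_of t)]"
      by (auto simp: y_pow_def replicate_append_same)
    moreover have "conv (y_pow s (t + ?k) @ [Y s (sign_of t), Y s e]) (y_pow s (t + ?k) @ [])"
      unfolding e using assms by (intro conv_append_left conv_cancel) (auto simp: S_word_y_pow)
    ultimately show ?thesis by simp
  qed
  then show ?thesis using S conv_append_left[of _ _ "tree_word (s @ [False]) l @ tree_word (s @ [True]) r"]
    by (simp add: sign_int_def)
qed

section \<open>Removing potential cancellations\<close>

abbreviation tree_word_y :: "bool list \<Rightarrow> ltree \<Rightarrow> sign \<Rightarrow> word" where
  "tree_word_y s c e \<equiv> tree_word s c @ [Y s e]"

text \<open>Once \<open>y_s\<close> is expanded, its \<open>x_s\<close> moves left past the three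
  subtrees at 00, 01, 1 and carries them to 0, 10, 11. These are exactly the indices of the three
  new letters, which are then commuted next to their subtrees. \<open>conv_push_neg\<close> is the
  mirror image.\<close>

lemma conv_push_pos:
  assumes "y_index s"
  shows "conv (tree_word_y s (Br 0 (Br 0 a b) r) Pos)
    ([X s Pos] @ (tree_word_y (s @ [False]) a Pos) @
      (tree_word_y (s @ [True, False]) b Neg) @
      (tree_word_y (s @ [True, True]) r Pos))"
proof -
  let ?x = "[X s Pos]" and ?A = "tree_word (s @ [False, False]) a" and ?B = "tree_word (s @ [False, True]) b"
    and ?R = "tree_word (s @ [True]) r" and ?A' = "tree_word (s @ [False]) a"
    and ?B' = "tree_word (s @ [True, False]) b" and ?R' = "tree_word (s @ [True, True]) r"
    and ?y1 = "[Y (s @ [False]) Pos]" and ?y2 = "[Y (s @ [True, False]) Neg]"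
    and ?y3 = "[Y (s @ [True, True]) Pos]"
  have [simp]: "y_index (s @ u)" for u
    using assms by (rule y_index_append)
  have S [simp]: "S_word ?A" "S_word ?B" "S_word ?R" "S_word ?A'" "S_word ?B'" "S_word ?R'"
    "S_word ?y1" "S_word ?y2" "S_word ?y3" "S_word ?x"
    using assms by (simp_all add: S_word_tree_word y_index_append)
  have "conv ((?A @ ?B @ ?R) @ [Y s Pos]) ((?A @ ?B @ ?R) @ ?x @ ?y1 @ ?y2 @ ?y3)"
    using conv_append_left[OF conv_expand[OF assms, of Pos], of "?A @ ?B @ ?R"] by simp
  also have "conv ((?A @ ?B) @ (?R @ ?x) @ ?y1 @ ?y2 @ ?y3) ((?A @ ?B) @ (?x @ ?R') @ ?y1 @ ?y2 @ ?y3)"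
    by (intro conv_append_left conv_append_right conv_tree_word_x acts_on_x) simp_all
  then have "conv ((?A @ ?B @ ?R) @ ?x @ ?y1 @ ?y2 @ ?y3) (?A @ (?B @ ?x) @ ?R' @ ?y1 @ ?y2 @ ?y3)"
    by simp
  also have "conv (?A @ (?B @ ?x) @ ?R' @ ?y1 @ ?y2 @ ?y3) (?A @ (?x @ ?B') @ ?R' @ ?y1 @ ?y2 @ ?y3)"
    by (intro conv_append_left conv_append_right conv_tree_word_x acts_on_x) simp_all
  also have "conv ((?A @ ?x) @ ?B' @ ?R' @ ?y1 @ ?y2 @ ?y3) ((?x @ ?A') @ ?B' @ ?R' @ ?y1 @ ?y2 @ ?y3)"
    by (intro conv_append_left conv_append_right conv_tree_word_x acts_on_x) simp_all
  then have "conv (?A @ (?x @ ?B') @ ?R' @ ?y1 @ ?y2 @ ?y3) (?x @ ?A' @ ((?B' @ ?R') @ ?y1) @ ?y2 @ ?y3)"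
    by simp
  also have "conv (?x @ ?A' @ ((?B' @ ?R') @ ?y1) @ ?y2 @ ?y3) (?x @ ?A' @ (?y1 @ (?B' @ ?R')) @ ?y2 @ ?y3)"
    by (intro conv_append_left conv_append_right conv_swap[of _ "s @ [True]" "s @ [False]"])
      (simp_all add: in_cone_mono[OF tree_word_in_cone])
  also have "conv ((?x @ ?A' @ ?y1 @ ?B') @ (?R' @ ?y2) @ ?y3) ((?x @ ?A' @ ?y1 @ ?B') @ (?y2 @ ?R') @ ?y3)"
    by (intro conv_append_left conv_append_right conv_swap[of _ "s @ [True, True]" "s @ [True, False]"])
      (simp_all add: parallel_def)
  then have "conv (?x @ ?A' @ (?y1 @ (?B' @ ?R')) @ ?y2 @ ?y3) (?x @ (?A' @ ?y1) @ (?B' @ ?y2) @ (?R' @ ?y3))"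
    by simp
  finally show ?thesis by simp
qed

lemma conv_push_neg:
  assumes "y_index s"
  shows "conv (tree_word_y s (Br 0 l (Br 0 a b)) Neg)
    ([X s Neg] @ (tree_word_y (s @ [False, False]) l Neg) @
      (tree_word_y (s @ [False, True]) a Pos) @
      (tree_word_y (s @ [True]) b Neg))"
proof -
  let ?x = "[X s Neg]" and ?L = "tree_word (s @ [False]) l" and ?A = "tree_word (s @ [True, False]) a"
    and ?B = "tree_word (s @ [True, True]) b" and ?L' = "tree_word (s @ [False, False]) l"
    and ?A' = "tree_word (s @ [False, True]) a" and ?B' = "tree_word (s @ [True]) b"
    and ?y1 = "[Y (s @ [False, False]) Neg]" and ?y2 = "[Y (s @ [False, True]) Pos]"
    and ?y3 = "[Y (s @ [True]) Neg]"
  have [simp]: "y_index (s @ u)" for u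
    using assms by (rule y_index_append)
  have S [simp]: "S_word ?L" "S_word ?A" "S_word ?B" "S_word ?L'" "S_word ?A'" "S_word ?B'"
    "S_word ?y1" "S_word ?y2" "S_word ?y3" "S_word ?x"
    using assms by (simp_all add: S_word_tree_word y_index_append)
  have "conv ((?L @ ?A @ ?B) @ [Y s Neg]) ((?L @ ?A @ ?B) @ ?x @ ?y1 @ ?y2 @ ?y3)"
    using conv_append_left[OF conv_expand[OF assms, of Neg], of "?L @ ?A @ ?B"] by simp
  also have "conv ((?L @ ?A) @ (?B @ ?x) @ ?y1 @ ?y2 @ ?y3) ((?L @ ?A) @ (?x @ ?B') @ ?y1 @ ?y2 @ ?y3)"
    by (intro conv_append_left conv_append_right conv_tree_word_x acts_on_x) simp_all
  then have "conv ((?L @ ?A @ ?B) @ ?x @ ?y1 @ ?y2 @ ?y3) (?L @ (?A @ ?x) @ ?B' @ ?y1 @ ?y2 @ ?y3)"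
    by simp
  also have "conv (?L @ (?A @ ?x) @ ?B' @ ?y1 @ ?y2 @ ?y3) (?L @ (?x @ ?A') @ ?B' @ ?y1 @ ?y2 @ ?y3)"
    by (intro conv_append_left conv_append_right conv_tree_word_x acts_on_x) simp_all
  also have "conv ((?L @ ?x) @ ?A' @ ?B' @ ?y1 @ ?y2 @ ?y3) ((?x @ ?L') @ ?A' @ ?B' @ ?y1 @ ?y2 @ ?y3)"
    by (intro conv_append_left conv_append_right conv_tree_word_x acts_on_x) simp_all
  then have "conv (?L @ (?x @ ?A') @ ?B' @ ?y1 @ ?y2 @ ?y3) (?x @ ?L' @ ?A' @ (?B' @ (?y1 @ ?y2)) @ ?y3)"
    by simp
  also have "conv (?x @ ?L' @ ?A' @ (?B' @ (?y1 @ ?y2)) @ ?y3) (?x @ ?L' @ ?A' @ ((?y1 @ ?y2) @ ?B') @ ?y3)"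
    by (intro conv_append_left conv_append_right conv_swap[of _ "s @ [True]" "s @ [False]"])
      simp_all
  also have "conv ((?x @ ?L') @ (?A' @ ?y1) @ ?y2 @ ?B' @ ?y3) ((?x @ ?L') @ (?y1 @ ?A') @ ?y2 @ ?B' @ ?y3)"
    by (intro conv_append_left conv_append_right conv_swap[of _ "s @ [False, True]" "s @ [False, False]"])
      (simp_all add: parallel_def)
  then have "conv (?x @ ?L' @ ?A' @ ((?y1 @ ?y2) @ ?B') @ ?y3) (?x @ (?L' @ ?y1) @ (?A' @ ?y2) @ (?B' @ ?y3))"
    by simp
  finally show ?thesis by simp
qed

lemma reaches_push_pos:
  assumes "y_index s"
    "reaches (s @ [False]) (tree_word_y (s @ [False]) a Pos) a'"
    "reaches (s @ [True, False]) (tree_word_y (s @ [True, False]) b Neg) b'"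
    "reaches (s @ [True, True]) (tree_word_y (s @ [True, True]) r Pos) r'"
  shows "reaches s (tree_word_y s (Br 0 (Br 0 a b) r) Pos) (Br 0 a' (Br 0 b' r'))"
proof (rule reaches_conv[OF conv_push_pos[OF assms(1)]], rule reaches_X)
  show "reaches s ((tree_word_y (s @ [False]) a Pos) @
      (tree_word_y (s @ [True, False]) b Neg) @
      (tree_word_y (s @ [True, True]) r Pos)) (Br 0 a' (Br 0 b' r'))"
    using assms by (intro reaches_Br) simp_all
qed auto

lemma reaches_push_neg:
  assumes "y_index s"
    "reaches (s @ [False, False]) (tree_word_y (s @ [False, False]) l Neg) l'"
    "reaches (s @ [False, True]) (tree_word_y (s @ [False, True]) a Pos) a'"
    "reaches (s @ [True]) (tree_word_y (s @ [True]) b Neg) b'"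
  shows "reaches s (tree_word_y s (Br 0 l (Br 0 a b)) Neg) (Br 0 (Br 0 l' a') b')"
proof (rule reaches_conv[OF conv_push_neg[OF assms(1)]], rule reaches_X)
  have "reaches s (((tree_word_y (s @ [False, False]) l Neg) @
      (tree_word_y (s @ [False, True]) a Pos)) @
      (tree_word_y (s @ [True]) b Neg)) (Br 0 (Br 0 l' a') b')"
    using assms by (intro reaches_Br) simp_all
  then show "reaches s ((tree_word_y (s @ [False, False]) l Neg) @
      (tree_word_y (s @ [False, True]) a Pos) @
      (tree_word_y (s @ [True]) b Neg)) (Br 0 (Br 0 l' a') b')"
    by simp
qed auto

lemma edges_nonempty [simp]: "edges c \<noteq> {}"
  by (induction c) auto

text \<open>The shapes of the two expansions: the three letters of an expansion have together the
  edge of the letter they replace.\<close>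

lemma edges_singletons:
  "edges l = {Plus} \<Longrightarrow> edges a = {Minus} \<Longrightarrow> edges r = {Plus} \<Longrightarrow> edges (Br 0 l (Br 0 a r)) = {Plus}"
  "edges l = {Minus} \<Longrightarrow> edges a = {Plus} \<Longrightarrow> edges r = {Minus} \<Longrightarrow> edges (Br 0 (Br 0 l a) r) = {Minus}"
  by simp_all

lemma reduced_add_root:
  assumes "reduced (Br t l r)" "t = 0 \<longrightarrow> sign_edge (opposite e) \<notin> edges (Br 0 l r)"
  shows "reduced (Br (t + sign_int e) l r)"
proof -
  have "sign_of (t + sign_int e) = sign_of t" if "t \<noteq> 0" "t + sign_int e \<noteq> 0"
    using that by (auto simp: sign_of_def sign_int_def split: sign.splits)
  moreover have "sign_of (sign_int e) = e" "sign_int e \<noteq> 0"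
    by (auto simp: sign_of_def sign_int_def split: sign.splits)
  ultimately show ?thesis using assms by (cases "t = 0") auto
qed

lemma edges_add_root:
  assumes "sign_edge (opposite e) \<notin> edges (Br t l r)"
  shows "edges (Br (t + sign_int e) l r) = {sign_edge e}"
proof -
  have "t = 0 \<or> sign_of t = e"
    using assms by (cases e; cases "sign_of t") (auto split: if_splits)
  then have "t + sign_int e \<noteq> 0" "sign_of (t + sign_int e) = e"
    by (cases e; auto simp: sign_of_def sign_int_def split: if_splits)+
  then show ?thesis by simp
qed

text \<open>A letter that does not backtrack expands into three letters that do not backtrack
  either. One expansion consumes two zero levels and produces one, hence \<open>2 * n\<close>
  against \<open>n\<close>. The resulting single edge allows the next letter of the same sign to be
  treated in the same way.\<close>

lemma reaches_add_deep:
  assumes "y_index s" "reduced c" "zero_below (2 * n) c" "sign_edge (opposite e) \<notin> edges c"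
  shows "\<exists>c'. reduced c' \<and> zero_below n c' \<and> edges c' = {sign_edge e} \<and>
    reaches s (tree_word_y s c e) c'"
  using assms
proof (induction n arbitrary: s c e)
  case 0
  obtain t l r where c: "\<And>s. tree_word s c = tree_word s (Br t l r)" "edges c = edges (Br t l r)"
    "reduced c = reduced (Br t l r)"
    using as_Br[of c] by metis
  then have "reduced (Br (t + sign_int e) l r)" "edges (Br (t + sign_int e) l r) = {sign_edge e}"
    using 0 by (metis reduced_add_root, metis edges_add_root)
  moreover have "reaches s (tree_word_y s c e) (Br (t + sign_int e) l r)"
    unfolding c by (intro conv_reaches conv_add_root 0)
  ultimately show ?case by (metis zero_below_0)
next
  case (Suc n)
  then have "zero_below (Suc (Suc (2 * n))) c" by simp
  then obtain l r where c: "\<And>s. tree_word s c = tree_word s (Br 0 l r)" "edges c = edges (Br 0 l r)"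
    "reduced c = reduced (Br 0 l r)" and lr: "zero_below (Suc (2 * n)) l" "zero_below (Suc (2 * n)) r"
    using as_Br_zero[of "Suc (2 * n)" c] by metis
  have red: "reduced l" "reduced r" using c Suc.prems by auto
  have lr': "zero_below (2 * n) l" "zero_below (2 * n) r" using lr zero_below_mono by auto
  show ?case
  proof (cases e)
    case Pos
    obtain a b where l: "\<And>s. tree_word s l = tree_word s (Br 0 a b)" "edges l = edges (Br 0 a b)"
      "reduced l = reduced (Br 0 a b)" "zero_below (2 * n) a" "zero_below (2 * n) b"
      using as_Br_zero[OF lr(1)] by metis
    have E: "Minus \<notin> edges a" "Plus \<notin> edges b" "Minus \<notin> edges r"
      using Suc.prems(4) unfolding c Pos by (auto simp: l)
    obtain a' where a': "reduced a'" "zero_below n a'" "edges a' = {Plus}"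
      "reaches (s @ [False]) (tree_word_y (s @ [False]) a Pos) a'"
      using Suc.IH[of "s @ [False]" a Pos] Suc.prems E l red by (auto simp: y_index_append)
    obtain b' where b': "reduced b'" "zero_below n b'" "edges b' = {Minus}"
      "reaches (s @ [True, False]) (tree_word_y (s @ [True, False]) b Neg) b'"
      using Suc.IH[of "s @ [True, False]" b Neg] Suc.prems E l red by (auto simp: y_index_append)
    obtain r' where r': "reduced r'" "zero_below n r'" "edges r' = {Plus}"
      "reaches (s @ [True, True]) (tree_word_y (s @ [True, True]) r Pos) r'"
      using Suc.IH[of "s @ [True, True]" r Pos] Suc.prems E lr' red by (auto simp: y_index_append)
    let ?c = "Br 0 a' (Br 0 b' r')"
    have "tree_word_y s c e = tree_word_y s (Br 0 (Br 0 a b) r) Pos"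
      using Pos by (simp add: c l)
    then have "reaches s (tree_word_y s c e) ?c"
      using reaches_push_pos[OF Suc.prems(1) a'(4) b'(4) r'(4)] by metis
    moreover have "reduced ?c" using a' b' r' by simp
    moreover have "zero_below (Suc n) ?c"
      using a' b' r' by (cases n) (auto intro: zero_below_mono)
    moreover have "edges ?c = {sign_edge e}" using a' b' r' Pos by (simp add: edges_singletons)
    ultimately show ?thesis by blast
  next
    case Neg
    obtain a b where r: "\<And>s. tree_word s r = tree_word s (Br 0 a b)" "edges r = edges (Br 0 a b)"
      "reduced r = reduced (Br 0 a b)" "zero_below (2 * n) a" "zero_below (2 * n) b"
      using as_Br_zero[OF lr(2)] by metis
    have E: "Plus \<notin> edges l" "Minus \<notin> edges a" "Plus \<notin> edges b"
      using Suc.prems(4) unfolding c Neg by (auto simp: r)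
    obtain l' where l': "reduced l'" "zero_below n l'" "edges l' = {Minus}"
      "reaches (s @ [False, False]) (tree_word_y (s @ [False, False]) l Neg) l'"
      using Suc.IH[of "s @ [False, False]" l Neg] Suc.prems E lr' red by (auto simp: y_index_append)
    obtain a' where a': "reduced a'" "zero_below n a'" "edges a' = {Plus}"
      "reaches (s @ [False, True]) (tree_word_y (s @ [False, True]) a Pos) a'"
      using Suc.IH[of "s @ [False, True]" a Pos] Suc.prems E r red by (auto simp: y_index_append)
    obtain b' where b': "reduced b'" "zero_below n b'" "edges b' = {Minus}"
      "reaches (s @ [True]) (tree_word_y (s @ [True]) b Neg) b'"
      using Suc.IH[of "s @ [True]" b Neg] Suc.prems E r red by (auto simp: y_index_append)
    let ?c = "Br 0 (Br 0 l' a') b'"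
    have "tree_word_y s c e = tree_word_y s (Br 0 l (Br 0 a b)) Neg"
      using Neg by (simp add: c r)
    then have "reaches s (tree_word_y s c e) ?c"
      using reaches_push_neg[OF Suc.prems(1) l'(4) a'(4) b'(4)] by metis
    moreover have "reduced ?c" using a' b' l' by simp
    moreover have "zero_below (Suc n) ?c"
      using a' b' l' by (cases n) (auto intro: zero_below_mono)
    moreover have "edges ?c = {sign_edge e}" using a' b' l' Neg by (simp add: edges_singletons)
    ultimately show ?thesis by blast
  qed
qed

text \<open>The subtrees are cleared first; then the letters of the root are appended again and
  pushed down. \<open>edges\<close> has to be preserved so that the surrounding tree stays
  reduced.\<close>

lemma reaches_zero_below:
  assumes "reduced c" "S_word (tree_word s c)"
  shows "\<exists>c'. reduced c' \<and> zero_below n c' \<and> edges c' = edges c \<and> reaches s (tree_word s c) c'"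
  using assms
proof (induction c arbitrary: s n)
  case Tip
  show ?case by (rule exI[of _ Tip]) (simp add: conv_reaches conv_refl)
next
  case (Br t l r)
  let ?P = "\<lambda>c n. \<exists>c'. reduced c' \<and> zero_below n c' \<and> edges c' = edges c \<and> reaches s (tree_word s c) c'"
  have red: "reduced l" "reduced r" and S: "S_word (tree_word (s @ [False]) l)" "S_word (tree_word (s @ [True]) r)"
    using Br.prems by auto
  have zero: "?P (Br 0 l r) n" for n
  proof (cases n)
    case 0
    then show ?thesis using red S by (intro exI[of _ "Br 0 l r"]) (use reaches_refl[of s "Br 0 l r"] S in auto)
  next
    case (Suc m)
    obtain l' where l': "reduced l'" "zero_below m l'" "edges l' = edges l"
      "reaches (s @ [False]) (tree_word (s @ [False]) l) l'" using Br.IH(1) red S by metis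
    obtain r' where r': "reduced r'" "zero_below m r'" "edges r' = edges r"
      "reaches (s @ [True]) (tree_word (s @ [True]) r) r'" using Br.IH(2) red S by metis
    show ?thesis using l' r' reaches_Br[OF l'(4) r'(4)] Suc
      by (intro exI[of _ "Br 0 l' r'"]) simp
  qed
  show ?case
  proof (cases "t = 0")
    case False
    define e where "e = sign_of t"
    have t: "t = int (nat \<bar>t\<bar>) * sign_int e" by (auto simp: e_def sign_of_def sign_int_def)
    have y: "y_index s" using Br.prems False by (auto simp: S_word_y_pow)
    have e: "sign_edge (opposite e) \<notin> edges (Br 0 l r)" using False Br.prems by (auto simp: e_def)
    \<comment> \<open>The root letters return one at a time. Appending one so that \<open>n\<close>
      levels stay empty needs \<open>2 * n\<close> empty levels before it, so the induction must
      leave \<open>n\<close> free.\<close>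
    have "?P (Br (int k * sign_int e) l r) n" for k n
    proof (induction k arbitrary: n)
      case 0
      then show ?case using zero by simp
    next
      case (Suc k)
      let ?c = "Br (int k * sign_int e) l r"
      have sg: "k = 0 \<or> sign_of (int k * sign_int e) = e"
        by (cases e) (auto simp: sign_of_def sign_int_def)
      obtain c' where c': "reduced c'" "zero_below (2 * n) c'" "edges c' = edges ?c"
        "reaches s (tree_word s ?c) c'" using Suc.IH by metis
      have "sign_edge (opposite e) \<notin> edges c'"
        using sg e unfolding c' by (auto simp: sign_int_def)
      then obtain d where d: "reduced d" "zero_below n d" "edges d = {sign_edge e}"
        "reaches s (tree_word_y s c' e) d"
        using reaches_add_deep[OF y c'(1,2)] by metis
      have "reaches s (tree_word_y s ?c e) d"
        using y by (intro reaches_append[OF c'(4) d(4)]) simp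
      moreover have "y_pow s (int k * sign_int e) @ [Y s e] = y_pow s (int (Suc k) * sign_int e)"
        by (cases e) (auto simp: y_pow_def sign_of_def sign_int_def replicate_append_same nat_add_distrib
            abs_mult algebra_simps)
      ultimately have "reaches s (tree_word s (Br (int (Suc k) * sign_int e) l r)) d" by simp
      moreover have "sign_of (int (Suc k) * sign_int e) = e" "int (Suc k) * sign_int e \<noteq> 0"
        by (cases e; simp add: sign_of_def sign_int_def)+
      ultimately show ?case using d by auto
    qed
    from this[of n "nat \<bar>t\<bar>"] show ?thesis using t by metis
  qed (use zero in simp)
qed

text \<open>If the new letter does not backtrack, it just changes the label of the root.  Otherwise it is
  expanded.  A child that blocks the expansion by a nonzero label has only one first edge and is
  expanded as well; the letters arriving there do not backtrack, so the recursion stops.\<close>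

lemma reaches_add:
  assumes "y_index s" "reduced c"
  shows "\<exists>c'. reduced c' \<and> reaches s (tree_word_y s c e) c'"
  using assms
proof (induction "size c" arbitrary: c s e rule: less_induct)
  case less
  show ?case
  proof (cases "\<exists>t l r. c = Br t l r \<and> t = 0 \<and> sign_edge (opposite e) \<in> edges c")
    case False
    obtain t l r where c: "\<And>s. tree_word s c = tree_word s (Br t l r)" "edges c = edges (Br t l r)"
      "reduced c = reduced (Br t l r)" and "t = 0 \<longrightarrow> sign_edge (opposite e) \<notin> edges (Br 0 l r)"
    proof (cases c)
      case Tip
      show ?thesis by (rule that[of 0 Tip Tip]) (use Tip in auto)
    next
      case (Br t l r)
      show ?thesis by (rule that[of t l r]) (use Br False in auto)
    qed
    then have "reduced (Br (t + sign_int e) l r)" using less.prems by (metis reduced_add_root)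
    moreover have "reaches s (tree_word_y s c e) (Br (t + sign_int e) l r)"
      unfolding c by (intro conv_reaches conv_add_root less.prems)
    ultimately show ?thesis by blast
  next
    case True
    then obtain l r where c: "c = Br 0 l r" by blast
    have red: "reduced l" "reduced r" using c less.prems by auto
    have IH: "\<exists>c'. reduced c' \<and> reaches (s @ u) (tree_word_y (s @ u) d e) c'"
      if "size d < size c" "reduced d" for d u e
      using less.hyps[OF that(1)] less.prems that(2) y_index_append by metis
    \<comment> \<open>Both signs of \<open>e\<close> make the same demand on the blocking child:
      after its root has been emptied, its first child receives a letter \<open>Pos\<close> and its
      second a letter \<open>Neg\<close>. Hence one statement serves both cases.\<close>
    have split: "\<exists>a b. reduced a \<and> reduced b \<and> reaches (s @ u) (tree_word (s @ u) d) (Br 0 a b) \<and>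
        (\<forall>v. \<exists>a'. reduced a' \<and> reaches (s @ v) (tree_word_y (s @ v) a Pos) a') \<and>
        (\<forall>v. \<exists>b'. reduced b' \<and> reaches (s @ v) (tree_word_y (s @ v) b Neg) b')"
      if d: "size d < size c" "reduced d" for d u
    proof -
      have S: "S_word (tree_word (s @ u) d)" for u
        using less.prems(1) by (intro S_word_tree_word y_index_append)
      obtain t a b where tab: "\<And>s. tree_word s d = tree_word s (Br t a b)"
        "edges d = edges (Br t a b)" "reduced d = reduced (Br t a b)"
        "size a < size d \<or> a = Tip" "size b < size d \<or> b = Tip"
        using as_Br[of d] by metis
      show ?thesis
      proof (cases "t = 0")
        case True
        have "reaches (s @ u) (tree_word (s @ u) d) (Br 0 a b)"
          using reaches_refl[OF S] tab(1) True unfolding reaches_def by simp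
        moreover have "size a < size c" "size b < size c" using tab d c by auto
        moreover have "reduced a" "reduced b" using tab(3) d by auto
        ultimately show ?thesis using IH by meson
      next
        case False
        obtain d' where d': "reduced d'" "zero_below (Suc 0) d'" "edges d' = edges d"
          "reaches (s @ u) (tree_word (s @ u) d) d'"
          using reaches_zero_below[OF d(2) S] by metis
        then obtain a b where ab: "\<And>s. tree_word s d' = tree_word s (Br 0 a b)"
          "edges d' = edges (Br 0 a b)" "reduced d' = reduced (Br 0 a b)"
          using as_Br_zero by metis
        have "edges (Br 0 a b) = {sign_edge (sign_of t)}"
          using ab d' tab False by simp
        \<comment> \<open>Only \<open>Third\<close> could make these letters backtrack: it is the
          image of \<open>Minus\<close> under digit 0 and of \<open>Plus\<close> under digit 1.
          Pushing the root label down has kept the single edge of the child, which is that of a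
          letter.\<close>
        then have "Third \<notin> edges (Br 0 a b)" by (cases "sign_of t") auto
        then have "Minus \<notin> edges a" "Plus \<notin> edges b" by auto
        then have "\<exists>a'. reduced a' \<and> reaches (s @ v) (tree_word_y (s @ v) a Pos) a'"
          "\<exists>b'. reduced b' \<and> reaches (s @ v) (tree_word_y (s @ v) b Neg) b'" for v
          using reaches_add_deep[of "s @ v" a 0 Pos] reaches_add_deep[of "s @ v" b 0 Neg]
            less.prems(1) ab d' by (auto simp: y_index_append)
        moreover have "reaches (s @ u) (tree_word (s @ u) d) (Br 0 a b)"
          using d'(4) ab(1) by (simp add: reaches_def)
        ultimately show ?thesis using ab d' by auto
      qed
    qed
    have y [simp]: "y_index (s @ u)" for u
      using less.prems(1) by (rule y_index_append)
    show ?thesis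
    proof (cases e)
      case Pos
      have "size l < size c" "reduced l" using red c by auto
      from split[OF this, of "[False]"] obtain a b where ab0:
        "reaches (s @ [False]) (tree_word (s @ [False]) l) (Br 0 a b)"
        "\<forall>v. \<exists>a'. reduced a' \<and> reaches (s @ v) (tree_word_y (s @ v) a Pos) a'"
        "\<forall>v. \<exists>b'. reduced b' \<and> reaches (s @ v) (tree_word_y (s @ v) b Neg) b'"
        by blast
      from ab0(2)[rule_format, of "[False]"] ab0(3)[rule_format, of "[True, False]"]
      obtain a b a' b' where ab: "reduced a'" "reduced b'"
        "reaches (s @ [False]) (tree_word (s @ [False]) l) (Br 0 a b)"
        "reaches (s @ [False]) (tree_word_y (s @ [False]) a Pos) a'"
        "reaches (s @ [True, False]) (tree_word_y (s @ [True, False]) b Neg) b'"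
        using ab0(1) by blast
      obtain r' where r': "reduced r'"
        "reaches (s @ [True, True]) (tree_word_y (s @ [True, True]) r Pos) r'"
        using IH[of r "[True, True]"] red c by auto
      have "reaches s (tree_word s c) (Br 0 (Br 0 a b) r)"
        using reaches_Br[OF ab(3) reaches_refl, of r] c by (simp add: S_word_tree_word)
      then have "reaches s (tree_word_y s c e) (Br 0 a' (Br 0 b' r'))"
        unfolding Pos
        by (rule reaches_append[OF _ reaches_push_pos[OF less.prems(1) ab(4,5) r'(2)]]) (simp add: less.prems(1))
      then show ?thesis using ab r' by (intro exI[of _ "Br 0 a' (Br 0 b' r')"]) auto
    next
      case Neg
      have "size r < size c" "reduced r" using red c by auto
      from split[OF this, of "[True]"] obtain a b where ab0:
        "reaches (s @ [True]) (tree_word (s @ [True]) r) (Br 0 a b)"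
        "\<forall>v. \<exists>a'. reduced a' \<and> reaches (s @ v) (tree_word_y (s @ v) a Pos) a'"
        "\<forall>v. \<exists>b'. reduced b' \<and> reaches (s @ v) (tree_word_y (s @ v) b Neg) b'"
        by blast
      from ab0(2)[rule_format, of "[False, True]"] ab0(3)[rule_format, of "[True]"]
      obtain a b a' b' where ab: "reduced a'" "reduced b'"
        "reaches (s @ [True]) (tree_word (s @ [True]) r) (Br 0 a b)"
        "reaches (s @ [False, True]) (tree_word_y (s @ [False, True]) a Pos) a'"
        "reaches (s @ [True]) (tree_word_y (s @ [True]) b Neg) b'"
        using ab0(1) by blast
      obtain l' where l': "reduced l'"
        "reaches (s @ [False, False]) (tree_word_y (s @ [False, False]) l Neg) l'"
        using IH[of l "[False, False]"] red c by auto
      have "reaches s (tree_word s c) (Br 0 l (Br 0 a b))"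
        using reaches_Br[OF reaches_refl ab(3), of l] c by (simp add: S_word_tree_word)
      then have "reaches s (tree_word_y s c e) (Br 0 (Br 0 l' a') b')"
        unfolding Neg
        by (rule reaches_append[OF _ reaches_push_neg[OF less.prems(1) l'(2) ab(4,5)]]) (simp add: less.prems(1))
      then show ?thesis using ab l' by (intro exI[of _ "Br 0 (Br 0 l' a') b'"]) auto
    qed
  qed
qed

text \<open>On the way to its index the new letter meets only zero labels and commutes with the
  subtrees to the right of the path. The \<open>k\<close> further zero levels remain for the work
  inside its own cone.\<close>

lemma reaches_insert_letter:
  assumes base: "\<And>c. reduced c \<Longrightarrow> zero_below k c \<Longrightarrow> S_word (tree_word (p @ s) c) \<Longrightarrow>
      \<exists>c'. reduced c' \<and> reaches (p @ s) (tree_word (p @ s) c @ [m]) c'"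
    and m: "index m = p @ s" "S_word [m]"
    and c: "reduced c" "zero_below (length s + k) c" "S_word (tree_word p c)"
  shows "\<exists>c'. reduced c' \<and> reaches p (tree_word p c @ [m]) c'"
  using assms
proof (induction s arbitrary: p c)
  case Nil
  then show ?case by simp
next
  case (Cons b s)
  have "zero_below (Suc (length s + k)) c" using Cons.prems by simp
  then obtain l r where c: "\<And>s. tree_word s c = tree_word s (Br 0 l r)"
    "reduced c = reduced (Br 0 l r)" "zero_below (length s + k) l" "zero_below (length s + k) r"
    using as_Br_zero by metis
  have S: "S_word (tree_word (p @ [False]) l)" "S_word (tree_word (p @ [True]) r)" "reduced l" "reduced r"
    using Cons.prems c by auto
  have IH: "\<exists>d'. reduced d' \<and> reaches (p @ [b]) (tree_word (p @ [b]) d @ [m]) d'"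
    if "reduced d" "zero_below (length s + k) d" "S_word (tree_word (p @ [b]) d)" for d
    using Cons.IH[of "p @ [b]" d] Cons.prems that by simp
  show ?case
  proof (cases b)
    case True
    then obtain r' where r': "reduced r'" "reaches (p @ [True]) (tree_word (p @ [True]) r @ [m]) r'"
      using IH[of r] c S by auto
    then have "reaches p (tree_word p c @ [m]) (Br 0 l r')"
      using reaches_Br[OF reaches_refl r'(2), of l] S by (simp add: c)
    then show ?thesis using r' S by (intro exI[of _ "Br 0 l r'"]) auto
  next
    case False
    then obtain l' where l': "reduced l'" "reaches (p @ [False]) (tree_word (p @ [False]) l @ [m]) l'"
      using IH[of l] c S by auto
    have "conv (tree_word (p @ [False]) l @ (tree_word (p @ [True]) r @ [m]))
        (tree_word (p @ [False]) l @ ([m] @ tree_word (p @ [True]) r))"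
      by (intro conv_append_left conv_swap[of _ "p @ [True]" "p @ [False]"])
        (use Cons.prems False S in auto)
    moreover have "reaches p ((tree_word (p @ [False]) l @ [m]) @ tree_word (p @ [True]) r) (Br 0 l' r)"
      using l' S by (intro reaches_Br reaches_refl)
    ultimately have "reaches p (tree_word p c @ [m]) (Br 0 l' r)"
      using reaches_conv by (simp add: c)
    then show ?thesis using l' S by (intro exI[of _ "Br 0 l' r"]) auto
  qed
qed

text \<open>With two zero levels the tree splits into three subtrees on whose roots the X letter
  acts; passing it to the left only regroups them. Labels and edges inside them do not
  change.\<close>

lemma reaches_add_X:
  assumes "reduced c" "zero_below 2 c" "S_word (tree_word s c)"
  shows "\<exists>c'. reduced c' \<and> reaches s (tree_word s c @ [X s e]) c'"
proof -
  have "zero_below (Suc (Suc 0)) c" using assms(2) by (simp add: numeral_2_eq_2)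
  then obtain l r where c: "\<And>s. tree_word s c = tree_word s (Br 0 l r)"
    "reduced c = reduced (Br 0 l r)" "zero_below (Suc 0) l" "zero_below (Suc 0) r"
    using as_Br_zero by metis
  obtain a b where l: "\<And>s. tree_word s l = tree_word s (Br 0 a b)" "reduced l = reduced (Br 0 a b)"
    using as_Br_zero c(3) by metis
  obtain a' b' where r: "\<And>s. tree_word s r = tree_word s (Br 0 a' b')" "reduced r = reduced (Br 0 a' b')"
    using as_Br_zero c(4) by metis
  have red: "reduced a" "reduced b" "reduced a'" "reduced b'" "reduced l" "reduced r"
    using assms c l r by auto
  have reach: "reaches s (A @ B @ C @ [X s e]) d"
    if "conv (A @ [X s e]) ([X s e] @ A')" "conv (B @ [X s e]) ([X s e] @ B')"
      "conv (C @ [X s e]) ([X s e] @ C')" "tree_word s d = A' @ B' @ C'" for A B C A' B' C' d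
  proof -
    have S: "S_word A" "S_word B" "S_word C" "S_word A'" "S_word B'" "S_word C'"
      using that conv_S_word by (metis S_word_append)+
    have "conv (A @ B @ (C @ [X s e])) (A @ B @ ([X s e] @ C'))"
      using that S by (intro conv_append_left) auto
    also have "conv (A @ (B @ [X s e]) @ C') (A @ ([X s e] @ B') @ C')"
      using that S by (intro conv_append_left conv_append_right) auto
    then have "conv (A @ B @ ([X s e] @ C')) (A @ ([X s e] @ B') @ C')" by simp
    also have "conv ((A @ [X s e]) @ B' @ C') (([X s e] @ A') @ B' @ C')"
      using that S by (intro conv_append_left conv_append_right) auto
    then have "conv (A @ ([X s e] @ B') @ C') ([X s e] @ tree_word s d)"
      using that(4) by simp
    finally have "conv (A @ B @ C @ [X s e]) ([X s e] @ tree_word s d)" by simp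
    then show ?thesis unfolding reaches_def by (intro exI[of _ "[X s e]"]) simp
  qed
  have S: "S_word (tree_word (s @ [False]) l)" "S_word (tree_word (s @ [True]) r)"
    using assms(3) c by auto
  show ?thesis
  proof (cases e)
    case Pos
    have S: "S_word (tree_word (s @ [False, False]) a)" "S_word (tree_word (s @ [False, True]) b)"
      using S(1) by (auto simp: l)
    have "reaches s (tree_word (s @ [False, False]) a @ tree_word (s @ [False, True]) b @
        tree_word (s @ [True]) r @ [X s e]) (Br 0 a (Br 0 b r))"
      unfolding Pos
      by (rule reach[unfolded Pos], (rule conv_tree_word_x[OF acts_on_x(1)] conv_tree_word_x[OF acts_on_x(2)]
          conv_tree_word_x[OF acts_on_x(3)], fact)+) (simp add: Pos)
    then show ?thesis using red by (intro exI[of _ "Br 0 a (Br 0 b r)"]) (auto simp: c l)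
  next
    case Neg
    have S': "S_word (tree_word (s @ [True, False]) a')" "S_word (tree_word (s @ [True, True]) b')"
      using S(2) by (auto simp: r)
    have "reaches s (tree_word (s @ [False]) l @ tree_word (s @ [True, False]) a' @
        tree_word (s @ [True, True]) b' @ [X s e]) (Br 0 (Br 0 l a') b')"
      unfolding Neg
      by (rule reach[unfolded Neg], (rule conv_tree_word_x[OF acts_on_x(4)] conv_tree_word_x[OF acts_on_x(5)]
          conv_tree_word_x[OF acts_on_x(6)], fact)+) (simp add: Neg)
    then show ?thesis using red by (intro exI[of _ "Br 0 (Br 0 l a') b'"]) (auto simp: c r)
  qed
qed

theorem reaches_reduced:
  assumes "S_word w" shows "\<exists>c. reduced c \<and> reaches [] w c"
  using assms
proof (induction w rule: rev_induct)
  case Nil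
  have "reaches [] [] Tip" using reaches_refl[of "[]" Tip] by simp
  then show ?case using reduced.simps(1) by blast
next
  case (snoc m w)
  then obtain c where c: "reduced c" "reaches [] w c" by auto
  define s where "s = index m"
  \<comment> \<open>\<open>length s\<close> empty levels let the letter descend to its index; two
    more let an X letter act there.\<close>
  obtain d where d: "reduced d" "zero_below (length s + 2) d" "reaches [] (tree_word [] c) d"
    using reaches_zero_below[OF c(1) reaches_S_word(2)[OF c(2)]] by metis
  have Sd: "S_word (tree_word [] d)" using d(3) by (rule reaches_S_word)
  have m: "S_word [m]" using snoc.prems by simp
  have "\<exists>c'. reduced c' \<and> reaches [] (tree_word [] d @ [m]) c'"
  proof (rule reaches_insert_letter[of 2 "[]" s m d])
    fix c assume c: "reduced c" "zero_below 2 c" "S_word (tree_word ([] @ s) c)"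
    show "\<exists>c'. reduced c' \<and> reaches ([] @ s) (tree_word ([] @ s) c @ [m]) c'"
    proof (cases m)
      case (X t e)
      then show ?thesis using reaches_add_X c by (simp add: s_def)
    next
      case (Y t e)
      then show ?thesis using reaches_add c m by (simp add: s_def)
    qed
  qed (use d Sd m in \<open>simp_all add: s_def\<close>)
  then obtain c' where c': "reduced c'" "reaches [] (tree_word [] d @ [m]) c'" by blast
  have "reaches [] (w @ [m]) c'"
    using reaches_append[OF reaches_trans[OF c(2) d(3)] c'(2) m] .
  then show ?case using c' by blast
qed

section \<open>Removing potential contractions\<close>

text \<open>Signs of labels suffice, since a letter with a given sign occurs exactly if the label at
  its index has this sign. The equivalence with the definition on words is
  \<open>potential_contraction_iff\<close>.\<close>

definition contractible :: "(bool list \<Rightarrow> int) \<Rightarrow> bool list \<Rightarrow> bool" where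
  "contractible lb s \<longleftrightarrow>
     (lb (s @ [False]) > 0 \<and> lb (s @ [True, False]) < 0 \<and> lb (s @ [True, True]) > 0 \<and> lb (s @ [True]) = 0) \<or>
     (lb (s @ [False, False]) < 0 \<and> lb (s @ [False, True]) > 0 \<and> lb (s @ [True]) < 0 \<and> lb (s @ [False]) = 0)"

definition contracted :: "ltree \<Rightarrow> bool" where
  "contracted c \<longleftrightarrow> (\<forall>s. \<not> contractible (label c) s)"

lemma contractible_Cons [simp]:
  "contractible (label (Br t l r)) (b # s) = contractible (label (if b then r else l)) s"
  by (simp add: contractible_def)

lemma contractible_zero [simp]: "\<not> contractible (\<lambda>u. 0) s"
  by (simp add: contractible_def)

lemma label_Tip [simp]: "label Tip = (\<lambda>u. 0)"
  by auto

lemma contracted_Tip [simp]: "contracted Tip"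
  by (simp add: contracted_def)

lemma contracted_Br:
  "contracted (Br t l r) \<longleftrightarrow> contracted l \<and> contracted r \<and> \<not> contractible (label (Br t l r)) []"
proof -
  have "contractible (label (Br t l r)) s \<longleftrightarrow> s = [] \<and> contractible (label (Br t l r)) [] \<or>
      (\<exists>u. s = False # u \<and> contractible (label l) u) \<or> (\<exists>u. s = True # u \<and> contractible (label r) u)" for s
  proof (cases s)
    case (Cons b u)
    then show ?thesis by (cases b) (simp_all del: label_Br_Cons)
  qed simp
  then show ?thesis unfolding contracted_def by (metis (no_types, lifting))
qed

primrec weight :: "ltree \<Rightarrow> nat" where
  "weight Tip = 0"
| "weight (Br t l r) = nat \<bar>t\<bar> + weight l + weight r"

lemma conv_X_insert: "conv [] [X s e, X s (opposite e)]"
proof (rule conv_F_element)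
  have "localize s (x_sgn (opposite e)) \<circ> localize s (x_sgn e) = id"
    unfolding localize_comp[symmetric] by (simp add: comp_def)
  then show "word_map [] = word_map [X s e, X s (opposite e)]"
    by (simp add: word_map_Cons letter_map_X)
qed simp_all

text \<open>Because \<open>conv\<close> is directed, \<open>conv_push_pos\<close> cannot simply be
  read backwards. Instead x^-1 x is inserted behind the subtrees, x is absorbed by the contraction,
  and x^-1 moves left, carrying the subtrees from 0, 10, 11 to 00, 01, 1.\<close>

lemma conv_contract_pos:
  assumes "y_index s"
  shows "conv ((tree_word_y (s @ [False]) a Pos) @
      (tree_word_y (s @ [True, False]) b Neg) @
      (tree_word_y (s @ [True, True]) r Pos))
    ([X s Neg] @ tree_word_y s (Br 0 (Br 0 a b) r) Pos)"
proof -
  let ?x = "[X s Neg]" and ?x' = "[X s Pos]"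
    and ?A = "tree_word (s @ [False, False]) a" and ?B = "tree_word (s @ [False, True]) b"
    and ?R = "tree_word (s @ [True]) r" and ?A' = "tree_word (s @ [False]) a"
    and ?B' = "tree_word (s @ [True, False]) b" and ?R' = "tree_word (s @ [True, True]) r"
    and ?y1 = "[Y (s @ [False]) Pos]" and ?y2 = "[Y (s @ [True, False]) Neg]"
    and ?y3 = "[Y (s @ [True, True]) Pos]"
  have [simp]: "y_index (s @ u)" for u
    using assms by (rule y_index_append)
  have [simp]: "y_index s" by fact
  have S [simp]: "S_word ?A" "S_word ?B" "S_word ?R" "S_word ?A'" "S_word ?B'" "S_word ?R'"
    "S_word ?y1" "S_word ?y2" "S_word ?y3" "S_word ?x" "S_word ?x'" "S_word [Y s Pos]"
    using assms by (simp_all add: S_word_tree_word)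
  have "conv (?A' @ (?y1 @ ?B') @ ?y2 @ ?R' @ ?y3) (?A' @ (?B' @ ?y1) @ ?y2 @ ?R' @ ?y3)"
    by (intro conv_append_left conv_append_right conv_swap[of _ "s @ [False]" "s @ [True, False]"])
      (simp_all add: in_cone_mono[OF tree_word_in_cone])
  also have "conv ((?A' @ ?B') @ ((?y1 @ ?y2) @ ?R') @ ?y3) ((?A' @ ?B') @ (?R' @ (?y1 @ ?y2)) @ ?y3)"
  proof -
    have "conv (?y1 @ (?y2 @ ?R')) (?y1 @ (?R' @ ?y2))"
      by (intro conv_append_left conv_swap[of _ "s @ [True, False]" "s @ [True, True]"])
        (simp_all add: parallel_def)
    also have "conv ((?y1 @ ?R') @ ?y2) ((?R' @ ?y1) @ ?y2)"
      by (intro conv_append_right conv_swap[of _ "s @ [False]" "s @ [True, True]"]) simp_all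
    then have "conv (?y1 @ (?R' @ ?y2)) (?R' @ (?y1 @ ?y2))" by simp
    finally have "conv ((?y1 @ ?y2) @ ?R') (?R' @ (?y1 @ ?y2))" by simp
    then show ?thesis by (intro conv_append_left conv_append_right) simp_all
  qed
  then have "conv (?A' @ (?B' @ ?y1) @ ?y2 @ ?R' @ ?y3) ((?A' @ ?B' @ ?R') @ [] @ ?y1 @ ?y2 @ ?y3)" by simp
  also have "conv ((?A' @ ?B' @ ?R') @ [] @ ?y1 @ ?y2 @ ?y3) ((?A' @ ?B' @ ?R') @ (?x @ ?x') @ ?y1 @ ?y2 @ ?y3)"
    by (intro conv_append_left conv_append_right) (use conv_X_insert[of s Neg] in simp_all)
  also have "conv ((?A' @ ?B' @ ?R' @ ?x) @ (?x' @ ?y1 @ ?y2 @ ?y3)) ((?A' @ ?B' @ ?R' @ ?x) @ [Y s Pos])"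
    by (intro conv_append_left) (use conv_contract[OF assms, of Pos] in simp_all)
  then have "conv ((?A' @ ?B' @ ?R') @ (?x @ ?x') @ ?y1 @ ?y2 @ ?y3) (?A' @ ?B' @ (?R' @ ?x) @ [Y s Pos])" by simp
  also have "conv (?A' @ ?B' @ (?R' @ ?x) @ [Y s Pos]) (?A' @ ?B' @ (?x @ ?R) @ [Y s Pos])"
    by (intro conv_append_left conv_append_right conv_tree_word_x acts_on_x) simp_all
  also have "conv (?A' @ (?B' @ ?x) @ ?R @ [Y s Pos]) (?A' @ (?x @ ?B) @ ?R @ [Y s Pos])"
    by (intro conv_append_left conv_append_right conv_tree_word_x acts_on_x) simp_all
  then have "conv (?A' @ ?B' @ (?x @ ?R) @ [Y s Pos]) (?A' @ (?x @ ?B) @ ?R @ [Y s Pos])" by simp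
  also have "conv ((?A' @ ?x) @ ?B @ ?R @ [Y s Pos]) ((?x @ ?A) @ ?B @ ?R @ [Y s Pos])"
    by (intro conv_append_left conv_append_right conv_tree_word_x acts_on_x) simp_all
  then have "conv (?A' @ (?x @ ?B) @ ?R @ [Y s Pos]) ((?x @ ?A) @ ?B @ ?R @ [Y s Pos])" by simp
  finally show ?thesis by simp
qed

lemma conv_contract_neg:
  assumes "y_index s"
  shows "conv ((tree_word_y (s @ [False, False]) l Neg) @
      (tree_word_y (s @ [False, True]) a Pos) @
      (tree_word_y (s @ [True]) b Neg))
    ([X s Pos] @ tree_word_y s (Br 0 l (Br 0 a b)) Neg)"
proof -
  let ?x = "[X s Pos]" and ?x' = "[X s Neg]"
    and ?L = "tree_word (s @ [False]) l" and ?A = "tree_word (s @ [True, False]) a"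
    and ?B = "tree_word (s @ [True, True]) b" and ?L' = "tree_word (s @ [False, False]) l"
    and ?A' = "tree_word (s @ [False, True]) a" and ?B' = "tree_word (s @ [True]) b"
    and ?y1 = "[Y (s @ [False, False]) Neg]" and ?y2 = "[Y (s @ [False, True]) Pos]"
    and ?y3 = "[Y (s @ [True]) Neg]"
  have [simp]: "y_index (s @ u)" for u
    using assms by (rule y_index_append)
  have [simp]: "y_index s" by fact
  have S [simp]: "S_word ?L" "S_word ?A" "S_word ?B" "S_word ?L'" "S_word ?A'" "S_word ?B'"
    "S_word ?y1" "S_word ?y2" "S_word ?y3" "S_word ?x" "S_word ?x'" "S_word [Y s Neg]"
    using assms by (simp_all add: S_word_tree_word)
  have "conv (?L' @ (?y1 @ ?A') @ ?y2 @ ?B' @ ?y3) (?L' @ (?A' @ ?y1) @ ?y2 @ ?B' @ ?y3)"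
    by (intro conv_append_left conv_append_right conv_swap[of _ "s @ [False, False]" "s @ [False, True]"])
      (simp_all add: parallel_def)
  also have "conv ((?L' @ ?A') @ ((?y1 @ ?y2) @ ?B') @ ?y3) ((?L' @ ?A') @ (?B' @ (?y1 @ ?y2)) @ ?y3)"
    by (intro conv_append_left conv_append_right conv_swap[of _ "s @ [False]" "s @ [True]"]) simp_all
  then have "conv (?L' @ (?A' @ ?y1) @ ?y2 @ ?B' @ ?y3) ((?L' @ ?A' @ ?B') @ [] @ ?y1 @ ?y2 @ ?y3)" by simp
  also have "conv ((?L' @ ?A' @ ?B') @ [] @ ?y1 @ ?y2 @ ?y3) ((?L' @ ?A' @ ?B') @ (?x @ ?x') @ ?y1 @ ?y2 @ ?y3)"
    by (intro conv_append_left conv_append_right) (use conv_X_insert[of s Pos] in simp_all)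
  also have "conv ((?L' @ ?A' @ ?B' @ ?x) @ (?x' @ ?y1 @ ?y2 @ ?y3)) ((?L' @ ?A' @ ?B' @ ?x) @ [Y s Neg])"
    by (intro conv_append_left) (use conv_contract[OF assms, of Neg] in simp_all)
  then have "conv ((?L' @ ?A' @ ?B') @ (?x @ ?x') @ ?y1 @ ?y2 @ ?y3) (?L' @ ?A' @ (?B' @ ?x) @ [Y s Neg])" by simp
  also have "conv (?L' @ ?A' @ (?B' @ ?x) @ [Y s Neg]) (?L' @ ?A' @ (?x @ ?B) @ [Y s Neg])"
    by (intro conv_append_left conv_append_right conv_tree_word_x acts_on_x) simp_all
  also have "conv (?L' @ (?A' @ ?x) @ ?B @ [Y s Neg]) (?L' @ (?x @ ?A) @ ?B @ [Y s Neg])"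
    by (intro conv_append_left conv_append_right conv_tree_word_x acts_on_x) simp_all
  then have "conv (?L' @ ?A' @ (?x @ ?B) @ [Y s Neg]) (?L' @ (?x @ ?A) @ ?B @ [Y s Neg])" by simp
  also have "conv ((?L' @ ?x) @ ?A @ ?B @ [Y s Neg]) ((?x @ ?L) @ ?A @ ?B @ [Y s Neg])"
    by (intro conv_append_left conv_append_right conv_tree_word_x acts_on_x) simp_all
  then have "conv (?L' @ (?x @ ?A) @ ?B @ [Y s Neg]) ((?x @ ?L) @ ?A @ ?B @ [Y s Neg])" by simp
  finally show ?thesis by simp
qed

lemma y_pow_split:
  "t > 0 \<Longrightarrow> y_pow s t = y_pow s (t - 1) @ [Y s Pos]"
  "t < 0 \<Longrightarrow> y_pow s t = y_pow s (t + 1) @ [Y s Neg]"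
  "t \<ge> 0 \<Longrightarrow> Y s Pos # y_pow s t = y_pow s (t + 1)"
  "t \<le> 0 \<Longrightarrow> Y s Neg # y_pow s t = y_pow s (t - 1)"
proof -
  show "y_pow s t = y_pow s (t - 1) @ [Y s Pos]" if "t > 0"
  proof -
    have "nat \<bar>t\<bar> = Suc (nat \<bar>t - 1\<bar>)" using that by simp
    then show ?thesis using that by (simp add: y_pow_def sign_of_def replicate_append_same)
  qed
  show "y_pow s t = y_pow s (t + 1) @ [Y s Neg]" if "t < 0"
  proof -
    have "nat \<bar>t\<bar> = Suc (nat \<bar>t + 1\<bar>)" using that by simp
    then show ?thesis using that by (auto simp add: y_pow_def sign_of_def replicate_append_same)
  qed
  show "Y s Pos # y_pow s t = y_pow s (t + 1)" if "t \<ge> 0"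
  proof -
    have "nat \<bar>t + 1\<bar> = Suc (nat \<bar>t\<bar>)" using that by simp
    then show ?thesis using that by (simp add: y_pow_def sign_of_def)
  qed
  show "Y s Neg # y_pow s t = y_pow s (t - 1)" if "t \<le> 0"
  proof -
    have "nat \<bar>t - 1\<bar> = Suc (nat \<bar>t\<bar>)" using that by simp
    then show ?thesis using that by (auto simp: y_pow_def sign_of_def)
  qed
qed

text \<open>The part about edges says that the removed letter does not backtrack against what
  remains. A contraction can therefore replace three removed letters by one at the node above and
  stay reduced.\<close>

lemma reduced_remove_root:
  assumes "reduced (Br t l r)"
  shows "t > 0 \<Longrightarrow> reduced (Br (t - 1) l r) \<and> Minus \<notin> edges (Br (t - 1) l r)"
    and "t < 0 \<Longrightarrow> reduced (Br (t + 1) l r) \<and> Plus \<notin> edges (Br (t + 1) l r)"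
  using assms by (auto simp: sign_of_def)

text \<open>Preserving \<open>edges\<close> makes the step local: the conditions that
  \<open>reduced\<close> imposes at the nodes above see only the edges of their subtrees. Three
  letters become one, so the weight drops.\<close>

lemma reaches_contract_step:
  assumes "S_word (tree_word s c)" "reduced c" "contractible (label c) u"
  shows "\<exists>c'. reduced c' \<and> edges c' = edges c \<and> weight c' < weight c \<and> reaches s (tree_word s c) c'"
  using assms
proof (induction u arbitrary: s c)
  case Nil
  then obtain t l r where c: "c = Br t l r" by (cases c) auto
  consider (pos) "label l [] > 0" "label r [False] < 0" "label r [True] > 0" "label r [] = 0"
    | (neg) "label l [False] < 0" "label l [True] > 0" "label r [] < 0" "label l [] = 0"
    using Nil.prems(3) by (auto simp: contractible_def c)
  then show ?case
  proof cases
    case pos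
    obtain p a0 a1 where l: "l = Br p a0 a1" "p > 0" using pos by (cases l) auto
    obtain m n where r: "r = Br 0 m n" using pos by (cases r) auto
    obtain q b0 b1 where m: "m = Br q b0 b1" "q < 0" using pos r by (cases m) auto
    obtain k d0 d1 where n: "n = Br k d0 d1" "k > 0" using pos r by (cases n) auto
    let ?a = "Br (p - 1) a0 a1" and ?b = "Br (q + 1) b0 b1" and ?d = "Br (k - 1) d0 d1"
    let ?c = "Br (t + 1) (Br 0 ?a ?b) ?d"
    have abd: "reduced ?a" "Minus \<notin> edges ?a" "reduced ?b" "Plus \<notin> edges ?b" "reduced ?d" "Minus \<notin> edges ?d"
      using reduced_remove_root(1)[of p a0 a1] reduced_remove_root(2)[of q b0 b1]
        reduced_remove_root(1)[of k d0 d1] Nil.prems(2) l m n unfolding c r by auto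
    \<comment> \<open>The left child has the edge \<open>Plus\<close>, which digit 0 fixes, so a
      negative label at the root would backtrack. The contracted letter thus adds to the root label
      without cancelling.\<close>
    have t: "t \<ge> 0"
      using Nil.prems(2) l by (auto simp: c sign_of_def split: if_splits)
    \<comment> \<open>The contraction creates an allowed index: since s0 is allowed,
      \<open>s\<close> contains a 1, and since s11 is allowed, it contains a 0.\<close>
    have y: "y_index s" 
      using Nil.prems(1) l n by (auto simp: c r S_word_y_pow y_index_set)
    have "reaches s ((tree_word_y (s @ [False]) ?a Pos) @
      (tree_word_y (s @ [True, False]) ?b Neg) @
      (tree_word_y (s @ [True, True]) ?d Pos) @ y_pow s t) ?c"
      (is "reaches s (?W1 @ ?W2 @ ?W3 @ _) _")
    proof -
      have "conv ((?W1 @ ?W2 @ ?W3) @ y_pow s t)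
          (([X s Neg] @ tree_word_y s (Br 0 (Br 0 ?a ?b) ?d) Pos) @ y_pow s t)"
        by (intro conv_append_right conv_contract_pos y) (use y in \<open>simp add: S_word_y_pow\<close>)
      moreover have "(([X s Neg] @ tree_word_y s (Br 0 (Br 0 ?a ?b) ?d) Pos) @ y_pow s t)
          = [X s Neg] @ tree_word s ?c"
        using y_pow_split(3)[OF t, of s] by simp
      ultimately show ?thesis
        unfolding reaches_def by (intro exI[of _ "[X s Neg]"]) simp
    qed
    then have "reaches s (tree_word s c) ?c"
      using y_pow_split(1)[OF l(2), of "s @ [False]"] y_pow_split(2)[OF m(2), of "s @ [True, False]"]
        y_pow_split(1)[OF n(2), of "s @ [True, True]"] by (simp add: c l(1) m(1) n(1) r)
    moreover have "reduced ?c" using abd t by (simp add: sign_of_def del: edges.simps) (simp)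
    moreover have "edges ?c = edges c"
      using l m n r t by (simp add: c sign_of_def)
    moreover have "weight ?c < weight c"
      using t l m n r by (simp add: c)
    ultimately show ?thesis by blast
  next
    case neg
    obtain m n where l: "l = Br 0 m n" using neg by (cases l) auto
    obtain p a0 a1 where m: "m = Br p a0 a1" "p < 0" using neg l by (cases m) auto
    obtain q b0 b1 where n: "n = Br q b0 b1" "q > 0" using neg l by (cases n) auto
    obtain k d0 d1 where r: "r = Br k d0 d1" "k < 0" using neg by (cases r) auto
    let ?a = "Br (p + 1) a0 a1" and ?b = "Br (q - 1) b0 b1" and ?d = "Br (k + 1) d0 d1"
    let ?c = "Br (t - 1) ?a (Br 0 ?b ?d)"
    have abd: "reduced ?a" "Plus \<notin> edges ?a" "reduced ?b" "Minus \<notin> edges ?b" "reduced ?d" "Plus \<notin> edges ?d"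
      using reduced_remove_root(2)[of p a0 a1] reduced_remove_root(1)[of q b0 b1]
        reduced_remove_root(2)[of k d0 d1] Nil.prems(2) l m n r unfolding c l by auto
    have t: "t \<le> 0"
      using Nil.prems(2) r by (auto simp: c sign_of_def split: if_splits)
    have y: "y_index s" 
      using Nil.prems(1) m r by (auto simp: c l S_word_y_pow y_index_set)
    have "reaches s ((tree_word_y (s @ [False, False]) ?a Neg) @
      (tree_word_y (s @ [False, True]) ?b Pos) @
      (tree_word_y (s @ [True]) ?d Neg) @ y_pow s t) ?c"
      (is "reaches s (?W1 @ ?W2 @ ?W3 @ _) _")
    proof -
      have "conv ((?W1 @ ?W2 @ ?W3) @ y_pow s t)
          (([X s Pos] @ tree_word_y s (Br 0 ?a (Br 0 ?b ?d)) Neg) @ y_pow s t)"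
        by (intro conv_append_right conv_contract_neg y) (use y in \<open>simp add: S_word_y_pow\<close>)
      moreover have "(([X s Pos] @ tree_word_y s (Br 0 ?a (Br 0 ?b ?d)) Neg) @ y_pow s t)
          = [X s Pos] @ tree_word s ?c"
        using y_pow_split(4)[OF t, of s] by simp
      ultimately show ?thesis
        unfolding reaches_def by (intro exI[of _ "[X s Pos]"]) simp
    qed
    then have "reaches s (tree_word s c) ?c"
      using y_pow_split(2)[OF m(2), of "s @ [False, False]"] y_pow_split(1)[OF n(2), of "s @ [False, True]"]
        y_pow_split(2)[OF r(2), of "s @ [True]"] by (simp add: c l(1) m(1) n(1) r)
    moreover have "reduced ?c" using abd t by (simp add: sign_of_def del: edges.simps) (simp)
    moreover have "edges ?c = edges c"
      using l m n r t by (simp add: c sign_of_def)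
    moreover have "weight ?c < weight c"
      using t l m n r by (simp add: c)
    ultimately show ?thesis by blast
  qed
next
  case (Cons b u)
  then obtain t l r where c: "c = Br t l r" by (cases c) auto
  have S: "S_word (tree_word (s @ [False]) l)" "S_word (tree_word (s @ [True]) r)" "S_word (y_pow s t)"
    "reduced l" "reduced r" using Cons.prems c by auto
  have "\<exists>l' r'. reduced l' \<and> edges l' = edges l \<and> reduced r' \<and> edges r' = edges r \<and>
      weight l' + weight r' < weight l + weight r \<and>
      reaches (s @ [False]) (tree_word (s @ [False]) l) l' \<and>
      reaches (s @ [True]) (tree_word (s @ [True]) r) r'"
  proof (cases b)
    case True
    then obtain r' where r': "reduced r'" "edges r' = edges r" "weight r' < weight r"
      "reaches (s @ [True]) (tree_word (s @ [True]) r) r'"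
      using Cons.IH[of "s @ [True]" r] S Cons.prems c by auto
    show ?thesis by (rule exI[of _ l], rule exI[of _ r']) (use r' S in \<open>auto intro: reaches_refl\<close>)
  next
    case False
    then obtain l' where l': "reduced l'" "edges l' = edges l" "weight l' < weight l"
      "reaches (s @ [False]) (tree_word (s @ [False]) l) l'"
      using Cons.IH[of "s @ [False]" l] S Cons.prems c by auto
    show ?thesis by (rule exI[of _ l'], rule exI[of _ r]) (use l' S in \<open>auto intro: reaches_refl\<close>)
  qed
  then obtain l' r' where lr: "reduced l'" "edges l' = edges l" "reduced r'" "edges r' = edges r"
      "weight l' + weight r' < weight l + weight r"
      "reaches (s @ [False]) (tree_word (s @ [False]) l) l'"
      "reaches (s @ [True]) (tree_word (s @ [True]) r) r'" by blast
  have "reaches s (tree_word s (Br 0 l' r') @ y_pow s t) (Br t l' r')"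
    using reaches_refl[of s "Br t l' r'"] S reaches_S_word[OF lr(6)] reaches_S_word[OF lr(7)] by simp
  from reaches_append[OF reaches_Br[OF lr(6,7)] this S(3)]
  have "reaches s (tree_word s c) (Br t l' r')" by (simp add: c)
  moreover have "reduced (Br t l' r')" "edges (Br t l' r') = edges c" "weight (Br t l' r') < weight c"
    using lr Cons.prems c by auto
  ultimately show ?case by blast
qed

theorem reaches_contracted:
  assumes "S_word w" shows "\<exists>c. reduced c \<and> contracted c \<and> reaches [] w c"
proof -
  obtain c where c: "reduced c" "reaches [] w c" using reaches_reduced[OF assms] by blast
  then show ?thesis
  proof (induction "weight c" arbitrary: c rule: less_induct)
    case less
    show ?case
    proof (cases "contracted c")
      case False
      then obtain u where "contractible (label c) u" by (auto simp: contracted_def)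
      then obtain c' where "reduced c'" "weight c' < weight c" "reaches [] (tree_word [] c) c'"
        using reaches_contract_step[OF reaches_S_word(2)[OF less.prems(2)] less.prems(1)] by blast
      then show ?thesis using less.hyps[of c'] reaches_trans[OF less.prems(2)] by blast
    qed (use less.prems in blast)
  qed
qed

section \<open>The map of a tree and its matrices\<close>

primrec tree_map :: "ltree \<Rightarrow> bool stream \<Rightarrow> bool stream" where
  "tree_map Tip = id"
| "tree_map (Br t l r) = (\<lambda>\<eta>. (y_rec (sign_of t) ^^ nat \<bar>t\<bar>)
     (shd \<eta> ## (if shd \<eta> then tree_map r else tree_map l) (stl \<eta>)))"

lemma word_map_tree_word: "word_map (tree_word s c) = localize s (tree_map c)"
proof (induction c arbitrary: s)
  case Tip
  then show ?case by simp
next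
  case (Br t l r)
  have "localize [True] g (localize [False] h \<eta>) = shd \<eta> ## (if shd \<eta> then g else h) (stl \<eta>)"
    for g h :: "bool stream \<Rightarrow> bool stream" and \<eta>
    by (cases \<eta>; cases "shd \<eta>") (auto simp: localize_Cons)
  then have "tree_map (Br t l r) = (y_rec (sign_of t) ^^ nat \<bar>t\<bar>) \<circ> localize [True] (tree_map r) \<circ> localize [False] (tree_map l)"
    by (simp add: fun_eq_iff)
  then show ?case
    by (simp only: Br tree_word_Br word_map_append word_map_y_pow localize_append localize_comp o_assoc)
qed

section \<open>Binary sequences as points of the projective line\<close>

primrec euclid_upto :: "nat \<Rightarrow> bool stream \<Rightarrow> int \<Rightarrow> int \<Rightarrow> bool" where
  "euclid_upto 0 \<eta> a b \<longleftrightarrow> a \<ge> 0 \<and> b \<ge> 0"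
| "euclid_upto (Suc n) \<eta> a b \<longleftrightarrow> a \<ge> 0 \<and> b \<ge> 0 \<and>
     (if shd \<eta> then euclid_upto n (stl \<eta>) (a - b) b else euclid_upto n (stl \<eta>) a (b - a))"

text \<open>The digits of \<open>\<eta>\<close> are the steps of the subtractive Euclidean algorithm for the ratio a : b,
  so that \<open>\<eta>\<close> represents the point a/b of the projective line.\<close>

definition euclid :: "bool stream \<Rightarrow> int \<Rightarrow> int \<Rightarrow> bool" where
  "euclid \<eta> a b \<longleftrightarrow> (\<forall>n. euclid_upto n \<eta> a b)"

lemma euclid_upto_nonneg: "euclid_upto n \<eta> a b \<Longrightarrow> a \<ge> 0 \<and> b \<ge> 0"
  by (cases n) auto

lemma euclid_nonneg: "euclid \<eta> a b \<Longrightarrow> a \<ge> 0 \<and> b \<ge> 0"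
  unfolding euclid_def using euclid_upto_nonneg by blast

lemma euclid_unfold: 
  "euclid \<eta> a b \<longleftrightarrow> a \<ge> 0 \<and> b \<ge> 0 \<and>
     (if shd \<eta> then euclid (stl \<eta>) (a - b) b else euclid (stl \<eta>) a (b - a))"
proof -
  have "euclid \<eta> a b \<longleftrightarrow> euclid_upto 0 \<eta> a b \<and> (\<forall>n. euclid_upto (Suc n) \<eta> a b)"
    unfolding euclid_def by (metis not0_implies_Suc)
  then show ?thesis by (auto simp: euclid_def)
qed

lemma euclid_False: "euclid (False ## \<eta>) a b \<longleftrightarrow> a \<ge> 0 \<and> euclid \<eta> a (b - a)"
  and euclid_True: "euclid (True ## \<eta>) a b \<longleftrightarrow> b \<ge> 0 \<and> euclid \<eta> (a - b) b"
  by (subst euclid_unfold, use euclid_nonneg in fastforce)+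

text \<open>On ratios, y is doubling and y^-1 is halving. Both are treated at once because 01
  switches from y to its inverse. The maps emit one or two digits per step, so the bound drops by
  one or two.\<close>

lemma euclid_upto_y_rec:
  assumes "euclid \<eta> a b"
  shows "euclid_upto n (y_rec Pos \<eta>) (2 * a) b \<and> euclid_upto n (y_rec Neg \<eta>) a (2 * b)"
  using assms
proof (induction n arbitrary: \<eta> a b rule: less_induct)
  case (less n)
  have nonneg: "a \<ge> 0" "b \<ge> 0" using euclid_nonneg less.prems by auto
  show ?case
  proof (cases n)
    case 0
    then show ?thesis using nonneg by simp
  next
    case (Suc m)
    have IH1: "euclid_upto m (y_rec Pos \<zeta>) (2 * c) d" "euclid_upto m (y_rec Neg \<zeta>) c (2 * d)"
      if "euclid \<zeta> c d" for \<zeta> c d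
      using less.IH[OF _ that, of m] Suc by auto
    have IH2: "euclid_upto k (y_rec Pos \<zeta>) (2 * c) d" "euclid_upto k (y_rec Neg \<zeta>) c (2 * d)"
      if "euclid \<zeta> c d" "m = Suc k" for \<zeta> c d k
      using less.IH[OF _ that(1), of k] Suc that(2) by auto
    have "euclid_upto n (y_rec Pos \<eta>) (2 * a) b"
    proof (cases rule: y_rec_cases[of \<eta>])
      case (1 \<zeta>)
      then have "euclid \<zeta> a (b - 2 * a)" using less.prems by (simp add: euclid_False)
      from IH1(1)[OF this] show ?thesis using nonneg by (simp add: 1 Suc y_rec_eqs)
    next
      case (2 \<zeta>)
      then have *: "euclid \<zeta> (2 * a - b) (b - a)" using less.prems by (simp add: euclid_False euclid_True)
      show ?thesis using IH2(2)[OF *] euclid_nonneg[OF *] nonneg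
        by (cases m) (auto simp: 2 Suc y_rec_eqs algebra_simps)
    next
      case (3 \<zeta>)
      then have *: "euclid (False ## \<zeta>) (a - b) b" using less.prems by (simp add: euclid_True)
      show ?thesis using IH2(1)[OF *] euclid_nonneg[OF *] nonneg y_rec_eqs(3)[of "False ## \<zeta>"]
        by (cases m) (auto simp: 3 Suc algebra_simps)
    next
      case (4 \<zeta>)
      then have *: "euclid (True ## \<zeta>) (a - b) b" using less.prems by (simp add: euclid_True)
      show ?thesis using IH2(1)[OF *] euclid_nonneg[OF *] nonneg y_rec_eqs(3)[of "True ## \<zeta>"]
        by (cases m) (auto simp: 4 Suc algebra_simps)
    qed
    moreover have "euclid_upto n (y_rec Neg \<eta>) a (2 * b)"
    proof (cases rule: y_rec_cases[of \<eta>])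
      case (1 \<zeta>)
      then have *: "euclid (False ## \<zeta>) a (b - a)" using less.prems by (simp add: euclid_False)
      show ?thesis using IH2(2)[OF *] euclid_nonneg[OF *] nonneg y_rec_eqs(4)[of "False ## \<zeta>"]
        by (cases m) (auto simp: 1 Suc algebra_simps)
    next
      case (2 \<zeta>)
      then have *: "euclid (True ## \<zeta>) a (b - a)" using less.prems by (simp add: euclid_False)
      show ?thesis using IH2(2)[OF *] euclid_nonneg[OF *] nonneg y_rec_eqs(4)[of "True ## \<zeta>"]
        by (cases m) (auto simp: 2 Suc algebra_simps)
    next
      case (3 \<zeta>)
      then have *: "euclid \<zeta> (a - b) (2 * b - a)" using less.prems by (simp add: euclid_False euclid_True)
      show ?thesis using IH2(1)[OF *] euclid_nonneg[OF *] nonneg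
        by (cases m) (auto simp: 3 Suc y_rec_eqs algebra_simps)
    next
      case (4 \<zeta>)
      then have "euclid \<zeta> (a - 2 * b) b" using less.prems by (simp add: euclid_True)
      from IH1(2)[OF this] show ?thesis using nonneg by (simp add: 4 Suc y_rec_eqs)
    qed
    ultimately show ?thesis ..
  qed
qed

lemma euclid_y_rec:
  assumes "euclid \<eta> a b"
  shows "euclid (y_rec Pos \<eta>) (2 * a) b" "euclid (y_rec Neg \<eta>) a (2 * b)"
  using euclid_upto_y_rec[OF assms] by (auto simp: euclid_def)

text \<open>Both pairs undergo the same subtractions, which preserve the claim. The sum of the
  entries decreases unless both subtracted numbers are 0, and in that case the two products
  vanish.\<close>

lemma euclid_ratio_unique:
  assumes "euclid \<eta> a b" "euclid \<eta> c d" shows "a * d = b * c"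
  using assms
proof (induction "nat (a + b + c + d)" arbitrary: \<eta> a b c d rule: less_induct)
  case less
  note n = euclid_nonneg[OF less.prems(1)] euclid_nonneg[OF less.prems(2)]
  show ?case
  proof (cases "shd \<eta>")
    case True
    then have e: "euclid (stl \<eta>) (a - b) b" "euclid (stl \<eta>) (c - d) d"
      using less.prems euclid_True[of "stl \<eta>"] by (metis stream.collapse)+
    show ?thesis
    proof (cases "b = 0 \<and> d = 0")
      case False
      then have "(a - b) * d = b * (c - d)"
        using e n euclid_nonneg[OF e(1)] euclid_nonneg[OF e(2)] by (intro less.hyps[OF _ e]) auto
      then show ?thesis by (simp add: algebra_simps)
    qed simp
  next
    case False
    then have e: "euclid (stl \<eta>) a (b - a)" "euclid (stl \<eta>) c (d - c)"
      using less.prems euclid_False[of "stl \<eta>"] by (metis (full_types) stream.collapse)+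
    show ?thesis
    proof (cases "a = 0 \<and> c = 0")
      case False
      then have "a * (d - c) = (b - a) * c"
        using e n euclid_nonneg[OF e(1)] euclid_nonneg[OF e(2)] by (intro less.hyps[OF _ e]) auto
      then show ?thesis by (simp add: algebra_simps)
    qed auto
  qed
qed

text \<open>The tuple (a, b, c, d) is the matrix with rows (a, b) and (c, d).\<close>

type_synonym mat2 = "int \<times> int \<times> int \<times> int"

fun digit_mult :: "bool \<Rightarrow> mat2 \<Rightarrow> mat2" where
  "digit_mult False (a, b, c, d) = (a, b, a + c, b + d)"
| "digit_mult True (a, b, c, d) = (a + c, b + d, c, d)"

text \<open>The entry for \<open>Neg\<close> is twice the inverse of diag(2, 1). Matrices thereby
  stay integral, and each letter, of either sign, doubles the determinant.\<close>

fun y_mult :: "sign \<Rightarrow> mat2 \<Rightarrow> mat2" where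
  "y_mult Pos (a, b, c, d) = (2 * a, 2 * b, c, d)"
| "y_mult Neg (a, b, c, d) = (a, b, 2 * c, 2 * d)"

fun det2 :: "mat2 \<Rightarrow> int" where
  "det2 (a, b, c, d) = a * d - b * c"

fun represents :: "mat2 \<Rightarrow> (bool stream \<Rightarrow> bool stream) \<Rightarrow> bool" where
  "represents (a, b, c, d) h \<longleftrightarrow>
     (\<forall>\<zeta> x y. euclid \<zeta> x y \<longrightarrow> euclid (h \<zeta>) (a * x + b * y) (c * x + d * y))"

lemma represents_digit:
  "represents M h \<Longrightarrow> represents (digit_mult i M) (\<lambda>\<zeta>. i ## h \<zeta>)"
proof (cases M)
  case (fields a b c d)
  assume "represents M h"
  then show ?thesis
  proof (cases i)
    case True
    have "euclid (True ## h \<zeta>) ((a + c) * x + (b + d) * y) (c * x + d * y)" if "euclid \<zeta> x y" for \<zeta> x y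
    proof -
      have e: "euclid (h \<zeta>) (a * x + b * y) (c * x + d * y)"
        using that \<open>represents M h\<close> by (simp add: fields)
      have "(a + c) * x + (b + d) * y - (c * x + d * y) = a * x + b * y" by (simp add: algebra_simps)
      then show ?thesis unfolding euclid_True using e euclid_nonneg[OF e] by simp
    qed
    then show ?thesis using True by (simp add: fields)
  next
    case False
    have "euclid (False ## h \<zeta>) (a * x + b * y) ((a + c) * x + (b + d) * y)" if "euclid \<zeta> x y" for \<zeta> x y
    proof -
      have e: "euclid (h \<zeta>) (a * x + b * y) (c * x + d * y)"
        using that \<open>represents M h\<close> by (simp add: fields)
      have "(a + c) * x + (b + d) * y - (a * x + b * y) = c * x + d * y" by (simp add: algebra_simps)
      then show ?thesis unfolding euclid_False using e euclid_nonneg[OF e] by simp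
    qed
    then show ?thesis using False by (simp add: fields)
  qed
qed

lemma represents_y: "represents M h \<Longrightarrow> represents (y_mult e M) (\<lambda>\<zeta>. y_rec e (h \<zeta>))"
proof (cases M)
  case (fields a b c d)
  assume *: "represents M h"
  show ?thesis
  proof (cases e)
    case Pos
    then show ?thesis using * euclid_y_rec(1) by (fastforce simp: fields distrib_left mult.assoc)
  next
    case Neg
    then show ?thesis using * euclid_y_rec(2) by (fastforce simp: fields distrib_left mult.assoc)
  qed
qed

lemma represents_y_pow:
  "represents M h \<Longrightarrow> represents ((y_mult e ^^ n) M) (\<lambda>\<zeta>. (y_rec e ^^ n) (h \<zeta>))"
  by (induction n) (auto simp: represents_y)

section \<open>The matrix and the first edge along a branch of a tree\<close>

primrec height :: "ltree \<Rightarrow> nat" where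
  "height Tip = 0"
| "height (Br t l r) = Suc (max (height l) (height r))"

lemma height_eq_0 [simp]: "height c = 0 \<longleftrightarrow> c = Tip"
  by (cases c) auto

text \<open>The following two functions are meaningful only for \<open>u\<close> of length at least \<open>height c\<close>.\<close>

fun mat_at :: "ltree \<Rightarrow> bool list \<Rightarrow> mat2" where
  "mat_at c [] = (1, 0, 0, 1)"
| "mat_at Tip (b # u) = digit_mult b (mat_at Tip u)"
| "mat_at (Br t l r) (b # u) =
     (y_mult (sign_of t) ^^ nat \<bar>t\<bar>) (digit_mult b (mat_at (if b then r else l) u))"

fun edge_at :: "ltree \<Rightarrow> bool list \<Rightarrow> edge" where
  "edge_at (Br t l r) (b # u) =
     (if t = 0 then digit_edge b (edge_at (if b then r else l) u) else sign_edge (sign_of t))"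
| "edge_at _ _ = Base"

lemma represents_mat_at:
  "height c \<le> length u \<Longrightarrow> represents (mat_at c u) (\<lambda>\<zeta>. tree_map c (u @- \<zeta>))"
proof (induction c u rule: mat_at.induct)
  case (1 c)
  then show ?case by (cases c) auto
next
  case (2 b u)
  then show ?case using represents_digit[of "mat_at Tip u" _ b] by simp
next
  case (3 t l r b u)
  then have "represents (mat_at (if b then r else l) u) (\<lambda>\<zeta>. tree_map (if b then r else l) (u @- \<zeta>))"
    by (auto split: if_splits)
  from represents_y_pow[OF represents_digit[OF this, of b], where e = "sign_of t" and n = "nat \<bar>t\<bar>"]
  show ?case by (simp add: if_distrib[of tree_map])
qed

lemma det2_digit_mult [simp]: "det2 (digit_mult b M) = det2 M"
  by (cases M; cases b) (simp_all add: algebra_simps)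

lemma det2_y_mult [simp]: "det2 (y_mult e M) = 2 * det2 M"
  by (cases M; cases e) (simp_all add: algebra_simps)

lemma det2_y_pow [simp]: "det2 ((y_mult e ^^ n) M) = 2 ^ n * det2 M"
  by (induction n) simp_all

lemma det2_mat_at: "det2 (mat_at c u) > 0"
  by (induction c u rule: mat_at.induct) auto

text \<open>This is the image modulo 2: everything, or the line where the first row vanishes, the
  second row vanishes, or both rows agree. It is a relation because a matrix that is zero modulo 2
  has no edge.\<close>

fun edge_of_mat :: "mat2 \<Rightarrow> edge \<Rightarrow> bool" where
  "edge_of_mat (a, b, c, d) Base \<longleftrightarrow> odd (a * d - b * c)"
| "edge_of_mat (a, b, c, d) Plus \<longleftrightarrow> even a \<and> even b \<and> (odd c \<or> odd d)"
| "edge_of_mat (a, b, c, d) Minus \<longleftrightarrow> even c \<and> even d \<and> (odd a \<or> odd b)"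
| "edge_of_mat (a, b, c, d) Third \<longleftrightarrow> even (a + c) \<and> even (b + d) \<and> (odd a \<or> odd b)"

lemma edge_of_digit_mult: "edge_of_mat M \<kappa> \<Longrightarrow> edge_of_mat (digit_mult b M) (digit_edge b \<kappa>)"
  by (cases M; cases b; cases \<kappa>) auto

lemma edge_of_y_mult:
  "edge_of_mat M \<kappa> \<Longrightarrow> \<kappa> \<noteq> sign_edge (opposite e) \<Longrightarrow> edge_of_mat (y_mult e M) (sign_edge e)"
  by (cases M; cases e; cases \<kappa>) auto

lemma edge_of_mat_unique: "edge_of_mat M \<kappa> \<Longrightarrow> edge_of_mat M \<kappa>' \<Longrightarrow> \<kappa> = \<kappa>'"
  by (cases M; cases \<kappa>; cases \<kappa>') auto

lemma edge_of_y_pow: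
  assumes "edge_of_mat M \<kappa>" "n \<noteq> 0 \<Longrightarrow> \<kappa> \<noteq> sign_edge (opposite e)"
  shows "edge_of_mat ((y_mult e ^^ n) M) (if n = 0 then \<kappa> else sign_edge e)"
  using assms
proof (induction n)
  case (Suc n)
  then show ?case using edge_of_y_mult[of "(y_mult e ^^ n) M" _ e] by (cases n) auto
qed simp

lemma edge_at_in_edges: "height c \<le> length u \<Longrightarrow> edge_at c u \<in> edges c"
  by (induction c u rule: edge_at.induct) auto

lemma edge_at_append: "height c \<le> length u \<Longrightarrow> edge_at c (u @ v) = edge_at c u"
  by (induction c u rule: edge_at.induct) auto

lemma edges_edge_at: "\<kappa> \<in> edges c \<Longrightarrow> \<exists>u. height c \<le> length u \<and> edge_at c u = \<kappa>"
proof (induction c arbitrary: \<kappa>)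
  case Tip
  then show ?case by auto
next
  case (Br t l r)
  have *: "\<exists>u. height (Br t l r) \<le> length u \<and> edge_at (Br t l r) u = \<kappa>"
    if "edge_at (Br t l r) (b # v) = \<kappa>" "height (if b then r else l) \<le> length v" for b v
  proof (intro exI conjI)
    let ?u = "b # v @ replicate (height (Br t l r)) True"
    show "height (Br t l r) \<le> length ?u" by (simp only: length_Cons length_append length_replicate)
    show "edge_at (Br t l r) ?u = \<kappa>" using that by (auto simp: edge_at_append)
  qed
  show ?case
  proof (cases "t = 0")
    case True
    then consider "digit_edge False \<kappa> \<in> edges l" | "digit_edge True \<kappa> \<in> edges r" using Br.prems by auto
    then show ?thesis
    proof cases
      case 1
      then obtain u where "height l \<le> length u" "edge_at l u = digit_edge False \<kappa>" using Br.IH by blast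
      then show ?thesis using *[of False u] True by simp
    next
      case 2
      then obtain u where "height r \<le> length u" "edge_at r u = digit_edge True \<kappa>" using Br.IH by blast
      then show ?thesis using *[of True u] True by simp
    qed
  next
    case False
    then show ?thesis using Br.prems
      *[of False "replicate (height l) True"] by simp
  qed
qed

lemma edge_of_mat_at:
  "reduced c \<Longrightarrow> height c \<le> length u \<Longrightarrow> edge_of_mat (mat_at c u) (edge_at c u)"
proof (induction c u rule: mat_at.induct)
  case (1 c)
  then show ?case by (cases c) auto
next
  case (2 b u)
  then show ?case using edge_of_digit_mult[of "mat_at Tip u" Base b] by simp
next
  case (3 t l r b u)
  let ?d = "if b then r else l" and ?e = "sign_of t"
  have h: "height ?d \<le> length u" and red: "reduced ?d" using 3 by auto
  then have "edge_of_mat (digit_mult b (mat_at ?d u)) (digit_edge b (edge_at ?d u))"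
    using 3 by (auto intro!: edge_of_digit_mult)
  moreover have "digit_edge b (edge_at ?d u) \<noteq> sign_edge (opposite ?e)" if "t \<noteq> 0"
  proof
    assume "digit_edge b (edge_at ?d u) = sign_edge (opposite ?e)"
    then have "digit_edge b (sign_edge (opposite ?e)) \<in> edges ?d"
      using edge_at_in_edges[OF h] by (metis digit_edge_involution)
    then show False using 3(2) that by (auto split: if_splits)
  qed
  ultimately show ?case using edge_of_y_pow[of _ _ "nat \<bar>t\<bar>" ?e] by auto
qed

text \<open>Two matrices that agree on three points of the projective line are proportional.\<close>

lemma edge_of_mat_proportional:
  assumes "represents M h" "represents M' h" "det2 M > 0" "det2 M' > 0"
    "edge_of_mat M \<kappa>" "edge_of_mat M' \<kappa>'"
  shows "\<kappa> = \<kappa>'"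
proof -
  obtain a b c d where M: "M = (a, b, c, d)" by (cases M)
  obtain a' b' c' d' where M': "M' = (a', b', c', d')" by (cases M')
  have e: "euclid_upto n (sconst True) 1 0" "euclid_upto n (sconst False) 0 1" for n
    by (induction n) auto
  \<comment> \<open>The three points are 1 : 0, 0 : 1 and, in \<open>e2\<close>, 1 : 1.\<close>
  have e1: "euclid (sconst True) 1 0" "euclid (sconst False) 0 1"
    using e by (simp_all add: euclid_def)
  then have e2: "euclid (True ## sconst False) 1 1" by (simp add: euclid_True)
  have eq: "(a * x + b * y) * (c' * x + d' * y) = (c * x + d * y) * (a' * x + b' * y)"
    if "euclid \<zeta> x y" for \<zeta> x y
    using euclid_ratio_unique assms(1,2) that unfolding M M' represents.simps by blast
  have ac: "a * c' = c * a'" and bd: "b * d' = d * b'" using eq[OF e1(1)] eq[OF e1(2)] by simp_all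
  have mix: "d * a' - b * c' = a * d' - c * b'"
    using eq[OF e2] ac bd by (simp add: algebra_simps)
  \<comment> \<open>The equations say that the adjugate of M times M' is \<open>p\<close> times the
    identity: \<open>ac\<close> and \<open>bd\<close> kill the entries off the diagonal and
    \<open>mix\<close> equates those on it. Multiplying by M gives q M' = p M.\<close>
  define p where "p = d * a' - b * c'"
  define q where "q = det2 M"
  have q: "q \<noteq> 0" using assms(3) by (simp add: q_def)
  have E: "q * a' = p * a" "q * b' = p * b" "q * c' = p * c" "q * d' = p * d"
  proof -
    have "q * a' = a * (d * a') - b * (c * a')" by (simp add: q_def M algebra_simps)
    then show "q * a' = p * a" unfolding ac[symmetric] p_def by (simp add: algebra_simps)
    have "q * b' = a * (d * b') - b * (c * b')" by (simp add: q_def M algebra_simps)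
    then show "q * b' = p * b" unfolding bd[symmetric] p_def mix by (simp add: algebra_simps)
    have "q * c' = (a * c') * d - b * c * c'" by (simp add: q_def M algebra_simps)
    then show "q * c' = p * c" unfolding ac p_def by (simp add: algebra_simps)
    have "q * d' = a * d * d' - (b * d') * c" by (simp add: q_def M algebra_simps)
    then show "q * d' = p * d" unfolding bd p_def mix by (simp add: algebra_simps)
  qed
  \<comment> \<open>After division by the gcd both factors are odd: if one were even, the other
    would be odd, and M or M' would vanish modulo 2. So M and M' agree modulo 2, and their edges
    agree.\<close>
  define g where "g = gcd p q"
  have g: "g \<noteq> 0" using q by (simp add: g_def)
  obtain p1 q1 where pq: "p = p1 * g" "q = q1 * g" "coprime p1 q1"
    using gcd_coprime_exists[of p q] g unfolding g_def by auto
  have E1: "q1 * a' = p1 * a" "q1 * b' = p1 * b" "q1 * c' = p1 * c" "q1 * d' = p1 * d"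
    using E g unfolding pq by (simp_all add: ac_simps)
  have nonzero: "odd a \<or> odd b \<or> odd c \<or> odd d" "odd a' \<or> odd b' \<or> odd c' \<or> odd d'"
    using assms(5,6) unfolding M M' by (cases \<kappa>; auto; fail | (cases \<kappa>'; auto; fail))+
  have not_both: "odd p1 \<or> odd q1" using pq(3) by (meson coprime_common_divisor odd_one)
  have par: "even q1 \<or> even a' \<longleftrightarrow> even p1 \<or> even a" "even q1 \<or> even b' \<longleftrightarrow> even p1 \<or> even b"
    "even q1 \<or> even c' \<longleftrightarrow> even p1 \<or> even c" "even q1 \<or> even d' \<longleftrightarrow> even p1 \<or> even d"
    using E1 by (metis even_mult_iff)+
  then have "even a' \<longleftrightarrow> even a" "even b' \<longleftrightarrow> even b" "even c' \<longleftrightarrow> even c" "even d' \<longleftrightarrow> even d"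
    using not_both nonzero by blast+
  then have "edge_of_mat M \<kappa>'"
    using assms(6) unfolding M M' by (cases \<kappa>') auto
  then show ?thesis using assms(5) edge_of_mat_unique by blast
qed

section \<open>Uniqueness of reduced and contracted trees\<close>

text \<open>The uniqueness proof sees F through this property and bijectivity. On small cones such a
  map exchanges prefixes, which leaves the tail, the variable on which the matrices act,
  alone.\<close>

definition locally_prefix :: "(bool stream \<Rightarrow> bool stream) \<Rightarrow> bool" where
  "locally_prefix h \<longleftrightarrow> (\<forall>\<eta>. \<exists>n w. \<forall>\<zeta>. h (stake n \<eta> @- \<zeta>) = w @- \<zeta>)"

lemma stake_append_shift: "stake (n + m) \<eta> @- \<zeta> = stake n \<eta> @- stake m (sdrop n \<eta>) @- \<zeta>"
  by (simp flip: stake_add)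

lemma locally_prefixE:
  assumes "locally_prefix h"
  obtains n w where "N \<le> n" "N \<le> length w" "\<And>\<zeta>. h (stake n \<eta> @- \<zeta>) = w @- \<zeta>"
proof -
  obtain n w where h: "\<And>\<zeta>. h (stake n \<eta> @- \<zeta>) = w @- \<zeta>"
    using assms unfolding locally_prefix_def by meson
  have "h (stake (n + N) \<eta> @- \<zeta>) = (w @ stake N (sdrop n \<eta>)) @- \<zeta>" for \<zeta>
    unfolding stake_append_shift h by simp
  then show ?thesis using that[of "n + N" "w @ stake N (sdrop n \<eta>)"] by simp
qed

text \<open>Both matrices represent the same map of the tail, so they are proportional even if
  \<open>u\<close> and \<open>u'\<close> differ.\<close>

lemma edge_at_eq:
  assumes "reduced c" "reduced c'" "height c \<le> length u" "height c' \<le> length u'"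
    "\<And>\<zeta>. tree_map c (u @- \<zeta>) = tree_map c' (u' @- \<zeta>)"
  shows "edge_at c u = edge_at c' u'"
proof (rule edge_of_mat_proportional)
  show "represents (mat_at c u) (\<lambda>\<zeta>. tree_map c (u @- \<zeta>))"
    using assms by (intro represents_mat_at)
  show "represents (mat_at c' u') (\<lambda>\<zeta>. tree_map c (u @- \<zeta>))"
    unfolding assms(5) using assms by (intro represents_mat_at)
qed (use assms in \<open>auto intro: edge_of_mat_at det2_mat_at\<close>)

text \<open>Around any point the exchanged prefixes can be lengthened beyond the heights of both
  trees, so the edges of \<open>c\<close> near a point are those of \<open>c'\<close> near its
  image; bijectivity of \<open>h\<close> reaches all points of \<open>c'\<close>.\<close>

lemma edges_eq:
  assumes "reduced c" "reduced c'" "locally_prefix h" "bij h" "\<And>\<eta>. tree_map c \<eta> = tree_map c' (h \<eta>)"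
  shows "edges c = edges c'"
proof (intro equalityI subsetI)
  define N where "N = max (height c) (height c')"
  have *: "edge_at c (stake n \<eta>) = edge_at c' w"
    if "N \<le> n" "N \<le> length w" "\<And>\<zeta>. h (stake n \<eta> @- \<zeta>) = w @- \<zeta>" for n \<eta> w
    using assms that by (intro edge_at_eq) (auto simp: N_def)
  fix \<kappa>
  {
    assume "\<kappa> \<in> edges c"
    then obtain u where u: "height c \<le> length u" "edge_at c u = \<kappa>" using edges_edge_at by blast
    define \<eta> where "\<eta> = u @- sconst True"
    obtain n w where nw: "max N (length u) \<le> n" "max N (length u) \<le> length w"
      "\<And>\<zeta>. h (stake n \<eta> @- \<zeta>) = w @- \<zeta>" using locally_prefixE[OF assms(3)] by metis
    have "stake n \<eta> = u @ stake (n - length u) (sconst True)"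
      using nw by (simp add: \<eta>_def stake_shift)
    then have "edge_at c (stake n \<eta>) = \<kappa>" using u by (simp add: edge_at_append)
    then have "edge_at c' w = \<kappa>" using *[of n w \<eta>] nw by simp
    then show "\<kappa> \<in> edges c'" using edge_at_in_edges[of c' w] nw by (auto simp: N_def)
  next
    assume "\<kappa> \<in> edges c'"
    then obtain u where u: "height c' \<le> length u" "edge_at c' u = \<kappa>" using edges_edge_at by blast
    obtain \<eta> where \<eta>: "h \<eta> = u @- sconst True" using assms(4) by (metis bij_pointE)
    obtain n w where nw: "max N (length u) \<le> n" "max N (length u) \<le> length w"
      "\<And>\<zeta>. h (stake n \<eta> @- \<zeta>) = w @- \<zeta>" using locally_prefixE[OF assms(3)] by metis
    have "u @- sconst True = w @- sdrop n \<eta>"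
      using nw(3)[of "sdrop n \<eta>"] by (simp add: stake_sdrop \<eta>)
    then have "stake (length w) (u @- sconst True) = w" by (simp add: stake_shift)
    then have "w = u @ stake (length w - length u) (sconst True)"
      using nw by (simp add: stake_shift)
    then have "edge_at c' w = \<kappa>" using u edge_at_append by metis
    then have "edge_at c (stake n \<eta>) = \<kappa>" using *[of n w \<eta>] nw by simp
    then show "\<kappa> \<in> edges c" using edge_at_in_edges[of c "stake n \<eta>"] nw by (auto simp: N_def)
  }
qed

lemma digit_edge_image_singleton:
  assumes "digit_edge b ` A \<subseteq> {\<kappa>}" "A \<noteq> {}" shows "A = {digit_edge b \<kappa>}"
proof -
  have "x = digit_edge b \<kappa>" if "x \<in> A" for x
  proof -
    have "digit_edge b x \<in> {\<kappa>}" using that assms(1) by (metis image_eqI subsetD)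
    then show ?thesis by (metis digit_edge_involution singletonD)
  qed
  then show ?thesis using assms(2) by blast
qed

lemma edges_Br_singleton:
  assumes "edges (Br 0 l r) = {\<kappa>}"
  shows "edges l = {digit_edge False \<kappa>}" "edges r = {digit_edge True \<kappa>}"
proof -
  have "digit_edge False ` edges l \<union> digit_edge True ` edges r = {\<kappa>}" using assms by simp
  then have "digit_edge False ` edges l \<subseteq> {\<kappa>}" "digit_edge True ` edges r \<subseteq> {\<kappa>}" by blast+
  then show "edges l = {digit_edge False \<kappa>}" "edges r = {digit_edge True \<kappa>}"
    by (simp_all only: digit_edge_image_singleton edges_nonempty not_False_eq_True)
qed

text \<open>Suppose that the edge is \<open>Plus\<close> and the root label is 0. Then the node at 1
  has only the edge \<open>Third\<close>, so its label is 0 too, and the nodes at 0, 10, 11 have the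
  single edges \<open>Plus\<close>, \<open>Minus\<close>, \<open>Plus\<close>. By induction these
  letters occur, and they form a contraction. The other sign is symmetric.\<close>

lemma contracted_root:
  assumes "contracted c" "edges c = {sign_edge e}"
  shows "label c [] \<noteq> 0 \<and> sign_of (label c []) = e"
  using assms
proof (induction "size c" arbitrary: c e rule: less_induct)
  case less
  obtain t l r where c: "c = Br t l r" using less.prems by (cases c) auto
  show ?case
  proof (cases "t = 0")
    case False
    then show ?thesis using less.prems by (simp add: c)
  next
    case True
    have con: "contracted l" "contracted r" "\<not> contractible (label c) []"
      using less.prems by (auto simp: c contracted_Br)
    have lr: "edges l = {digit_edge False (sign_edge e)}" "edges r = {digit_edge True (sign_edge e)}"
      using less.prems(2) edges_Br_singleton unfolding c True by blast+
    show ?thesis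
    proof (cases e)
      case Pos
      obtain u m n where r: "r = Br u m n" using lr Pos by (cases r) auto
      have u: "u = 0" using lr Pos by (cases "sign_of u") (auto simp: r split: if_splits)
      have mn: "edges m = {Minus}" "edges n = {Plus}"
        using edges_Br_singleton[of m n "Third"] lr Pos u by (simp_all add: r del: edges.simps)
      have "label l [] > 0" using less.hyps[of l Pos] con lr Pos by (auto simp: c sign_of_def split: if_splits)
      moreover have "label m [] < 0"
        using less.hyps[of m Neg] con mn by (auto simp: c r contracted_Br sign_of_def split: if_splits)
      moreover have "label n [] > 0"
        using less.hyps[of n Pos] con mn by (auto simp: c r contracted_Br sign_of_def split: if_splits)
      ultimately show ?thesis using con(3) by (simp add: contractible_def c r u)
    next
      case Neg
      obtain u m n where l: "l = Br u m n" using lr Neg by (cases l) auto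
      have u: "u = 0" using lr Neg by (cases "sign_of u") (auto simp: l split: if_splits)
      have mn: "edges m = {Minus}" "edges n = {Plus}"
        using edges_Br_singleton[of m n "Third"] lr Neg u by (simp_all add: l del: edges.simps)
      have "label r [] < 0" using less.hyps[of r Neg] con lr Neg by (auto simp: c sign_of_def split: if_splits)
      moreover have "label m [] < 0"
        using less.hyps[of m Neg] con mn by (auto simp: c l contracted_Br sign_of_def split: if_splits)
      moreover have "label n [] > 0"
        using less.hyps[of n Pos] con mn by (auto simp: c l contracted_Br sign_of_def split: if_splits)
      ultimately show ?thesis using con(3) by (simp add: contractible_def c l u)
    qed
  qed
qed

lemma locally_prefix_tail:
  assumes "locally_prefix h" "bij h" "\<And>\<zeta>. shd (h \<zeta>) = shd \<zeta>"
  defines "g \<equiv> \<lambda>b \<zeta>. stl (h (b ## \<zeta>))"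
  shows "h (b ## \<zeta>) = b ## g b \<zeta>" "locally_prefix (g b)" "bij (g b)"
proof -
  show h: "h (b ## \<zeta>) = b ## g b \<zeta>" for b \<zeta>
  proof -
    have "shd (h (b ## \<zeta>)) = b" using assms(3)[of "b ## \<zeta>"] by simp
    then show ?thesis unfolding g_def by (intro stream.expand) simp
  qed
  show "locally_prefix (g b)"
    unfolding locally_prefix_def
  proof
    fix \<eta>
    obtain n w where nw: "Suc 0 \<le> n" "Suc 0 \<le> length w" "\<And>\<zeta>. h (stake n (b ## \<eta>) @- \<zeta>) = w @- \<zeta>"
      using locally_prefixE[OF assms(1)] by metis
    obtain m where n: "n = Suc m" using nw by (cases n) auto
    have "g b (stake m \<eta> @- \<zeta>) = tl w @- \<zeta>" for \<zeta>
    proof -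
      have "stl (h (b ## stake m \<eta> @- \<zeta>)) = stl (w @- \<zeta>)" using nw(3)[of \<zeta>] by (simp add: n)
      then show ?thesis using nw(2) by (cases w) (auto simp: g_def)
    qed
    then show "\<exists>n w. \<forall>\<zeta>. g b (stake n \<eta> @- \<zeta>) = w @- \<zeta>" by blast
  qed
  show "bij (g b)"
  proof (rule bijI)
    show "inj (g b)"
    proof (rule injI)
      fix \<zeta> \<xi> assume "g b \<zeta> = g b \<xi>"
      then have "h (b ## \<zeta>) = h (b ## \<xi>)" by (simp add: h)
      then show "\<zeta> = \<xi>" using assms(2) by (simp add: bij_is_inj inj_eq)
    qed
    show "surj (g b)"
      unfolding surj_def
    proof
      fix \<xi>
      obtain \<eta> where \<eta>: "h \<eta> = b ## \<xi>" using assms(2) by (metis bij_pointE)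
      have "shd \<eta> = shd (h \<eta>)" by (simp only: assms(3))
      then have "b ## stl \<eta> = \<eta>" by (simp add: \<eta> stream.expand)
      then have "g b (stl \<eta>) = \<xi>" by (simp add: g_def \<eta>)
      then show "\<exists>\<zeta>. \<xi> = g b \<zeta>" by blast
    qed
  qed
qed

lemma tree_map_remove_root:
  assumes "t \<noteq> 0"
  shows "tree_map (Br t l r) \<eta> = y_rec (sign_of t) (tree_map (Br (t - sign_int (sign_of t)) l r) \<eta>)"
proof (cases "t - sign_int (sign_of t) = 0")
  case True
  then have "nat \<bar>t\<bar> = Suc 0" by (auto simp: sign_int_def sign_of_def split: if_splits)
  then show ?thesis using True by simp
next
  case False
  then have "nat \<bar>t\<bar> = Suc (nat \<bar>t - sign_int (sign_of t)\<bar>)" "sign_of (t - sign_int (sign_of t)) = sign_of t"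
    using assms by (auto simp: sign_int_def sign_of_def split: if_splits)
  then show ?thesis by simp
qed

lemma as_Br_map:
  obtains t l r where "tree_map c = tree_map (Br t l r)" "edges c = edges (Br t l r)"
    "reduced c = reduced (Br t l r)" "contracted c = contracted (Br t l r)"
    "label c = label (Br t l r)" "c \<noteq> Tip \<Longrightarrow> c = Br t l r" "c = Tip \<Longrightarrow> t = 0 \<and> l = Tip \<and> r = Tip"
proof (cases c)
  case Tip
  have "label (Br 0 Tip Tip) = label Tip"
  proof
    fix u show "label (Br 0 Tip Tip) u = label Tip u" by (cases u) auto
  qed
  moreover have "contracted (Br 0 Tip Tip)" by (simp add: contracted_Br contractible_def)
  moreover have "tree_map (Br 0 Tip Tip) = id" by (simp add: fun_eq_iff)
  ultimately show ?thesis by (intro that[of 0 Tip Tip]) (simp_all add: Tip)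
next
  case (Br t l r)
  show ?thesis by (rule that[of t l r]) (simp_all add: Br)
qed

text \<open>The first edges of c and c' agree.  Hence the roots carry letters of the same sign, which are
  removed, or h preserves the two halves of the Cantor set, and one descends to the children.\<close>

theorem label_unique:
  assumes "reduced c" "contracted c" "reduced c'" "contracted c'"
    "locally_prefix h" "bij h" "\<And>\<eta>. tree_map c \<eta> = tree_map c' (h \<eta>)"
  shows "label c = label c'"
  using assms
\<comment> \<open>Removing a root letter from each tree lowers the weights and keeps the sizes;
  descending to the children lowers the sizes.\<close>
proof (induction "size c + size c' + weight c + weight c'" arbitrary: c c' h rule: less_induct)
  case less
  show ?case
  proof (cases "c = Tip \<and> c' = Tip")
    case False
    obtain t l r where c: "tree_map c = tree_map (Br t l r)" "edges c = edges (Br t l r)"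
      "reduced c = reduced (Br t l r)" "contracted c = contracted (Br t l r)"
      "label c = label (Br t l r)" "c \<noteq> Tip \<Longrightarrow> c = Br t l r" "c = Tip \<Longrightarrow> t = 0 \<and> l = Tip \<and> r = Tip"
      using as_Br_map[of c] by metis
    obtain t' l' r' where c': "tree_map c' = tree_map (Br t' l' r')" "edges c' = edges (Br t' l' r')"
      "reduced c' = reduced (Br t' l' r')" "contracted c' = contracted (Br t' l' r')"
      "label c' = label (Br t' l' r')" "c' \<noteq> Tip \<Longrightarrow> c' = Br t' l' r'" "c' = Tip \<Longrightarrow> t' = 0 \<and> l' = Tip \<and> r' = Tip"
      using as_Br_map[of c'] by metis
    have e: "edges c = edges c'"
      using edges_eq less.prems by blast
    have root: "t' \<noteq> 0 \<and> sign_of t' = sign_of t" if "t \<noteq> 0"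
      using contracted_root[of c' "sign_of t"] less.prems that e c c' by simp
    have root': "t \<noteq> 0 \<and> sign_of t = sign_of t'" if "t' \<noteq> 0"
      using contracted_root[of c "sign_of t'"] less.prems that e c c' by simp
    show ?thesis
    proof (cases "t = 0")
      case False
      define e where "e = sign_of t"
      have t': "t' \<noteq> 0" "sign_of t' = e" using root False by (auto simp: e_def)
      have cc: "c = Br t l r" "c' = Br t' l' r'" using c c' False t' by auto
      let ?d = "Br (t - sign_int e) l r" and ?d' = "Br (t' - sign_int e) l' r'"
      have red: "reduced (Br (t - sign_int (sign_of t)) l r)" if "t \<noteq> 0" "reduced (Br t l r)" for t l r
        using reduced_remove_root[OF that(2)] that(1) by (cases "t > 0") (auto simp: sign_int_def sign_of_def)
      have con: "contracted (Br t l r) = contracted (Br u l r)" for t u l r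
        by (simp add: contracted_Br contractible_def)
      have wt: "weight (Br (t - sign_int (sign_of t)) l r) < weight (Br t l r)" if "t \<noteq> 0" for t l r
        using that by (auto simp: sign_int_def sign_of_def)
      have eq: "tree_map ?d \<eta> = tree_map ?d' (h \<eta>)" for \<eta>
      proof -
        have "y_rec e (tree_map ?d \<eta>) = tree_map c \<eta>"
          unfolding cc e_def by (rule tree_map_remove_root[OF False, symmetric])
        also have "\<dots> = tree_map c' (h \<eta>)" by (rule less.prems(7))
        also have "\<dots> = y_rec e (tree_map ?d' (h \<eta>))"
          unfolding cc t'(2)[symmetric] by (rule tree_map_remove_root[OF t'(1)])
        finally show ?thesis by (metis y_rec_opposite)
      qed
      have "label ?d = label ?d'"
      proof (rule less.hyps[where h = h])
        show "size ?d + size ?d' + weight ?d + weight ?d' < size c + size c' + weight c + weight c'"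
        proof -
          have "weight ?d < weight c" unfolding cc e_def by (rule wt[OF False])
          moreover have "weight ?d' < weight c'" unfolding cc t'(2)[symmetric] by (rule wt[OF t'(1)])
          moreover have "size ?d = size c" "size ?d' = size c'" by (simp_all add: cc)
          ultimately show ?thesis by linarith
        qed
        show "reduced ?d" "reduced ?d'"
          using red[OF False, of l r] red[OF t'(1), of l' r'] less.prems t'(2) unfolding cc e_def[symmetric] by auto
        show "contracted ?d" "contracted ?d'"
          using less.prems con unfolding cc by metis+
      qed (use less.prems eq in auto)
      then have "label ?d u = label ?d' u" for u by metis
      from this[of "[]"] this[of "_ # _"] have "t = t'" "label (Br t l r) (b # u) = label (Br t l' r') (b # u)" for b u
        by (simp, metis label.simps(3))
      then have "label (Br t l r) u = label (Br t' l' r') u" for u by (cases u) auto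
      then show ?thesis unfolding cc by blast
    next
      case True
      then have t': "t' = 0" using root' by blast
      \<comment> \<open>With zero root labels both tree maps keep the first digit, so
        \<open>h\<close> keeps it as well and restricts to each half.\<close>
      have shd: "shd (tree_map (Br 0 l r) \<eta>) = shd \<eta>" for l r \<eta> by simp
      have "shd (h \<eta>) = shd \<eta>" for \<eta>
        using less.prems(7)[of \<eta>] shd[of l r \<eta>] shd[of l' r' "h \<eta>"] unfolding c(1) c'(1) True t' by simp
      note h = locally_prefix_tail[OF less.prems(5,6) this]
      have eq: "tree_map (Br 0 l r) (b ## \<zeta>) = tree_map (Br 0 l' r') (b ## stl (h (b ## \<zeta>)))" for b \<zeta>
        using less.prems(7)[of "b ## \<zeta>"] h(1)[of b \<zeta>] unfolding c(1) c'(1) True t' by simp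
      have red: "reduced l" "reduced r" "contracted l" "contracted r"
        "reduced l'" "reduced r'" "contracted l'" "contracted r'"
        using less.prems c c' by (auto simp: contracted_Br)
      have size: "size l + size l' + weight l + weight l' < size c + size c' + weight c + weight c'"
        "size r + size r' + weight r + weight r' < size c + size c' + weight c + weight c'"
        using c(6,7) c'(6,7) False by (cases "c = Tip"; cases "c' = Tip"; simp)+
      have "label l = label l'"
        using eq[of False] red by (intro less.hyps[OF size(1) _ _ _ _ h(2,3)[of False]]) simp_all
      moreover have "label r = label r'"
        using eq[of True] red by (intro less.hyps[OF size(2) _ _ _ _ h(2,3)[of True]]) simp_all
      ultimately have "label (Br 0 l r) u = label (Br 0 l' r') u" for u
        by (induction u) auto
      then show ?thesis unfolding c(5) c'(5) True t' by blast
    qed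
  qed simp
qed

lemma locally_prefix_comp:
  assumes "locally_prefix g" "locally_prefix h" shows "locally_prefix (g \<circ> h)"
  unfolding locally_prefix_def
proof
  fix \<eta>
  obtain m v where mv: "\<And>\<zeta>. g (stake m (h \<eta>) @- \<zeta>) = v @- \<zeta>"
    using locally_prefixE[OF assms(1)] by metis
  obtain n w where nw: "m \<le> length w" "\<And>\<zeta>. h (stake n \<eta> @- \<zeta>) = w @- \<zeta>"
    using locally_prefixE[OF assms(2)] by metis
  have "h \<eta> = w @- sdrop n \<eta>" using nw(2)[of "sdrop n \<eta>"] by (simp add: stake_sdrop)
  then have "stake m (h \<eta>) = take m w" using nw(1) by (simp add: stake_shift)
  then have "w = stake m (h \<eta>) @ drop m w" by simp
  then have "w @- \<zeta> = stake m (h \<eta>) @- drop m w @- \<zeta>" for \<zeta> by (metis shift_append)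
  then have "(g \<circ> h) (stake n \<eta> @- \<zeta>) = (v @ drop m w) @- \<zeta>" for \<zeta> using mv nw by simp
  then show "\<exists>n w. \<forall>\<zeta>. (g \<circ> h) (stake n \<eta> @- \<zeta>) = w @- \<zeta>" by blast
qed

lemma locally_prefix_x: "locally_prefix (localize s (x_sgn e))"
  unfolding locally_prefix_def
proof
  fix \<eta>
  show "\<exists>n w. \<forall>\<zeta>. localize s (x_sgn e) (stake n \<eta> @- \<zeta>) = w @- \<zeta>"
  proof (cases rule: stream_inside_cases[of \<eta> s])
    case (1 \<zeta>)
    obtain a b \<xi> where \<zeta>: "\<zeta> = a ## b ## \<xi>" by (metis stream.collapse)
    have "\<exists>w. \<forall>\<xi>. x_sgn e (a ## b ## \<xi>) = w @- \<xi>"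
    proof -
      have "x_sgn e (a ## b ## \<xi>) = (case e of
          Pos \<Rightarrow> if a then [True, True, b] else if b then [True, False] else [False]
        | Neg \<Rightarrow> if \<not> a then [False, False, b] else if b then [True] else [False, True]) @- \<xi>" for \<xi>
        by (cases e; cases a; cases b) simp_all
      then show ?thesis by blast
    qed
    then obtain w where "\<And>\<xi>. x_sgn e (a ## b ## \<xi>) = w @- \<xi>" by blast
    moreover have "stake (length s + 2) \<eta> = s @ [a, b]"
      by (simp add: 1 \<zeta> stake_shift numeral_2_eq_2)
    ultimately have "localize s (x_sgn e) (stake (length s + 2) \<eta> @- \<xi>) = (s @ w) @- \<xi>" for \<xi>
      by simp
    then show ?thesis by blast
  next
    case 2
    then have "localize s (x_sgn e) (stake (length s) \<eta> @- \<xi>) = stake (length s) \<eta> @- \<xi>" for \<xi>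
      by (intro localize_outside) (simp add: stake_shift)
    then show ?thesis by blast
  qed
qed

lemma locally_prefix_X_word: "X_word f \<Longrightarrow> locally_prefix (word_map f)"
proof (induction f)
  case Nil
  show ?case by (auto simp: locally_prefix_def)
next
  case (Cons l f)
  then obtain s e where "l = X s e" by (auto simp: X_word_def)
  then show ?case using Cons unfolding word_map_Cons
    by (intro locally_prefix_comp) (auto simp: letter_map_X locally_prefix_x)
qed

fun inverse_letter :: "letter \<Rightarrow> letter" where
  "inverse_letter (X s e) = X s (opposite e)"
| "inverse_letter (Y s e) = Y s (opposite e)"

definition inverse_word :: "word \<Rightarrow> word" where
  "inverse_word w = rev (map inverse_letter w)"

lemma letter_map_inverse: "letter_map (inverse_letter l) \<circ> letter_map l = id"
proof (cases l)
  case (X s e)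
  have "localize s (x_sgn (opposite e)) \<circ> localize s (x_sgn e) = id"
    unfolding localize_comp[symmetric] by (simp add: comp_def)
  then show ?thesis by (simp only: X inverse_letter.simps letter_map_X)
next
  case (Y s e)
  have "localize s (y_rec (opposite e)) \<circ> localize s (y_rec e) = id"
    unfolding localize_comp[symmetric] by (simp add: comp_def)
  then show ?thesis by (simp only: Y inverse_letter.simps letter_map_Y)
qed

lemma word_map_inverse: "word_map (inverse_word w) \<circ> word_map w = id"
proof (induction w)
  case (Cons l w)
  have "word_map (inverse_word (l # w)) \<circ> word_map (l # w) =
      letter_map (inverse_letter l) \<circ> (word_map (inverse_word w) \<circ> word_map w) \<circ> letter_map l"
    by (simp add: inverse_word_def word_map_append word_map_Cons comp_assoc)
  then show ?case by (simp only: Cons comp_id letter_map_inverse)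
qed (simp add: inverse_word_def)

lemma X_word_inverse: "X_word f \<Longrightarrow> X_word (inverse_word f)"
  by (force simp: X_word_def inverse_word_def)

text \<open>The two F-parts are combined into the single map \<open>h\<close>, first the inverse of
  \<open>f\<close> and then \<open>f'\<close>. The conclusion is about labels because
  \<open>Tip\<close> and \<open>Br 0 Tip Tip\<close> give the same word.\<close>

lemma tree_label_unique:
  assumes "reduced c" "contracted c" "reduced c'" "contracted c'" "X_word f" "X_word f'"
    "word_map (f @ tree_word [] c) = word_map (f' @ tree_word [] c')"
  shows "label c = label c'"
proof (rule label_unique[OF assms(1-4)])
  let ?h = "word_map (inverse_word f @ f')"
  show "locally_prefix ?h" using assms by (intro locally_prefix_X_word) (simp add: X_word_inverse)
  show "bij ?h" by (rule bij_word_map)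
  fix \<eta>
  have inv: "word_map f (word_map (inverse_word f) \<eta>) = \<eta>"
    using word_map_inverse[of f] bij_word_map[of f] by (metis bij_pointE comp_apply id_apply)
  have "tree_map c (word_map f \<zeta>) = tree_map c' (word_map f' \<zeta>)" for \<zeta>
    using fun_cong[OF assms(7), of \<zeta>] by (simp add: word_map_append word_map_tree_word)
  from this[of "word_map (inverse_word f) \<eta>"]
  show "tree_map c \<eta> = tree_map c' (?h \<eta>)" by (simp add: inv word_map_append)
qed

section \<open>Normal forms in Thompson's group F\<close>

text \<open>The list \<open>[(a\<^sub>0, b\<^sub>0), (a\<^sub>1, b\<^sub>1), \<dots>]\<close> encodes the word with the exponents \<open>a\<^sub>k\<close> and \<open>-b\<^sub>k\<close>.\<close>

fun nf_word :: "nat \<Rightarrow> (nat \<times> nat) list \<Rightarrow> word" where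
  "nf_word k [] = []"
| "nf_word k ((a, b) # L) =
     x_pow (replicate k True) (int a) @ nf_word (Suc k) L @ x_pow (replicate k True) (- int b)"

fun nf_map :: "(nat \<times> nat) list \<Rightarrow> bool stream \<Rightarrow> bool stream" where
  "nf_map [] = id"
| "nf_map ((a, b) # L) = (x_sgn Neg ^^ b) \<circ> localize [True] (nf_map L) \<circ> (x_sgn Pos ^^ a)"

text \<open>At the last entry the two conditions combine: not both exponents are positive and not
  both are 0, so exactly one is nonzero.\<close>

fun nf_reduced :: "(nat \<times> nat) list \<Rightarrow> bool" where
  "nf_reduced [] \<longleftrightarrow> True"
| "nf_reduced ((a, b) # L) \<longleftrightarrow> nf_reduced L \<and> (a > 0 \<and> b > 0 \<longrightarrow> L \<noteq> [] \<and> hd L \<noteq> (0, 0)) \<and>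
     (L = [] \<longrightarrow> (a, b) \<noteq> (0, 0))"

lemma x_pow_int: "x_pow s (int a) = replicate a (X s Pos)" "x_pow s (- int b) = replicate b (X s Neg)"
  by (auto simp: x_pow_def sign_of_def)

lemma word_map_replicate_X: "word_map (replicate n (X s e)) = localize s (x_sgn e ^^ n)"
proof (induction n)
  case (Suc n)
  then show ?case
    unfolding funpow_Suc_right replicate_Suc word_map_Cons letter_map_X localize_comp by simp
qed (simp add: id_def[symmetric])

lemma word_map_nf_word: "word_map (nf_word k L) = localize (replicate k True) (nf_map L)"
proof (induction L arbitrary: k rule: nf_reduced.induct)
  case (2 a b L)
  have "localize (replicate (Suc k) True) g = localize (replicate k True) (localize [True] g)" for g
  proof -
    have "replicate (Suc k) True = replicate k True @ [True]" by (simp add: replicate_append_same)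
    then show ?thesis by (simp only: localize_append)
  qed
  then show ?case
    by (simp only: nf_word.simps nf_map.simps word_map_append x_pow_int word_map_replicate_X 2 localize_comp)
qed (simp add: id_def[symmetric])

lemma X_word_nf_word: "X_word (nf_word k L)"
  by (induction k L rule: nf_word.induct) (auto simp: x_pow_def X_word_def)

lemma nf_word_concat:
  "nf_word j L = concat (map (\<lambda>k. x_pow (replicate (j + k) True) (int (fst (L ! k)))) [0..<length L]) @
    concat (map (\<lambda>k. x_pow (replicate (j + k) True) (- int (snd (L ! k)))) (rev [0..<length L]))"
proof (induction j L rule: nf_word.induct)
  case (2 j a b L)
  have upt: "[0..<Suc (length L)] = 0 # map Suc [0..<length L]"
    by (metis map_Suc_upt upt_conv_Cons zero_less_Suc)
  show ?case unfolding nf_word.simps 2 length_Cons upt by (simp add: comp_def rev_map)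
qed simp

lemma nf_reduced_nth:
  "nf_reduced L \<longleftrightarrow> (\<forall>k. Suc k < length L \<longrightarrow> fst (L ! k) > 0 \<longrightarrow> snd (L ! k) > 0 \<longrightarrow> L ! Suc k \<noteq> (0, 0)) \<and>
    (L \<noteq> [] \<longrightarrow> (fst (last L) = 0 \<longleftrightarrow> snd (last L) \<noteq> 0))"
proof (induction L rule: nf_reduced.induct)
  case (2 a b L)
  let ?P = "\<lambda>L k. fst (L ! k) > 0 \<longrightarrow> snd (L ! k) > 0 \<longrightarrow> L ! Suc k \<noteq> (0, 0)"
  have "(\<forall>k. Suc k < length ((a, b) # L) \<longrightarrow> ?P ((a, b) # L) k) \<longleftrightarrow>
      (L \<noteq> [] \<longrightarrow> a > 0 \<longrightarrow> b > 0 \<longrightarrow> hd L \<noteq> (0, 0)) \<and> (\<forall>k. Suc k < length L \<longrightarrow> ?P L k)"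
  proof (intro iffI conjI allI impI)
    fix k assume "(L \<noteq> [] \<longrightarrow> a > 0 \<longrightarrow> b > 0 \<longrightarrow> hd L \<noteq> (0, 0)) \<and> (\<forall>k. Suc k < length L \<longrightarrow> ?P L k)"
      "Suc k < length ((a, b) # L)" "fst (((a, b) # L) ! k) > 0" "snd (((a, b) # L) ! k) > 0"
    then show "((a, b) # L) ! Suc k \<noteq> (0, 0)" by (cases k) (auto simp: hd_conv_nth)
  next
    assume *: "\<forall>k. Suc k < length ((a, b) # L) \<longrightarrow> ?P ((a, b) # L) k"
    show "hd L \<noteq> (0, 0)" if "L \<noteq> []" "a > 0" "b > 0"
      using *[rule_format, of 0] that by (simp add: hd_conv_nth)
    show "L ! Suc k \<noteq> (0, 0)" if "Suc k < length L" "fst (L ! k) > 0" "snd (L ! k) > 0" for k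
      using *[rule_format, of "Suc k"] that by simp
  qed
  then show ?case using 2 by (cases "L = []") auto
qed simp

lemma F_normal_form_iff: "F_normal_form w \<longleftrightarrow> (\<exists>L. nf_reduced L \<and> w = nf_word 0 L)"
proof
  assume "F_normal_form w"
  then show "\<exists>L. nf_reduced L \<and> w = nf_word 0 L"
    unfolding F_normal_form_def
  proof (elim disjE exE conjE)
    assume "w = []"
    then show ?thesis by (intro exI[of _ "[]"]) simp
  next
    fix n and a b :: "nat \<Rightarrow> nat"
    assume 2: "a n = 0 \<longleftrightarrow> b n \<noteq> 0" "\<forall>k < n. a k > 0 \<and> b k > 0 \<longrightarrow> a (k + 1) > 0 \<or> b (k + 1) > 0"
      "w = concat (map (\<lambda>k. x_pow (replicate k True) (int (a k))) [0..<n + 1]) @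
         concat (map (\<lambda>k. x_pow (replicate k True) (- int (b k))) (rev [0..<n + 1]))"
    let ?L = "map (\<lambda>k. (a k, b k)) [0..<n + 1]"
    have nth: "?L ! k = (a k, b k)" if "k < n + 1" for k
      using that nth_map[of k "[0..<n + 1]"] by (simp del: upt_Suc)
    have "last ?L = (a n, b n)" by simp
    then have "nf_reduced ?L"
      unfolding nf_reduced_nth using 2(1,2) nth by (auto simp del: upt_Suc)
    moreover have "nf_word 0 ?L = w"
    proof -
      have "map (\<lambda>k. x_pow (replicate (0 + k) True) (int (fst (?L ! k)))) [0..<length ?L] =
          map (\<lambda>k. x_pow (replicate k True) (int (a k))) [0..<n + 1]"
        using nth by (intro map_cong) (auto simp del: upt_Suc)
      moreover have "map (\<lambda>k. x_pow (replicate (0 + k) True) (- int (snd (?L ! k)))) (rev [0..<length ?L]) =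
          map (\<lambda>k. x_pow (replicate k True) (- int (b k))) (rev [0..<n + 1])"
        using nth by (intro map_cong) (auto simp del: upt_Suc)
      ultimately show ?thesis unfolding nf_word_concat 2(3) by (simp only:)
    qed
    ultimately show ?thesis by metis
  qed
next
  assume "\<exists>L. nf_reduced L \<and> w = nf_word 0 L"
  then obtain L where L: "nf_reduced L" "w = nf_word 0 L" by blast
  show "F_normal_form w"
  proof (cases "L = []")
    case True
    then show ?thesis using L by (simp add: F_normal_form_def)
  next
    case False
    define n where "n = length L - 1"
    have n: "length L = n + 1" using False by (simp add: n_def)
    have last: "last L = L ! n" using False by (simp add: last_conv_nth n_def)
    show ?thesis unfolding F_normal_form_def
    proof (rule disjI2, rule exI[of _ n], rule exI[of _ "\<lambda>k. fst (L ! k)"],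
        rule exI[of _ "\<lambda>k. snd (L ! k)"], intro conjI)
      show "fst (L ! n) = 0 \<longleftrightarrow> snd (L ! n) \<noteq> 0"
        using L(1) False unfolding nf_reduced_nth last by blast
      show "\<forall>k<n. fst (L ! k) > 0 \<and> snd (L ! k) > 0 \<longrightarrow> fst (L ! (k + 1)) > 0 \<or> snd (L ! (k + 1)) > 0"
        using L(1) unfolding nf_reduced_nth n by (auto simp: prod_eq_iff)
      show "w = concat (map (\<lambda>k. x_pow (replicate k True) (int (fst (L ! k)))) [0..<n + 1]) @
         concat (map (\<lambda>k. x_pow (replicate k True) (- int (snd (L ! k)))) (rev [0..<n + 1]))"
        unfolding L(2) nf_word_concat n by simp
    qed
  qed
qed

section \<open>Uniqueness of the normal form in F\<close>

lemma x_sgn_cancel: "x_sgn Neg (x_sgn Pos \<eta>) = \<eta>" "x_sgn Pos (x_sgn Neg \<eta>) = \<eta>"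
  using x_sgn_opposite[of Pos \<eta>] x_sgn_opposite[of Neg \<eta>] by simp_all

lemma x_pow_cancel: "(x_sgn Neg ^^ a) ((x_sgn Pos ^^ a) \<eta>) = \<eta>"
proof (induction a arbitrary: \<eta>)
  case (Suc a)
  have "(x_sgn Neg ^^ Suc a) ((x_sgn Pos ^^ Suc a) \<eta>) = (x_sgn Neg ^^ a) (x_sgn Neg (x_sgn Pos ((x_sgn Pos ^^ a) \<eta>)))"
    by (simp add: funpow_swap1)
  then show ?case by (simp only: x_sgn_cancel Suc)
qed simp

lemma bij_x_pow: "bij (x_sgn e ^^ a)"
proof (induction a)
  case (Suc a)
  then show ?case unfolding funpow.simps by (rule bij_comp) simp
qed (simp only: funpow.simps bij_id)

lemma inj_x_pow: "(x_sgn e ^^ a) \<eta> = (x_sgn e ^^ a) \<xi> \<longleftrightarrow> \<eta> = \<xi>"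
  using bij_x_pow by (metis bij_pointE)

lemma x_pos_pow: "(x_sgn Pos ^^ a) (replicate (a + Suc n) False @- \<eta>) = replicate (Suc n) False @- \<eta>"
proof (induction a)
  case (Suc a)
  have "(x_sgn Pos ^^ Suc a) (replicate (Suc a + Suc n) False @- \<eta>) =
    (x_sgn Pos ^^ a) (x_sgn Pos (False ## False ## replicate (a + n) False @- \<eta>))"
    by (simp add: funpow_swap1)
  then show ?case using Suc by simp
qed simp

lemma x_neg_pow: "(x_sgn Neg ^^ b) (replicate (Suc n) False @- \<eta>) = replicate (b + Suc n) False @- \<eta>"
  by (induction b) simp_all

lemma x_pos_pow_True:
  "(x_sgn Pos ^^ Suc k) (replicate (Suc k) False @- True ## \<xi>) = True ## False ## \<xi>"
proof -
  have "replicate (Suc k) False @- True ## \<xi> = replicate (k + Suc 0) False @- (True ## \<xi>)" by simp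
  then have "(x_sgn Pos ^^ Suc k) (replicate (Suc k) False @- True ## \<xi>) =
      x_sgn Pos (replicate (Suc 0) False @- (True ## \<xi>))"
    by (simp only: funpow.simps comp_apply x_pos_pow)
  then show ?thesis by simp
qed

lemma localize_True_False [simp]: "localize [True] g (False ## \<eta>) = False ## \<eta>"
  "localize [True] g (True ## \<eta>) = True ## g \<eta>"
  by (simp_all add: localize_Cons)

text \<open>All inner letters fix the cone 0, so near 000... only the outer powers of x are felt:
  \<open>a\<close> zeros are removed and \<open>b\<close> are added. This makes b - a an invariant
  of the map.\<close>

lemma nf_map_at_0:
  assumes "a < N"
  shows "nf_map ((a, b) # L) (replicate N False @- \<eta>) = replicate (N - a + b) False @- \<eta>"
proof -
  obtain n where N: "N = a + Suc n" using assms less_iff_Suc_add by auto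
  have "localize [True] (nf_map L) (replicate (Suc n) False @- \<eta>) = replicate (Suc n) False @- \<eta>"
    by simp
  then have "nf_map ((a, b) # L) (replicate N False @- \<eta>) = (x_sgn Neg ^^ b) (replicate (Suc n) False @- \<eta>)"
    unfolding N nf_map.simps comp_apply x_pos_pow by (simp only:)
  then show ?thesis unfolding x_neg_pow by (simp add: N add.commute)
qed

lemma replicate_False_eq:
  "replicate m False @- True ## \<eta> = replicate n False @- True ## \<eta>' \<Longrightarrow> m = n"
proof (induction m arbitrary: n)
  case 0
  then show ?case by (cases n) auto
next
  case (Suc m)
  then show ?case by (cases n) auto
qed

lemma nf_map_exponents:
  assumes "nf_map ((a, b) # L) = nf_map ((a', b') # L')" shows "a + b' = a' + b"
proof -
  let ?N = "Suc (a + a')"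
  have "replicate (?N - a + b) False @- True ## sconst True = replicate (?N - a' + b') False @- True ## sconst True"
    using nf_map_at_0[of a ?N b L "True ## sconst True"] nf_map_at_0[of a' ?N b' L' "True ## sconst True"]
    unfolding assms by simp
  from replicate_False_eq[OF this] show ?thesis by simp
qed

text \<open>Otherwise the letters \<open>x\<^sup>a\<close> and \<open>x\<^sup>-\<^sup>a\<close> at both ends conjugate the fixed cone 0 to the cone 10,
  so the rest of the word fixes a cone 0 as well, contradicting the normal form condition.\<close>

lemma nf_map_fixes_0:
  assumes "nf_reduced L" "\<And>\<xi>. nf_map L (False ## \<xi>) = False ## \<xi>"
  shows "L = [] \<or> hd L = (0, 0)"
  using assms
proof (induction L rule: nf_reduced.induct)
  case (2 a b L)
  have "replicate (Suc a - a + b) False @- True ## sconst True = replicate (Suc a) False @- True ## sconst True"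
    using nf_map_at_0[of a "Suc a" b L "True ## sconst True"] 2(3)[of "replicate a False @- True ## sconst True"]
    by simp
  from replicate_False_eq[OF this] have ab: "a = b" by simp
  have "a = 0"
  proof (rule ccontr)
    assume "a \<noteq> 0"
    then obtain k where k: "a = Suc k" using not0_implies_Suc by blast
    have "nf_map L (False ## \<xi>) = False ## \<xi>" for \<xi>
    proof -
      let ?\<eta> = "replicate (Suc k) False @- True ## \<xi>"
      have "nf_map ((a, b) # L) ?\<eta> = ?\<eta>" using 2(3)[of "replicate k False @- True ## \<xi>"] by simp
      then have "(x_sgn Neg ^^ a) (localize [True] (nf_map L) ((x_sgn Pos ^^ a) ?\<eta>)) = (x_sgn Neg ^^ a) ((x_sgn Pos ^^ a) ?\<eta>)"
        unfolding x_pow_cancel by (simp only: nf_map.simps comp_apply ab)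
      then have "localize [True] (nf_map L) ((x_sgn Pos ^^ a) ?\<eta>) = (x_sgn Pos ^^ a) ?\<eta>"
        by (simp only: inj_x_pow)
      then show ?thesis unfolding k x_pos_pow_True by simp
    qed
    then have "L = [] \<or> hd L = (0, 0)" using 2 by simp
    then show False using 2(2) k ab by auto
  qed
  then show ?case using ab by simp
qed simp

lemma localize_True_inj: "localize [True] g = localize [True] h \<Longrightarrow> g = h"
proof
  fix \<eta> assume "localize [True] g = localize [True] h"
  then have "localize [True] g (True ## \<eta>) = localize [True] h (True ## \<eta>)" by simp
  then show "g \<eta> = h \<eta>" by simp
qed

text \<open>If \<open>a\<close> is smaller by k + 1, so is \<open>b\<close>, as their difference is
  an invariant. Removing the common outer powers leaves a map that fixes the cone 0, written as the
  map of \<open>L'\<close> in the cone 1, conjugated by x^(k+1). This power carries the cone 0^(k+1)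
  1 to the cone 10, so \<open>L'\<close> fixes its cone 0, which the condition on the positive
  exponents \<open>a'\<close> and \<open>b'\<close> excludes.\<close>

lemma nf_map_exponent_le:
  assumes "nf_reduced ((a, b) # L)" "nf_reduced ((a', b') # L')" "nf_map ((a, b) # L) = nf_map ((a', b') # L')"
  shows "\<not> a < a'"
proof
  assume "a < a'"
  then obtain k where a': "a' = a + Suc k" using less_iff_Suc_add by auto
  then have b': "b' = b + Suc k" using nf_map_exponents[OF assms(3)] by simp
  have "nf_map L' (False ## \<xi>) = False ## \<xi>" for \<xi>
  proof -
    let ?\<eta> = "replicate (Suc k) False @- True ## \<xi>"
    obtain \<zeta> where \<zeta>: "(x_sgn Pos ^^ a) \<zeta> = ?\<eta>" using bij_x_pow by (metis bij_pointE)
    have "nf_map ((a, b) # L) \<zeta> = (x_sgn Neg ^^ b) ?\<eta>"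
      by (simp only: nf_map.simps comp_apply \<zeta>) simp
    moreover have "(x_sgn Pos ^^ a') \<zeta> = (x_sgn Pos ^^ Suc k) ((x_sgn Pos ^^ a) \<zeta>)"
      unfolding a' add.commute[of a] by (simp only: funpow_add comp_apply)
    then have "nf_map ((a', b') # L') \<zeta> =
        (x_sgn Neg ^^ b) ((x_sgn Neg ^^ Suc k) (localize [True] (nf_map L') (True ## False ## \<xi>)))"
      unfolding nf_map.simps comp_apply b' \<zeta> x_pos_pow_True by (simp only: funpow_add comp_apply)
    ultimately have "(x_sgn Neg ^^ Suc k) (localize [True] (nf_map L') (True ## False ## \<xi>)) = ?\<eta>"
      using assms(3) by (simp only: inj_x_pow)
    also have "?\<eta> = (x_sgn Neg ^^ Suc k) (True ## False ## \<xi>)"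
      by (metis x_pos_pow_True x_pow_cancel)
    finally show ?thesis by (simp only: inj_x_pow localize_True_False stream.inject)
  qed
  then have "L' = [] \<or> hd L' = (0, 0)" using nf_map_fixes_0 assms(2) by simp
  then show False using assms(2) a' b' by auto
qed

lemma nf_map_eq_id: "nf_reduced L \<Longrightarrow> nf_map L = id \<Longrightarrow> L = []"
proof (induction L rule: nf_reduced.induct)
  case (2 a b L)
  have "hd ((a, b) # L) = (0, 0)"
    using nf_map_fixes_0[OF 2(2)] unfolding 2(3) by simp
  then have ab: "a = 0" "b = 0" by simp_all
  then have "localize [True] (nf_map L) = localize [True] id" using 2(3) by (simp add: id_def)
  then have "nf_map L = id" by (rule localize_True_inj)
  then show ?case using 2 ab by simp
qed simp

theorem nf_map_unique:
  "nf_reduced L \<Longrightarrow> nf_reduced L' \<Longrightarrow> nf_map L = nf_map L' \<Longrightarrow> L = L'"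
proof (induction L arbitrary: L' rule: nf_reduced.induct)
  case 1
  then show ?case using nf_map_eq_id[of L'] by (metis nf_map.simps(1))
next
  case (2 a b L)
  show ?case
  proof (cases L')
    case Nil
    then show ?thesis using nf_map_eq_id[OF 2(2)] 2(4) by (metis nf_map.simps(1))
  next
    case (Cons p M)
    obtain a' b' where L': "L' = (a', b') # M" using Cons by (cases p) auto
    have a: "a' = a" using nf_map_exponent_le 2(2-4) unfolding L' by (metis linorder_neqE_nat)
    then have b: "b' = b" using nf_map_exponents[OF 2(4)[unfolded L']] by simp
    have "localize [True] (nf_map L) = localize [True] (nf_map M)"
    proof
      fix \<eta>
      obtain \<zeta> where \<zeta>: "(x_sgn Pos ^^ a) \<zeta> = \<eta>" using bij_x_pow by (metis bij_pointE)
      show "localize [True] (nf_map L) \<eta> = localize [True] (nf_map M) \<eta>"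
        using fun_cong[OF 2(4)[unfolded L' a b], of \<zeta>] by (simp only: nf_map.simps comp_apply \<zeta> inj_x_pow)
    qed
    then have "nf_map L = nf_map M" by (rule localize_True_inj)
    then show ?thesis using 2 unfolding L' a b by simp
  qed
qed

section \<open>Existence of the normal form in F\<close>

lemma nf_map_zero: "nf_map ((0, 0) # L) = localize [True] (nf_map L)"
  by simp

lemma x_conj_True:
  "x_sgn Neg (localize [True] (localize [True] g) (x_sgn Pos \<eta>)) = localize [True] g \<eta>"
  by (cases rule: y_rec_cases[of \<eta>]) simp_all

text \<open>If both exponents are positive and the next pair is (0, 0), the inner word lives in the
  cone 11, and \<open>x_conj_True\<close> trades one x on either side for moving it to the cone 1.
  With nothing inside, x^a and x^-b simply cancel.\<close>

lemma nf_reduce_Cons: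
  assumes "nf_reduced L" shows "\<exists>M. nf_reduced M \<and> nf_map M = nf_map ((a, b) # L)"
  using assms
proof (induction L arbitrary: a b)
  case Nil
  show ?case
  proof (cases "a = b")
    case True
    have "nf_map [(a, b)] = nf_map []" by (simp add: fun_eq_iff True x_pow_cancel del: comp_apply) (simp add: x_pow_cancel)
    then show ?thesis by (metis nf_reduced.simps(1))
  next
    case False
    show ?thesis
    proof (cases "a < b")
      case True
      then obtain k where b: "b = k + a" "k > 0" using less_imp_add_positive by (metis add.commute)
      have "nf_map [(a, b)] = nf_map [(0, k)]"
        by (simp add: fun_eq_iff b funpow_add x_pow_cancel)
      moreover have "nf_reduced [(0, k)]" using b by simp
      ultimately show ?thesis by metis
    next
      case f: False
      then obtain k where a: "a = b + k" "k > 0" using less_imp_add_positive False by (metis linorder_neqE_nat)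
      have "nf_map [(a, b)] = nf_map [(k, 0)]"
        by (simp add: fun_eq_iff a funpow_add x_pow_cancel)
      moreover have "nf_reduced [(k, 0)]" using a by simp
      ultimately show ?thesis by metis
    qed
  qed
next
  case (Cons p L)
  show ?case
  proof (cases "a > 0 \<and> b > 0 \<and> p = (0, 0)")
    case False
    then have "nf_reduced ((a, b) # p # L)" using Cons.prems by auto
    then show ?thesis by blast
  next
    case True
    then obtain a1 b1 where ab: "a = Suc a1" "b = Suc b1" by (metis gr0_conv_Suc)
    have p: "p = (0, 0)" using True by simp
    have "nf_map ((a1, b1) # L) \<eta> = nf_map ((a, b) # p # L) \<eta>" for \<eta>
    proof -
      have "nf_map ((a, b) # p # L) \<eta> = (x_sgn Neg ^^ b1) (x_sgn Neg (localize [True] (localize [True] (nf_map L))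
          (x_sgn Pos ((x_sgn Pos ^^ a1) \<eta>))))"
        unfolding p nf_map_zero nf_map.simps(2)[of a] ab by (simp add: funpow_swap1)
      then show ?thesis by (simp only: x_conj_True nf_map.simps comp_apply)
    qed
    then have "nf_map ((a1, b1) # L) = nf_map ((a, b) # p # L)" by blast
    moreover have "nf_reduced L" using Cons.prems p by simp
    ultimately show ?thesis using Cons.IH by metis
  qed
qed

lemma nf_reduce: "\<exists>M. nf_reduced M \<and> nf_map M = nf_map L"
proof (induction L)
  case Nil
  show ?case by (rule exI[of _ "[]"]) simp
next
  case (Cons p L)
  obtain a b where p: "p = (a, b)" by (cases p)
  obtain M where M: "nf_reduced M" "nf_map M = nf_map L" using Cons by blast
  obtain M' where "nf_reduced M'" "nf_map M' = nf_map ((a, b) # M)" using nf_reduce_Cons[OF M(1)] by blast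
  then show ?case using M(2) p by auto
qed

lemma nf_map_shift: "nf_map (replicate k (0, 0) @ L) = localize (replicate k True) (nf_map L)"
proof (induction k)
  case (Suc k)
  then show ?case
    using localize_append[of "[True]" "replicate k True" "nf_map L"] nf_map_zero by simp
qed simp

lemma x_shift:
  "localize (True # s) g ((x_sgn Neg ^^ b) \<eta>) = (x_sgn Neg ^^ b) (localize (replicate b True @ True # s) g \<eta>)"
proof (induction b arbitrary: s \<eta>)
  case (Suc b)
  have shift: "localize (True # s) g (x_sgn Neg \<eta>) = x_sgn Neg (localize (True # True # s) g \<eta>)" for s \<eta>
    by (cases rule: y_rec_cases[of \<eta>]) (simp_all add: localize_Cons)
  have "localize (True # s) g ((x_sgn Neg ^^ Suc b) \<eta>) = x_sgn Neg (localize (True # True # s) g ((x_sgn Neg ^^ b) \<eta>))"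
    by (simp add: shift)
  also have "\<dots> = (x_sgn Neg ^^ Suc b) (localize (replicate b True @ True # True # s) g \<eta>)"
    unfolding Suc by simp
  also have "replicate b True @ True # True # s = replicate (Suc b) True @ True # s"
    by (simp add: replicate_app_Cons_same)
  finally show ?case .
qed simp

text \<open>The lists here need not be reduced. A letter at 1^k with k > 0 passes x^-b, which
  lengthens its index by \<open>b\<close>, and so enters the inner list. At the root it changes the
  outer exponents.\<close>

lemma nf_map_x:
  "\<exists>M. localize (replicate k True) (x_sgn e) \<circ> nf_map L = nf_map M"
proof (induction L arbitrary: k)
  case Nil
  have "nf_map [case e of Pos \<Rightarrow> (1, 0) | Neg \<Rightarrow> (0, 1)] = x_sgn e"
    by (cases e) (simp_all add: fun_eq_iff)
  then show ?case using nf_map_shift by (metis comp_id nf_map.simps(1))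
next
  case (Cons p L)
  obtain a b where p: "p = (a, b)" by (cases p)
  show ?case
  proof (cases k)
    case 0
    consider "e = Neg" | b' where "e = Pos" "b = Suc b'" | "e = Pos" "b = 0"
      by (cases e; cases b) auto
    then show ?thesis
    proof cases
      case 1
      have "localize (replicate k True) (x_sgn e) \<circ> nf_map (p # L) = nf_map ((a, Suc b) # L)"
        by (simp add: 0 1 p o_assoc)
      then show ?thesis by blast
    next
      case (2 b')
      have "localize (replicate k True) (x_sgn e) \<circ> nf_map (p # L) = nf_map ((a, b') # L)"
        by (simp add: 0 2 p fun_eq_iff x_sgn_cancel)
      then show ?thesis by blast
    next
      case 3
      \<comment> \<open>No x^-1 is left to absorb the new x, so it passes the inner word, which
        sinks one level; the inserted pair (0, 0) records this.\<close>
      have conj: "x_sgn Pos (localize [True] g \<eta>) = localize [True] (localize [True] g) (x_sgn Pos \<eta>)" for g \<eta>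
        by (metis x_conj_True x_sgn_cancel(2))
      have "localize (replicate k True) (x_sgn e) \<circ> nf_map (p # L) = nf_map ((Suc a, 0) # (0, 0) # L)"
        by (simp add: 0 3 p fun_eq_iff conj)
      then show ?thesis by blast
    qed
  next
    case (Suc j)
    obtain M where M: "localize (replicate (b + j) True) (x_sgn e) \<circ> nf_map L = nf_map M"
      using Cons.IH by blast
    have "(localize (replicate k True) (x_sgn e) \<circ> nf_map (p # L)) \<eta> = nf_map ((a, b) # M) \<eta>" for \<eta>
    proof -
      have r: "replicate b True @ True # replicate j True = [True] @ replicate (b + j) True"
        by (simp add: replicate_add replicate_app_Cons_same)
      show ?thesis
        unfolding Suc replicate_Suc p nf_map.simps comp_apply x_shift r localize_append M[symmetric] localize_comp ..
    qed
    then show ?thesis by blast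
  qed
qed

inductive_set x_group :: "(bool stream \<Rightarrow> bool stream) set" where
  x: "localize (replicate k True) (x_sgn e) \<in> x_group"
| comp: "g \<in> x_group \<Longrightarrow> h \<in> x_group \<Longrightarrow> g \<circ> h \<in> x_group"

lemma x_group_shift: "g \<in> x_group \<Longrightarrow> localize [True] g \<in> x_group"
proof (induction rule: x_group.induct)
  case (x k e)
  then show ?case using x_group.x[of "Suc k" e] localize_append[of "[True]" "replicate k True"] by simp
next
  case (comp g h)
  then show ?case unfolding localize_comp by (intro x_group.comp)
qed

lemma x_in_x_group: "x_sgn e \<in> x_group"
  using x_group.x[of 0 e] by simp

lemma x_group_conj:
  assumes "acts_on (word_map [X [] Pos]) s t" "localize t h \<in> x_group" shows "localize s h \<in> x_group"
proof -
  have "localize s h \<tau> = (x_sgn Neg \<circ> localize t h \<circ> x_sgn Pos) \<tau>" for \<tau>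
    using acts_on_localize[OF assms(1), of h \<tau>] by (metis comp_apply localize_Nil x_sgn_cancel(1))
  then have "localize s h = x_sgn Neg \<circ> localize t h \<circ> x_sgn Pos" by blast
  then show ?thesis by (simp add: x_group.comp x_in_x_group assms(2) del: comp_apply)
qed

text \<open>Conjugation by x replaces 00u by the shorter 0u, and 01u by 10u, whose tail 0u is
  shorter. Leading ones are stripped by \<open>x_group_shift\<close>. Only the index 0 resists and
  needs a relation of its own.\<close>

lemma localize_in_x_group: "localize s (x_sgn e) \<in> x_group"
proof (induction "length s" arbitrary: s rule: less_induct)
  case less
  have acts: "acts_on (word_map [X [] Pos]) (False # False # u) (False # u)"
    "acts_on (word_map [X [] Pos]) (False # True # u) (True # False # u)" for u
    by (simp_all add: acts_on_def)
  have shift: "localize (True # u) (x_sgn e) \<in> x_group" if "localize u (x_sgn e) \<in> x_group" for u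
    using x_group_shift[OF that] localize_append[of "[True]" u] by simp
  consider "s = []" | u where "s = True # u" | "s = [False]" | u where "s = False # False # u"
    | u where "s = False # True # u"
    by (metis (full_types) list.exhaust)
  then show ?case
  proof cases
    case 1
    then show ?thesis by (simp add: x_in_x_group)
  next
    case (2 u)
    then show ?thesis using shift less by simp
  next
    case 3
    \<comment> \<open>the pentagon relation \<open>x\<^sup>2 = x\<^sub>0 x x\<^sub>1\<close>, solved for \<open>x\<^sub>0\<close>\<close>
    have Pos: "localize [False] (x_sgn Pos) \<eta> = (x_sgn Neg \<circ> localize [True] (x_sgn Neg) \<circ> x_sgn Pos \<circ> x_sgn Pos) \<eta>" for \<eta>
    proof (cases rule: y_rec_cases[of \<eta>])
      case (1 \<zeta>)
      then show ?thesis by (cases \<zeta>; cases "shd \<zeta>") (auto simp: localize_Cons)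
    qed (simp_all add: localize_Cons)
    have Neg: "localize [False] (x_sgn Neg) \<eta> = (x_sgn Neg \<circ> x_sgn Neg \<circ> localize [True] (x_sgn Pos) \<circ> x_sgn Pos) \<eta>" for \<eta>
    proof (cases rule: y_rec_cases[of \<eta>])
      case (2 \<zeta>)
      then show ?thesis by (cases \<zeta>; cases "shd \<zeta>") (auto simp: localize_Cons)
    qed (simp_all add: localize_Cons)
    have "localize [True] (x_sgn e') \<in> x_group" for e' using x_group_shift[OF x_in_x_group] .
    moreover have "localize [False] (x_sgn Pos) = x_sgn Neg \<circ> localize [True] (x_sgn Neg) \<circ> x_sgn Pos \<circ> x_sgn Pos"
      "localize [False] (x_sgn Neg) = x_sgn Neg \<circ> x_sgn Neg \<circ> localize [True] (x_sgn Pos) \<circ> x_sgn Pos"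
      by (rule ext, rule Pos) (rule ext, rule Neg)
    ultimately show ?thesis
      unfolding 3 by (cases e) (simp_all only:, (intro x_group.comp x_in_x_group; simp only:)+)
  next
    case (4 u)
    then show ?thesis using x_group_conj[OF acts(1)[of u]] less by simp
  next
    case (5 u)
    then show ?thesis using x_group_conj[OF acts(2)[of u]] shift[of "False # u"] less by simp
  qed
qed

lemma X_word_x_group: "X_word w \<Longrightarrow> word_map w \<in> x_group"
proof (induction w)
  case Nil
  have "x_sgn Neg \<circ> x_sgn Pos = id" by (simp add: fun_eq_iff x_sgn_cancel)
  then show ?case using x_group.comp[OF x_in_x_group[of Neg] x_in_x_group[of Pos]] by (simp only: word_map_Nil)
next
  case (Cons l w)
  then obtain s e where "l = X s e" by (auto simp: X_word_def)
  then show ?case using Cons unfolding word_map_Cons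
    by (intro x_group.comp) (auto simp: letter_map_X localize_in_x_group)
qed

lemma x_group_nf_map: "g \<in> x_group \<Longrightarrow> \<exists>M. g \<circ> nf_map L = nf_map M"
proof (induction arbitrary: L rule: x_group.induct)
  case (x k e)
  show ?case by (rule nf_map_x)
next
  case (comp g h)
  obtain M where M: "h \<circ> nf_map L = nf_map M" using comp.IH(2) by blast
  obtain N where "g \<circ> nf_map M = nf_map N" using comp.IH(1) by blast
  then show ?case using M by (metis comp_assoc)
qed

theorem F_normal_form_exists:
  assumes "X_word f" shows "\<exists>w. F_normal_form w \<and> X_word w \<and> word_map w = word_map f"
proof -
  obtain M where M: "word_map f = nf_map M"
    using x_group_nf_map[OF X_word_x_group[OF assms], of "[]"] by auto
  obtain L where "nf_reduced L" "nf_map L = nf_map M" using nf_reduce by blast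
  then show ?thesis using M F_normal_form_iff X_word_nf_word word_map_nf_word[of 0 L] by auto
qed

theorem F_normal_form_unique:
  assumes "F_normal_form v" "F_normal_form w" "word_map v = word_map w" shows "v = w"
proof -
  obtain L M where "nf_reduced L" "v = nf_word 0 L" "nf_reduced M" "w = nf_word 0 M"
    using assms F_normal_form_iff by blast
  then show ?thesis using nf_map_unique[of L M] assms(3) word_map_nf_word[of 0] by simp
qed

section \<open>Standard forms and trees\<close>

lemma index_less_asym: "index_less s t \<Longrightarrow> \<not> index_less t s"
proof
  assume st: "index_less s t" and ts: "index_less t s"
  show False
  proof (cases "s \<parallel> t")
    case True
    then have "\<not> strict_prefix s t" "\<not> strict_prefix t s" by (auto simp: parallel_def strict_prefix_def)
    then obtain i j where ij: "take i s = take i t" "s ! i < t ! i" "take j t = take j s" "t ! j < s ! j"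
      using st ts by (auto simp: index_less_def)
    have "i = j"
    proof (rule ccontr)
      assume "i \<noteq> j"
      then consider "i < j" | "j < i" by linarith
      then show False
      proof cases
        case 1
        then have "t ! i = s ! i" using ij(3) by (metis nth_take)
        then show False using ij(2) by simp
      next
        case 2
        then have "s ! j = t ! j" using ij(1) by (metis nth_take)
        then show False using ij(4) by simp
      qed
    qed
    then show False using ij by auto
  next
    case False
    then have "strict_prefix t s" "strict_prefix s t" using st ts by (auto simp: index_less_def)
    then show False by (meson prefix_order.less_asym)
  qed
qed

lemma index_less_child: "index_less (s @ b # u) s"
  by (auto simp: index_less_def strict_prefix_def)

lemma index_less_sibling: "index_less (s @ False # u) (s @ True # v)"
proof -
  have "take (length s) (s @ False # u) = take (length s) (s @ True # v)" by simp
  moreover have "(s @ False # u) ! length s < (s @ True # v) ! length s" by simp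
  moreover have "length s < min (length (s @ False # u)) (length (s @ True # v))" by simp
  ultimately show ?thesis unfolding index_less_def using parallel_children(1) by blast
qed

text \<open>Different heads would each have to precede the other. Thus the list of powers of a
  standard form is determined by its set, i.e. by the labels.\<close>

lemma sorted_wrt_unique:
  assumes asym: "\<And>x y. P x y \<Longrightarrow> \<not> P y x"
  shows "sorted_wrt P xs \<Longrightarrow> sorted_wrt P ys \<Longrightarrow> set xs = set ys \<Longrightarrow> xs = ys"
proof (induction xs arbitrary: ys)
  case (Cons x xs)
  then obtain y zs where ys: "ys = y # zs" by (cases ys) auto
  have irr: "\<not> P z z" for z using asym by blast
  have "x = y"
  proof (rule ccontr)
    assume "x \<noteq> y"
    then have "y \<in> set xs" "x \<in> set zs" using Cons.prems(3) ys by auto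
    then have "P x y" "P y x" using Cons.prems ys by auto
    then show False using asym by blast
  qed
  moreover have "x \<notin> set xs" "y \<notin> set zs" using Cons.prems ys irr by auto
  moreover from calculation have "set xs = set zs"
    using Cons.prems(3) ys by (metis insert_ident list.simps(15))
  ultimately show ?case using Cons.IH[of zs] Cons.prems ys by auto
qed simp

lemma powers_at_iff: "(v, t) \<in> set (powers_at s c) \<longleftrightarrow> (\<exists>u. v = s @ u \<and> t = label c u \<and> t \<noteq> 0)"
proof (induction c arbitrary: s)
  case (Br k l r)
  have *: "(\<exists>u. P u) \<longleftrightarrow> P [] \<or> (\<exists>u. P (False # u)) \<or> (\<exists>u. P (True # u))" for P :: "bool list \<Rightarrow> bool"
    by (metis (full_types) neq_Nil_conv)
  show ?case by (subst *) (auto simp: Br)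
qed simp

lemma powers_at_sorted: "sorted_wrt (\<lambda>p q. index_less (fst p) (fst q)) (powers_at s c)"
proof (induction c arbitrary: s)
  case (Br k l r)
  then show ?case
    by (auto simp: sorted_wrt_append powers_at_iff index_less_child index_less_sibling)
qed simp

lemma S_word_Y_word_of: "S_word (Y_word_of ps) \<longleftrightarrow> (\<forall>(s, t) \<in> set ps. t = 0 \<or> y_index s)"
  by (induction ps) (auto simp: Y_word_of_def S_word_y_pow)

lemma standard_form_powers_at:
  assumes "X_word f" "S_word (tree_word [] c)" shows "standard_form f (powers_at [] c)"
proof -
  have "\<forall>i < length ps. \<forall>j < length ps. i < j \<longrightarrow> index_less (fst (ps ! i)) (fst (ps ! j))"
    if "ps = powers_at [] c" for ps
    using powers_at_sorted[of "[]" c] that by (simp add: sorted_wrt_iff_nth_less)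
  moreover have "Y_powers (powers_at [] c)"
    using assms(2) unfolding tree_word_def S_word_Y_word_of Y_powers_def by (auto simp: powers_at_iff)
  ultimately show ?thesis using assms(1) by (simp add: standard_form_def)
qed

primrec tree_of :: "nat \<Rightarrow> (bool list \<Rightarrow> int) \<Rightarrow> ltree" where
  "tree_of 0 lb = Tip"
| "tree_of (Suc n) lb = Br (lb []) (tree_of n (\<lambda>u. lb (False # u))) (tree_of n (\<lambda>u. lb (True # u)))"

lemma label_tree_of: "label (tree_of n lb) u = (if length u < n then lb u else 0)"
proof (induction n arbitrary: lb u)
  case (Suc n)
  then show ?case by (cases u) auto
qed simp

lemma standard_form_tree:
  assumes "standard_form f ps" obtains c where "powers_at [] c = ps"
proof -
  have sorted: "sorted_wrt (\<lambda>p q. index_less (fst p) (fst q)) ps"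
    using assms by (auto simp: standard_form_def sorted_wrt_iff_nth_less)
  then have dist: "distinct (map fst ps)"
    using index_less_asym by (induction ps) force+
  have nz: "t \<noteq> 0" if "(s, t) \<in> set ps" for s t
    using assms that by (auto simp: standard_form_def Y_powers_def)
  define lb where "lb u = (case map_of ps u of None \<Rightarrow> 0 | Some t \<Rightarrow> t)" for u
  \<comment> \<open>One more than the sum of all index lengths bounds every index strictly, so the
    truncation in \<open>tree_of\<close> loses nothing.\<close>
  define n where "n = Suc (sum_list (map (length \<circ> fst) ps))"
  have n: "length s < n" if "(s, t) \<in> set ps" for s t
    using member_le_sum_list[of "length s" "map (length \<circ> fst) ps"] that
    unfolding n_def by (force simp: image_iff)
  have lb: "(s, t) \<in> set ps \<longleftrightarrow> lb s = t \<and> t \<noteq> 0" for s t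
    using map_of_eq_Some_iff[OF dist, of s t] nz[of s t] by (cases "map_of ps s") (auto simp: lb_def)
  have "set (powers_at [] (tree_of n lb)) = set ps"
  proof (rule Set.set_eqI)
    fix p :: "bool list \<times> int"
    obtain s t where p: "p = (s, t)" by (cases p)
    show "p \<in> set (powers_at [] (tree_of n lb)) \<longleftrightarrow> p \<in> set ps"
      using n[of s t] lb[of s t] by (auto simp: p powers_at_iff label_tree_of)
  qed
  then have "powers_at [] (tree_of n lb) = ps"
    using sorted_wrt_unique[OF _ powers_at_sorted sorted] index_less_asym by blast
  then show ?thesis using that by blast
qed

section \<open>Potential contractions of trees\<close>

lemma Y_in_tree_word:
  "Y v e \<in> set (tree_word s c) \<longleftrightarrow> (\<exists>u. v = s @ u \<and> label c u \<noteq> 0 \<and> e = sign_of (label c u))"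
proof -
  have "Y v e \<in> set (tree_word s c) \<longleftrightarrow> (\<exists>t. (v, t) \<in> set (powers_at s c) \<and> t \<noteq> 0 \<and> e = sign_of t)"
    by (force simp: tree_word_def Y_word_of_def y_pow_def)
  then show ?thesis by (auto simp: powers_at_iff)
qed

lemma sign_of_pos: "t \<noteq> 0 \<Longrightarrow> Pos = sign_of t \<longleftrightarrow> t > 0" "t \<noteq> 0 \<Longrightarrow> Neg = sign_of t \<longleftrightarrow> t < 0"
  by (auto simp: sign_of_def)

lemma Y_in_tree_word_signs:
  "Y v Pos \<in> set (tree_word [] c) \<longleftrightarrow> label c v > 0"
  "Y v Neg \<in> set (tree_word [] c) \<longleftrightarrow> label c v < 0"
  "(\<forall>e. Y v e \<notin> set (tree_word [] c)) \<longleftrightarrow> label c v = 0"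
  unfolding Y_in_tree_word using sign_of_pos[of "label c v"] by auto

lemma subseq_set: "subseq xs ys \<Longrightarrow> set xs \<subseteq> set ys"
proof
  fix x assume "subseq xs ys" "x \<in> set xs"
  then obtain y where "y \<in> set ys" "x = y" by (rule list_emb_set)
  then show "x \<in> set ys" by simp
qed

lemma subseq3:
  assumes "a \<in> set u" "b \<in> set v" "c \<in> set w" shows "subseq [a, b, c] (u @ v @ w)"
proof -
  have "subseq ([a] @ [b] @ [c]) (u @ v @ w)"
    using assms by (intro list_emb_append_mono) (simp_all add: subseq_singleton_left)
  then show ?thesis by simp
qed

text \<open>The three letters lie in the subtrees at 0, 10 and 11, which the traversal visits in
  this order.\<close>

lemma subseq_tree_word_pos:
  assumes "label c (u @ [False]) > 0" "label c (u @ [True, False]) < 0" "label c (u @ [True, True]) > 0"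
  shows "subseq [Y (s @ u @ [False]) Pos, Y (s @ u @ [True, False]) Neg, Y (s @ u @ [True, True]) Pos] (tree_word s c)"
  using assms
proof (induction u arbitrary: s c)
  case Nil
  then obtain t l r where c: "c = Br t l r" by (cases c) auto
  obtain k m n where r: "r = Br k m n" using Nil by (cases r) (auto simp: c)
  have "subseq [Y (s @ [False]) Pos, Y (s @ [True, False]) Neg, Y (s @ [True, True]) Pos]
      (tree_word (s @ [False]) l @ tree_word (s @ [True, False]) m @ tree_word (s @ [True, True]) n)"
    using Nil by (intro subseq3) (auto simp: Y_in_tree_word c r sign_of_def)
  then have "subseq [Y (s @ [False]) Pos, Y (s @ [True, False]) Neg, Y (s @ [True, True]) Pos]
      ((tree_word (s @ [False]) l @ tree_word (s @ [True, False]) m @ tree_word (s @ [True, True]) n) @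
        y_pow (s @ [True]) k @ y_pow s t)" by (rule list_emb_prefix)
  then show ?case by (simp add: c r)
next
  case (Cons b u)
  then obtain t l r where c: "c = Br t l r" by (cases c) auto
  show ?case
  proof (cases b)
    case True
    then have "subseq [Y (s @ (b # u) @ [False]) Pos, Y (s @ (b # u) @ [True, False]) Neg, Y (s @ (b # u) @ [True, True]) Pos]
        (tree_word (s @ [True]) r)"
      using Cons.IH[of r "s @ [True]"] Cons.prems by (simp add: c)
    then show ?thesis unfolding c tree_word_Br by (intro list_emb_append2 list_emb_prefix)
  next
    case False
    then have "subseq [Y (s @ (b # u) @ [False]) Pos, Y (s @ (b # u) @ [True, False]) Neg, Y (s @ (b # u) @ [True, True]) Pos]
        (tree_word (s @ [False]) l)"
      using Cons.IH[of l "s @ [False]"] Cons.prems by (simp add: c)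
    then show ?thesis unfolding c tree_word_Br by (rule list_emb_prefix)
  qed
qed

lemma subseq_tree_word_neg:
  assumes "label c (u @ [False, False]) < 0" "label c (u @ [False, True]) > 0" "label c (u @ [True]) < 0"
  shows "subseq [Y (s @ u @ [False, False]) Neg, Y (s @ u @ [False, True]) Pos, Y (s @ u @ [True]) Neg] (tree_word s c)"
  using assms
proof (induction u arbitrary: s c)
  case Nil
  then obtain t l r where c: "c = Br t l r" by (cases c) auto
  obtain k m n where l: "l = Br k m n" using Nil by (cases l) (auto simp: c)
  have "subseq [Y (s @ [False, False]) Neg, Y (s @ [False, True]) Pos, Y (s @ [True]) Neg]
      (tree_word (s @ [False, False]) m @ (tree_word (s @ [False, True]) n @ y_pow (s @ [False]) k) @ tree_word (s @ [True]) r)"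
    using Nil by (intro subseq3) (auto simp: Y_in_tree_word c l sign_of_def)
  then have "subseq [Y (s @ [False, False]) Neg, Y (s @ [False, True]) Pos, Y (s @ [True]) Neg]
      ((tree_word (s @ [False, False]) m @ (tree_word (s @ [False, True]) n @ y_pow (s @ [False]) k) @ tree_word (s @ [True]) r) @
        y_pow s t)" by (rule list_emb_prefix)
  then show ?case by (simp add: c l)
next
  case (Cons b u)
  then obtain t l r where c: "c = Br t l r" by (cases c) auto
  show ?case
  proof (cases b)
    case True
    then have "subseq [Y (s @ (b # u) @ [False, False]) Neg, Y (s @ (b # u) @ [False, True]) Pos, Y (s @ (b # u) @ [True]) Neg]
        (tree_word (s @ [True]) r)"
      using Cons.IH[of r "s @ [True]"] Cons.prems by (simp add: c)
    then show ?thesis unfolding c tree_word_Br by (intro list_emb_append2 list_emb_prefix)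
  next
    case False
    then have "subseq [Y (s @ (b # u) @ [False, False]) Neg, Y (s @ (b # u) @ [False, True]) Pos, Y (s @ (b # u) @ [True]) Neg]
        (tree_word (s @ [False]) l)"
      using Cons.IH[of l "s @ [False]"] Cons.prems by (simp add: c)
    then show ?thesis unfolding c tree_word_Br by (rule list_emb_prefix)
  qed
qed

theorem potential_contraction_iff: "potential_contraction (powers_at [] c) \<longleftrightarrow> \<not> contracted c"
proof
  assume "potential_contraction (powers_at [] c)"
  then obtain s where
    "(subseq [Y (s @ [False]) Pos, Y (s @ [True, False]) Neg, Y (s @ [True, True]) Pos] (tree_word [] c) \<and>
       (\<forall>e. Y (s @ [True]) e \<notin> set (tree_word [] c))) \<or>
      (subseq [Y (s @ [False, False]) Neg, Y (s @ [False, True]) Pos, Y (s @ [True]) Neg] (tree_word [] c) \<and>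
       (\<forall>e. Y (s @ [False]) e \<notin> set (tree_word [] c)))"
    unfolding potential_contraction_def tree_word_def by blast
  then have "contractible (label c) s"
  proof
    assume "subseq [Y (s @ [False]) Pos, Y (s @ [True, False]) Neg, Y (s @ [True, True]) Pos] (tree_word [] c) \<and>
       (\<forall>e. Y (s @ [True]) e \<notin> set (tree_word [] c))"
    then have "set [Y (s @ [False]) Pos, Y (s @ [True, False]) Neg, Y (s @ [True, True]) Pos] \<subseteq> set (tree_word [] c)"
      "label c (s @ [True]) = 0" unfolding Y_in_tree_word_signs using subseq_set by blast+
    then show ?thesis by (simp add: Y_in_tree_word_signs contractible_def)
  next
    assume "subseq [Y (s @ [False, False]) Neg, Y (s @ [False, True]) Pos, Y (s @ [True]) Neg] (tree_word [] c) \<and>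
       (\<forall>e. Y (s @ [False]) e \<notin> set (tree_word [] c))"
    then have "set [Y (s @ [False, False]) Neg, Y (s @ [False, True]) Pos, Y (s @ [True]) Neg] \<subseteq> set (tree_word [] c)"
      "label c (s @ [False]) = 0" unfolding Y_in_tree_word_signs using subseq_set by blast+
    then show ?thesis by (simp add: Y_in_tree_word_signs contractible_def)
  qed
  then show "\<not> contracted c" by (auto simp: contracted_def)
next
  assume "\<not> contracted c"
  then obtain s where "contractible (label c) s" by (auto simp: contracted_def)
  then show "potential_contraction (powers_at [] c)"
    unfolding potential_contraction_def tree_word_def[symmetric] Y_in_tree_word_signs contractible_def
    using subseq_tree_word_pos[of c s "[]"] subseq_tree_word_neg[of c s "[]"] by auto
qed

section \<open>Potential cancellations of trees\<close>

definition first_nonzero :: "(bool list \<Rightarrow> int) \<Rightarrow> bool list \<Rightarrow> bool" where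
  "first_nonzero lb \<sigma> \<longleftrightarrow> lb \<sigma> \<noteq> 0 \<and> (\<forall>\<rho>. strict_prefix \<rho> \<sigma> \<longrightarrow> lb \<rho> = 0)"

abbreviation path_edge :: "bool list \<Rightarrow> sign \<Rightarrow> edge" where
  "path_edge \<sigma> e \<equiv> foldr digit_edge \<sigma> (sign_edge e)"

text \<open>A nonrecursive form of the failure of \<open>reduced\<close>: a letter at
  \<open>s\<close>, then digits up to the next letter of the calculation, whose edge seen from
  \<open>s\<close> is the forbidden one. It matches the substrings in the definition of a
  cancellation.\<close>

definition backtracking :: "(bool list \<Rightarrow> int) \<Rightarrow> bool list \<Rightarrow> bool" where
  "backtracking lb s \<longleftrightarrow> lb s \<noteq> 0 \<and> (\<exists>b \<sigma>. first_nonzero (\<lambda>u. lb (s @ b # u)) \<sigma> \<and>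
     path_edge (b # \<sigma>) (sign_of (lb (s @ b # \<sigma>))) = sign_edge (opposite (sign_of (lb s))))"

lemma first_nonzero_Nil: "first_nonzero lb [] \<longleftrightarrow> lb [] \<noteq> 0"
  by (simp add: first_nonzero_def)

lemma first_nonzero_Cons: "first_nonzero lb (b # \<sigma>) \<longleftrightarrow> lb [] = 0 \<and> first_nonzero (\<lambda>u. lb (b # u)) \<sigma>"
proof -
  have "(\<forall>\<rho>. strict_prefix \<rho> (b # \<sigma>) \<longrightarrow> lb \<rho> = 0) \<longleftrightarrow> lb [] = 0 \<and> (\<forall>\<rho>. strict_prefix \<rho> \<sigma> \<longrightarrow> lb (b # \<rho>) = 0)"
    (is "?L \<longleftrightarrow> ?R")
  proof (intro iffI conjI allI impI)
    assume ?L
    show "lb [] = 0" by (rule \<open>?L\<close>[rule_format]) simp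
    show "lb (b # \<rho>) = 0" if "strict_prefix \<rho> \<sigma>" for \<rho> by (rule \<open>?L\<close>[rule_format]) (simp add: that)
  next
    fix \<rho> assume ?R "strict_prefix \<rho> (b # \<sigma>)"
    then show "lb \<rho> = 0" by (cases \<rho>) auto
  qed
  then show ?thesis by (auto simp: first_nonzero_def)
qed

lemma edges_first_nonzero:
  "\<kappa> \<noteq> Base \<Longrightarrow> \<kappa> \<in> edges c \<longleftrightarrow> (\<exists>\<sigma>. first_nonzero (label c) \<sigma> \<and> path_edge \<sigma> (sign_of (label c \<sigma>)) = \<kappa>)"
proof (induction c arbitrary: \<kappa>)
  case Tip
  then show ?case by (simp add: first_nonzero_def)
next
  case (Br t l r)
  have ex: "(\<exists>u. P u) \<longleftrightarrow> P [] \<or> (\<exists>u. P (False # u)) \<or> (\<exists>u. P (True # u))" for P :: "bool list \<Rightarrow> bool"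
    by (metis (full_types) neq_Nil_conv)
  have "digit_edge b \<kappa> \<noteq> Base" for b using Br.prems by (cases \<kappa>; cases b) auto
  then have IH: "digit_edge False \<kappa> \<in> edges l \<longleftrightarrow> (\<exists>\<sigma>. first_nonzero (label l) \<sigma> \<and> path_edge \<sigma> (sign_of (label l \<sigma>)) = digit_edge False \<kappa>)"
    "digit_edge True \<kappa> \<in> edges r \<longleftrightarrow> (\<exists>\<sigma>. first_nonzero (label r) \<sigma> \<and> path_edge \<sigma> (sign_of (label r \<sigma>)) = digit_edge True \<kappa>)"
    using Br.IH by blast+
  have flip: "digit_edge b x = \<kappa> \<longleftrightarrow> x = digit_edge b \<kappa>" for b x by auto
  show ?case
    by (subst ex) (simp add: first_nonzero_Nil first_nonzero_Cons IH flip, blast)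
qed

lemma reduced_iff: "reduced c \<longleftrightarrow> (\<forall>s. \<not> backtracking (label c) s)"
proof (induction c)
  case Tip
  then show ?case by (simp add: backtracking_def)
next
  case (Br t l r)
  have all: "(\<forall>u. P u) \<longleftrightarrow> P [] \<and> (\<forall>u. P (False # u)) \<and> (\<forall>u. P (True # u))" for P :: "bool list \<Rightarrow> bool"
    by (metis (full_types) neq_Nil_conv)
  have children: "backtracking (label (Br t l r)) (False # s) = backtracking (label l) s"
    "backtracking (label (Br t l r)) (True # s) = backtracking (label r) s" for s
    by (simp_all add: backtracking_def)
  let ?e = "sign_edge (opposite (sign_of t))"
  have flip: "digit_edge b x = y \<longleftrightarrow> x = digit_edge b y" for b x y by auto
  have ne: "digit_edge b ?e \<noteq> Base" for b by (cases b; cases "sign_of t") auto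
  have "backtracking (label (Br t l r)) [] \<longleftrightarrow> t \<noteq> 0 \<and> (digit_edge False ?e \<in> edges l \<or> digit_edge True ?e \<in> edges r)"
    unfolding edges_first_nonzero[OF ne] backtracking_def
    by (simp add: ex_bool_eq flip) blast
  then show ?case by (subst all) (simp add: children Br, blast)
qed

section \<open>Substitutions as matrix identities\<close>

fun symbol_mult :: "symbol \<Rightarrow> mat2 \<Rightarrow> mat2" where
  "symbol_mult (Bit b) = digit_mult b"
| "symbol_mult (Ys e) = y_mult e"

definition symbol_mat :: "symbol list \<Rightarrow> mat2" where
  "symbol_mat w = foldr symbol_mult w (1, 0, 0, 1)"

fun all_even :: "mat2 \<Rightarrow> bool" where
  "all_even (a, b, c, d) \<longleftrightarrow> even a \<and> even b \<and> even c \<and> even d"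

lemma y_mult_digit_mult:
  "y_mult Pos (digit_mult False (digit_mult False M)) = digit_mult False (y_mult Pos M)"
  "y_mult Pos (digit_mult False (digit_mult True M)) = digit_mult True (digit_mult False (y_mult Neg M))"
  "y_mult Pos (digit_mult True M) = digit_mult True (digit_mult True (y_mult Pos M))"
  "y_mult Neg (digit_mult False M) = digit_mult False (digit_mult False (y_mult Neg M))"
  "y_mult Neg (digit_mult True (digit_mult False M)) = digit_mult False (digit_mult True (y_mult Pos M))"
  "y_mult Neg (digit_mult True (digit_mult True M)) = digit_mult True (y_mult Neg M)"
  by (cases M; simp)+

lemma substitution_symbol_mat: "substitution v w \<Longrightarrow> symbol_mat v = symbol_mat w"
  by (induction rule: substitution.induct) (simp_all only: symbol_mat_def foldr_append foldr.simps comp_apply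
      symbol_mult.simps y_mult_digit_mult id_apply)

lemma all_even_mult: "all_even M \<Longrightarrow> all_even (digit_mult b M)" "all_even M \<Longrightarrow> all_even (y_mult e M)"
  by (cases M; cases b; simp) (cases M; cases e; simp)

lemma all_even_symbol_mult: "all_even M \<Longrightarrow> all_even (foldr symbol_mult w M)"
proof (induction w)
  case (Cons x w)
  then show ?case by (cases x) (simp_all add: all_even_mult)
qed simp

lemma edge_of_symbol_mat: "edge_of_mat (symbol_mat (map Bit \<sigma> @ [Ys e])) (path_edge \<sigma> e)"
proof (induction \<sigma>)
  case Nil
  show ?case by (cases e) (simp_all add: symbol_mat_def)
next
  case (Cons b \<sigma>)
  then show ?case using edge_of_digit_mult by (simp add: symbol_mat_def)
qed

text \<open>Substitutions preserve the matrix of a string, and y y^-1 or y^-1 y forces all its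
  entries to be even. Unless the second letter has the forbidden edge, the matrix is nonzero modulo
  2.\<close>

lemma cancelling_only_if:
  assumes "cancelling ([Ys e] @ map Bit \<sigma> @ [Ys e'])"
  shows "path_edge \<sigma> e' = sign_edge (opposite e)"
proof (rule ccontr)
  let ?a = "[Ys e] @ map Bit \<sigma> @ [Ys e']"
  obtain b where b: "substitution\<^sup>*\<^sup>* ?a b" "sublist [Ys Pos, Ys Neg] b \<or> sublist [Ys Neg, Ys Pos] b"
    using assms unfolding cancelling_def by blast
  have "symbol_mat ?a = symbol_mat b"
    using b(1) by (induction rule: rtranclp_induct) (auto dest: substitution_symbol_mat)
  moreover have "all_even (symbol_mat b)"
  proof -
    obtain p q d where "b = p @ [Ys d, Ys (opposite d)] @ q"
      using b(2) by (auto simp: sublist_def) (metis opposite.simps)+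
    moreover have "all_even (symbol_mult (Ys d) (symbol_mult (Ys (opposite d)) M))" for M
      by (cases d; cases M) simp_all
    ultimately show ?thesis by (simp add: symbol_mat_def all_even_symbol_mult)
  qed
  moreover assume "path_edge \<sigma> e' \<noteq> sign_edge (opposite e)"
  then have "edge_of_mat (y_mult e (symbol_mat (map Bit \<sigma> @ [Ys e']))) (sign_edge e)"
    by (intro edge_of_y_mult[OF edge_of_symbol_mat])
  then have "edge_of_mat (symbol_mat ?a) (sign_edge e)" by (simp add: symbol_mat_def)
  ultimately show False by (cases "symbol_mat b"; cases e) auto
qed

text \<open>The left letter is pushed through the digits. Each substitution consumes digits and
  keeps the condition on edges for the new sign; when no digits remain, the condition says that the
  letters are opposite. The prefix \<open>w\<close> collects the emitted digits.\<close>

lemma substitutions_cancel: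
  assumes "path_edge \<sigma> e' = sign_edge (opposite e)"
  shows "\<exists>b. substitution\<^sup>*\<^sup>* (w @ [Ys e] @ map Bit \<sigma> @ [Ys e']) b \<and>
    (sublist [Ys Pos, Ys Neg] b \<or> sublist [Ys Neg, Ys Pos] b)"
  using assms
proof (induction "length \<sigma>" arbitrary: \<sigma> e w rule: less_induct)
  case less
  have step: ?case
    if "substitution (w @ [Ys e] @ map Bit \<sigma> @ [Ys e']) (w @ map Bit \<pi> @ [Ys d] @ map Bit \<rho> @ [Ys e'])"
      "length \<rho> < length \<sigma>" "path_edge \<rho> e' = sign_edge (opposite d)" for \<pi> \<rho> d
    using less.hyps[of \<rho> d "w @ map Bit \<pi>"] that by (auto intro: converse_rtranclp_into_rtranclp)
  note sub = substitution.intros[of w]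
  have flip: "digit_edge b x = y \<longleftrightarrow> x = digit_edge b y" for b x y by auto
  show ?case
  proof (cases \<sigma>)
    case Nil
    then have "e' = opposite e" using less.prems by simp
    then have "sublist [Ys Pos, Ys Neg] (w @ [Ys e] @ map Bit \<sigma> @ [Ys e']) \<or>
        sublist [Ys Neg, Ys Pos] (w @ [Ys e] @ map Bit \<sigma> @ [Ys e'])"
      using Nil by (cases e) (simp_all add: sublist_append_leftI)
    then show ?thesis by blast
  next
    case (Cons b \<rho>)
    then have \<rho>: "path_edge \<rho> e' = digit_edge b (sign_edge (opposite e))"
      using less.prems by (simp add: flip)
    show ?thesis
    proof (cases "(e = Pos \<and> b) \<or> (e = Neg \<and> \<not> b)")
      case True
      then consider "e = Pos" b | "e = Neg" "\<not> b" by blast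
      then show ?thesis
      proof cases
        case 1
        then show ?thesis using \<rho> sub(3)[of "map Bit \<rho> @ [Ys e']"] Cons
          by (intro step[of "[True, True]" Pos \<rho>]) simp_all
      next
        case 2
        then show ?thesis using \<rho> sub(4)[of "map Bit \<rho> @ [Ys e']"] Cons
          by (intro step[of "[False, False]" Neg \<rho>]) simp_all
      qed
    next
      case False
      \<comment> \<open>The first digit alone triggers no rule here. But \<open>Third\<close> is not
        the edge of a single letter, so a second digit follows and a rule applies.\<close>
      then have third: "path_edge \<rho> e' = Third" using \<rho> by (cases e) auto
      then obtain b' \<pi> where \<pi>: "\<rho> = b' # \<pi>" by (cases \<rho>; cases e') auto
      then have p: "path_edge \<pi> e' = digit_edge b' Third" using third by (simp add: flip)
      consider "e = Pos" "\<not> b" "\<not> b'" | "e = Pos" "\<not> b" b' | "e = Neg" b "\<not> b'" | "e = Neg" b b'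
        using False by (cases e) auto
      then show ?thesis
      proof cases
        case 1
        then show ?thesis using p sub(1)[of "map Bit \<pi> @ [Ys e']"] Cons \<pi>
          by (intro step[of "[False]" Pos \<pi>]) simp_all
      next
        case 2
        then show ?thesis using p sub(2)[of "map Bit \<pi> @ [Ys e']"] Cons \<pi>
          by (intro step[of "[True, False]" Neg \<pi>]) simp_all
      next
        case 3
        then show ?thesis using p sub(5)[of "map Bit \<pi> @ [Ys e']"] Cons \<pi>
          by (intro step[of "[False, True]" Pos \<pi>]) simp_all
      next
        case 4
        then show ?thesis using p sub(6)[of "map Bit \<pi> @ [Ys e']"] Cons \<pi>
          by (intro step[of "[True]" Neg \<pi>]) simp_all
      qed
    qed
  qed
qed

lemma cancelling_iff:
  "cancelling ([Ys e] @ map Bit \<sigma> @ [Ys e']) \<longleftrightarrow> path_edge \<sigma> e' = sign_edge (opposite e)"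
  using cancelling_only_if substitutions_cancel[of \<sigma> e' e "[]"] unfolding cancelling_def by auto

section \<open>Calculations restarted at a prefix, and their substrings\<close>

definition calculation_from :: "powers \<Rightarrow> bool list \<Rightarrow> bool stream \<Rightarrow> symbol stream" where
  "calculation_from ps p \<tau> = flat (smap (\<lambda>k. inserted ps (p @ stake k \<tau>) @ [Bit (\<tau> !! k)]) nats)"

lemma calculation_from_Stream:
  "calculation_from ps p (b ## \<tau>) = inserted ps p @- Bit b ## calculation_from ps (p @ [b]) \<tau>"
proof -
  have nats: "nats = 0 ## smap Suc nats"
    by (subst siterate.code) (simp add: smap_siterate)
  show ?thesis unfolding calculation_from_def
    by (subst nats) (simp add: stream.map_comp comp_def)
qed

lemma calculation_eq: "calculation ps \<tau> = calculation_from ps [] \<tau>"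
  by (simp add: calculation_def calculation_from_def)

lemma calculation_from_shift: "\<exists>A. calculation_from ps p (s @- \<tau>) = A @- calculation_from ps (p @ s) \<tau>"
proof (induction s arbitrary: p)
  case Nil
  show ?case by (rule exI[of _ "[]"]) simp
next
  case (Cons b s)
  obtain A where "calculation_from ps (p @ [b]) (s @- \<tau>) = A @- calculation_from ps ((p @ [b]) @ s) \<tau>"
    using Cons by blast
  then show ?case
    by (intro exI[of _ "inserted ps p @ Bit b # A"]) (simp add: calculation_from_Stream)
qed

lemma calculation_from_zero:
  assumes "\<And>\<rho>. strict_prefix \<rho> \<sigma> \<Longrightarrow> inserted ps (p @ \<rho>) = []"
  shows "calculation_from ps p (\<sigma> @- \<tau>) = map Bit \<sigma> @- calculation_from ps (p @ \<sigma>) \<tau>"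
  using assms
proof (induction \<sigma> arbitrary: p)
  case (Cons b \<sigma>)
  have "inserted ps p = []" using Cons.prems[of "[]"] by simp
  moreover have "inserted ps ((p @ [b]) @ \<rho>) = []" if "strict_prefix \<rho> \<sigma>" for \<rho>
    using Cons.prems[of "b # \<rho>"] that by simp
  ultimately show ?case using Cons.IH[of "p @ [b]"] by (simp add: calculation_from_Stream)
qed simp

lemma calculation_from_first:
  assumes "stake (Suc (length \<sigma>)) (calculation_from ps p \<tau>) = map Bit \<sigma> @ [Ys e]"
  shows "inserted ps (p @ \<sigma>) \<noteq> [] \<and> hd (inserted ps (p @ \<sigma>)) = Ys e \<and>
    (\<forall>\<rho>. strict_prefix \<rho> \<sigma> \<longrightarrow> inserted ps (p @ \<rho>) = [])"
  using assms
proof (induction \<sigma> arbitrary: p \<tau>)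
  case Nil
  obtain b \<tau>' where "\<tau> = b ## \<tau>'" by (metis stream.collapse)
  then show ?case using Nil by (cases "inserted ps p") (auto simp: calculation_from_Stream)
next
  case (Cons a \<sigma>)
  obtain b \<tau>' where \<tau>: "\<tau> = b ## \<tau>'" by (metis stream.collapse)
  have "set (inserted ps p) \<subseteq> range Ys"
    by (auto simp: inserted_def split: if_splits)
  moreover have "inserted ps p = [] \<or> hd (inserted ps p) = Bit a"
    using Cons.prems by (cases "inserted ps p") (auto simp: \<tau> calculation_from_Stream)
  ultimately have nil: "inserted ps p = []" by (cases "inserted ps p") auto
  have "stake (Suc (Suc (length \<sigma>))) (Bit b ## calculation_from ps (p @ [b]) \<tau>') = Bit a # map Bit \<sigma> @ [Ys e]"
    using Cons.prems nil by (simp add: \<tau> calculation_from_Stream del: stake.simps)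
  then have "Bit b = Bit a \<and> stake (Suc (length \<sigma>)) (calculation_from ps (p @ [b]) \<tau>') = map Bit \<sigma> @ [Ys e]"
    unfolding stake.simps(2)[of "Suc (length \<sigma>)"] stream.sel list.inject .
  then have "a = b" "stake (Suc (length \<sigma>)) (calculation_from ps (p @ [b]) \<tau>') = map Bit \<sigma> @ [Ys e]"
    by blast+
  with Cons.IH[of "p @ [b]" \<tau>'] show ?case
  proof (intro conjI allI impI)
    fix \<rho> assume "strict_prefix \<rho> (a # \<sigma>)"
    then show "inserted ps (p @ \<rho>) = []"
      using nil Cons.IH[of "p @ [b]" \<tau>'] \<open>a = b\<close>
        \<open>stake (Suc (length \<sigma>)) (calculation_from ps (p @ [b]) \<tau>') = map Bit \<sigma> @ [Ys e]\<close>
      by (cases \<rho>) auto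
  qed auto
qed

lemma sdrop_calculation_from:
  "\<exists>q \<tau>' j. sdrop k (calculation_from ps p \<tau>) = drop j (inserted ps q) @- Bit (shd \<tau>') ## calculation_from ps (q @ [shd \<tau>']) (stl \<tau>')"
proof (induction k arbitrary: p \<tau> rule: less_induct)
  case (less k)
  obtain b \<tau>' where \<tau>: "\<tau> = b ## \<tau>'" by (metis stream.collapse)
  show ?case
  proof (cases "k \<le> length (inserted ps p)")
    case True
    then show ?thesis
      by (intro exI[of _ p] exI[of _ \<tau>] exI[of _ k]) (simp add: \<tau> calculation_from_Stream sdrop_shift)
  next
    case False
    then obtain m where k: "k = length (inserted ps p) + Suc m"
      using less_imp_Suc_add[of "length (inserted ps p)" k] by auto
    then have "sdrop k (calculation_from ps p \<tau>) = sdrop m (calculation_from ps (p @ [b]) \<tau>')"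
      by (simp add: \<tau> calculation_from_Stream sdrop_shift)
    then show ?thesis using less[of m] k by simp
  qed
qed

lemma inserted_append: "inserted (ps @ qs) v = inserted ps v @ inserted qs v"
  by (simp add: inserted_def)

lemma inserted_outside: "(\<And>t. (v, t) \<notin> set ps) \<Longrightarrow> inserted ps v = []"
  by (auto simp: inserted_def)

lemma inserted_powers_at:
  "inserted (powers_at s c) (s @ u) = replicate (nat \<bar>label c u\<bar>) (Ys (sign_of (label c u)))"
proof (induction c arbitrary: s u)
  case Tip
  then show ?case by (simp add: inserted_def)
next
  case (Br t l r)
  have out: "inserted (powers_at p c) v = []" if "\<not> prefix p v" for p c v
    using that by (intro inserted_outside) (auto simp: powers_at_iff)
  show ?case
  proof (cases u)
    case Nil
    then show ?thesis
      using out[of "s @ [False]" s l] out[of "s @ [True]" s r] by (auto simp: inserted_append inserted_def)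
  next
    case (Cons b v)
    have "inserted (if t = 0 then [] else [(s, t)]) (s @ u) = []" using Cons by (simp add: inserted_def)
    then show ?thesis
      using out[of "s @ [\<not> b]" "s @ u" "if b then l else r"] Br.IH(1)[of "s @ [False]" v] Br.IH(2)[of "s @ [True]" v] Cons
      by (cases b) (simp_all add: inserted_append)
  qed
qed

theorem potential_cancellation_iff: "potential_cancellation (powers_at [] c) \<longleftrightarrow> \<not> reduced c"
proof
  let ?ps = "powers_at [] c" and ?lb = "label c"
  have ins: "inserted ?ps u = replicate (nat \<bar>?lb u\<bar>) (Ys (sign_of (?lb u)))" for u
    using inserted_powers_at[of "[]"] by simp
  have substring: "stake (length a) (sdrop (length p) (p @- a @- R)) = a" for p a :: "symbol list" and R
    by (simp add: sdrop_shift stake_shift)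
  {
    assume "potential_cancellation ?ps"
    then obtain \<tau> k n where can: "cancelling (stake n (sdrop k (calculation_from ?ps [] \<tau>)))"
      by (auto simp: potential_cancellation_def calculation_eq)
    then obtain e \<sigma> e' where st: "stake n (sdrop k (calculation_from ?ps [] \<tau>)) = [Ys e] @ map Bit \<sigma> @ [Ys e']"
      unfolding cancelling_def by blast
    then have edge: "path_edge \<sigma> e' = sign_edge (opposite e)" using can cancelling_iff by simp
    obtain q \<tau>' j where q: "sdrop k (calculation_from ?ps [] \<tau>) =
        drop j (inserted ?ps q) @- Bit (shd \<tau>') ## calculation_from ?ps (q @ [shd \<tau>']) (stl \<tau>')"
      using sdrop_calculation_from by blast
    have "length (stake n (sdrop k (calculation_from ?ps [] \<tau>))) = Suc (Suc (length \<sigma>))" unfolding st by simp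
    then have n: "n = Suc (Suc (length \<sigma>))" by simp
    define m where "m = nat \<bar>?lb q\<bar> - j"
    have d: "drop j (inserted ?ps q) = replicate m (Ys (sign_of (?lb q)))"
      by (simp add: ins m_def)
    have st': "stake (Suc (Suc (length \<sigma>))) (replicate m (Ys (sign_of (?lb q))) @- Bit (shd \<tau>') ## calculation_from ?ps (q @ [shd \<tau>']) (stl \<tau>'))
        = Ys e # map Bit \<sigma> @ [Ys e']" using st unfolding q d n by simp
    then obtain m' where m: "m = Suc m'" by (cases m) auto
    have st2: "Ys (sign_of (?lb q)) = Ys e \<and> stake (Suc (length \<sigma>)) (replicate m' (Ys (sign_of (?lb q))) @-
        Bit (shd \<tau>') ## calculation_from ?ps (q @ [shd \<tau>']) (stl \<tau>')) = map Bit \<sigma> @ [Ys e']"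
      using st' unfolding m replicate_Suc shift.simps stake.simps(2)[of "Suc (length \<sigma>)"] stream.sel list.inject .
    then have e: "e = sign_of (?lb q)" by simp
    have lq: "?lb q \<noteq> 0" using m by (auto simp: m_def)
    have st2: "stake (Suc (length \<sigma>)) (replicate m' (Ys (sign_of (?lb q))) @- Bit (shd \<tau>') ## calculation_from ?ps (q @ [shd \<tau>']) (stl \<tau>'))
        = map Bit \<sigma> @ [Ys e']" using st2 ..
    show "\<not> reduced c"
    proof (cases m')
      \<comment> \<open>The next symbol lies in the same block, so there are no digits in between
        and the two letters have equal signs.\<close>
      case (Suc i)
      have "\<sigma> = []" using st2 by (cases \<sigma>) (auto simp: Suc)
      then have "e' = e" using st2 e by (simp add: Suc)
      then show ?thesis using edge \<open>\<sigma> = []\<close> by simp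
    next
      case 0
      then obtain \<rho> where \<sigma>: "\<sigma> = shd \<tau>' # \<rho>"
        using st2 by (cases \<sigma>) auto
      let ?b = "shd \<tau>'"
      have "stake (Suc (length \<rho>)) (calculation_from ?ps (q @ [?b]) (stl \<tau>')) = map Bit \<rho> @ [Ys e']"
        using st2 0 \<sigma> by simp
      from calculation_from_first[OF this]
      have f: "?lb (q @ ?b # \<rho>) \<noteq> 0" "e' = sign_of (?lb (q @ ?b # \<rho>))"
        "\<And>\<pi>. strict_prefix \<pi> \<rho> \<Longrightarrow> ?lb (q @ ?b # \<pi>) = 0"
        by (auto simp: ins hd_replicate)
      then have "first_nonzero (\<lambda>u. ?lb (q @ ?b # u)) \<rho>" by (simp add: first_nonzero_def)
      then have "backtracking ?lb q"
        unfolding backtracking_def using lq f(2) edge e \<sigma> by auto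
      then show ?thesis using reduced_iff by blast
    qed
  next
    assume "\<not> reduced c"
    then obtain s where "backtracking ?lb s" using reduced_iff by blast
    then obtain b \<sigma> where s: "?lb s \<noteq> 0" and f: "first_nonzero (\<lambda>u. ?lb (s @ b # u)) \<sigma>"
      and edge: "path_edge (b # \<sigma>) (sign_of (?lb (s @ b # \<sigma>))) = sign_edge (opposite (sign_of (?lb s)))"
      by (auto simp: backtracking_def)
    let ?e = "sign_of (?lb s)" and ?e' = "sign_of (?lb (s @ b # \<sigma>))"
    let ?a = "[Ys ?e] @ map Bit (b # \<sigma>) @ [Ys ?e']"
    define \<tau> where "\<tau> = s @- b ## \<sigma> @- sconst True"
    obtain A where A: "calculation_from ?ps [] \<tau> = A @- calculation_from ?ps s (b ## \<sigma> @- sconst True)"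
      using calculation_from_shift[of ?ps "[]" s] by (auto simp: \<tau>_def)
    obtain i where i: "nat \<bar>?lb s\<bar> = Suc i" using s by (cases "nat \<bar>?lb s\<bar>") auto
    \<comment> \<open>The cancelling substring starts at the last letter of the block inserted after
      \<open>s\<close>.\<close>
    have B: "inserted ?ps s = replicate i (Ys ?e) @ [Ys ?e]" unfolding ins i by (simp add: replicate_append_same)
    have "inserted ?ps ((s @ [b]) @ \<rho>) = []" if "strict_prefix \<rho> \<sigma>" for \<rho>
      using f that by (simp add: first_nonzero_def ins)
    then have C: "calculation_from ?ps (s @ [b]) (\<sigma> @- sconst True) = map Bit \<sigma> @- calculation_from ?ps (s @ b # \<sigma>) (sconst True)"
      using calculation_from_zero[of \<sigma> ?ps "s @ [b]"] by simp
    obtain j where j: "nat \<bar>?lb (s @ b # \<sigma>)\<bar> = Suc j" using f by (cases "nat \<bar>?lb (s @ b # \<sigma>)\<bar>") (auto simp: first_nonzero_def)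
    obtain R where R: "calculation_from ?ps (s @ b # \<sigma>) (sconst True) = Ys ?e' ## R"
      using calculation_from_Stream[of ?ps "s @ b # \<sigma>" True "sconst True"] j
      by (simp add: ins siterate.code[symmetric] sconst_code[symmetric])
    have "calculation ?ps \<tau> = (A @ replicate i (Ys ?e)) @- ?a @- R"
      unfolding calculation_eq A calculation_from_Stream B C R by simp
    then have "stake (length ?a) (sdrop (length (A @ replicate i (Ys ?e))) (calculation ?ps \<tau>)) = ?a"
      by (simp only: substring)
    moreover have "cancelling ?a" unfolding cancelling_iff by (rule edge)
    ultimately show "potential_cancellation ?ps" unfolding potential_cancellation_def by metis
  }
qed

section \<open>The normal form theorem\<close>

lemma Bij_UNIV: "Bij UNIV = {f. bij f}"
  by (auto simp: Bij_def)

lemma mult_BijGroup: "bij g \<Longrightarrow> bij h \<Longrightarrow> g \<otimes>\<^bsub>BijGroup UNIV\<^esub> h = g \<circ> h"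
  by (simp add: BijGroup_def Bij_UNIV compose_def fun_eq_iff)

lemma inv_BijGroup_UNIV: "bij g \<Longrightarrow> inv\<^bsub>BijGroup UNIV\<^esub> g = inv_into UNIV g"
  by (simp add: inv_BijGroup Bij_UNIV fun_eq_iff)

lemma one_BijGroup: "\<one>\<^bsub>BijGroup UNIV\<^esub> = id"
  by (simp add: BijGroup_def fun_eq_iff)

lemma generate_letter:
  assumes "letter_map l \<in> generate (BijGroup UNIV) H" "word_map w \<in> generate (BijGroup UNIV) H"
  shows "word_map (l # w) \<in> generate (BijGroup UNIV) H"
  using generate.eng[OF assms(2,1)] mult_BijGroup[OF bij_word_map bij_letter_map] by (simp only: word_map_Cons)

lemma X_letter_in_F: "letter_map (X s e) \<in> thompson_F"
proof (cases e)
  case Pos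
  then show ?thesis unfolding thompson_F_def by (auto intro: generate.incl)
next
  case Neg
  have "bij (x_at s)" by (simp add: x_at_def bij_localize bij_x_map)
  moreover have "inv\<^bsub>BijGroup UNIV\<^esub> (x_at s) \<in> thompson_F"
    unfolding thompson_F_def by (rule generate.inv) simp
  ultimately show ?thesis using Neg by (simp add: inv_BijGroup_UNIV)
qed

lemma X_word_in_F: "X_word f \<Longrightarrow> word_map f \<in> thompson_F"
proof (induction f)
  case Nil
  then show ?case using generate.one[of "BijGroup UNIV" "range x_at"] by (simp only: thompson_F_def one_BijGroup word_map_Nil)
next
  case (Cons l f)
  then obtain s e where "l = X s e" by (auto simp: X_word_def)
  then show ?case using Cons X_letter_in_F generate_letter unfolding thompson_F_def by simp
qed

lemma group_G_word: "g \<in> group_G \<Longrightarrow> \<exists>v. S_word v \<and> word_map v = g"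
  unfolding group_G_def
proof (induction rule: generate.induct)
  case one
  show ?case by (rule exI[of _ "[]"]) (simp add: one_BijGroup)
next
  case (incl h)
  then consider s where "h = x_at s" | s where "h = y_at s" "y_index s" by auto
  then show ?case
  proof cases
    case (1 s)
    then show ?thesis by (intro exI[of _ "[X s Pos]"]) (simp add: word_map_Cons)
  next
    case (2 s)
    then show ?thesis by (intro exI[of _ "[Y s Pos]"]) (simp add: word_map_Cons)
  qed
next
  case (inv h)
  then consider s where "h = x_at s" | s where "h = y_at s" "y_index s" by auto
  then show ?case
  proof cases
    case (1 s)
    then have "word_map [X s Neg] = inv\<^bsub>BijGroup UNIV\<^esub> h"
      using inv_BijGroup_UNIV[of h] by (simp add: word_map_Cons x_at_def bij_localize bij_x_map del: word_map_X)
    then show ?thesis by (intro exI[of _ "[X s Neg]"]) simp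
  next
    case (2 s)
    then have "word_map [Y s Neg] = inv\<^bsub>BijGroup UNIV\<^esub> h"
      using inv_BijGroup_UNIV[of h] by (simp add: word_map_Cons y_at_def bij_localize bij_y_map)
    then show ?thesis using 2 by (intro exI[of _ "[Y s Neg]"]) simp
  qed
next
  case (eng h1 h2)
  then obtain v w where "S_word v" "word_map v = h1" "S_word w" "word_map w = h2" by blast
  then show ?case
    using mult_BijGroup[OF bij_word_map bij_word_map, of v w]
    \<comment> \<open>The product of the group is composition from the left, while words act from
      the right, so the two words are joined in reverse order.\<close>
    by (intro exI[of _ "w @ v"]) (simp add: word_map_append)
qed

lemma normal_form_exists:
  assumes "S_word v" shows "\<exists>w. normal_form_of (word_map v) w \<and> converts_to v w"
proof -
  obtain c f where c: "reduced c" "contracted c" and f: "X_word f" "conv v (f @ tree_word [] c)"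
    using reaches_contracted[OF assms] by (auto simp: reaches_def)
  have S: "S_word (tree_word [] c)" using conv_S_word(2)[OF f(2)] by simp
  obtain h where h: "F_normal_form h" "X_word h" "word_map h = word_map f"
    using F_normal_form_exists[OF f(1)] by blast
  have "conv (f @ tree_word [] c) (h @ tree_word [] c)"
    using f h S by (intro conv_append_right conv_F_element) auto
  with f(2) have conv: "conv v (h @ tree_word [] c)" by (rule conv_trans)
  then have "converts_to ([] @ v @ []) ([] @ (h @ tree_word [] c) @ [])"
    unfolding conv_def by (meson S_word_Nil)
  then have "converts_to v (h @ tree_word [] c)" by simp
  moreover have "normal_form_of (word_map v) (h @ tree_word [] c)"
    unfolding normal_form_of_def
  proof (intro exI[of _ h] exI[of _ "powers_at [] c"] conjI)
    show "h @ tree_word [] c = h @ Y_word_of (powers_at [] c)" by (simp add: tree_word_def)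
    show "word_map (h @ tree_word [] c) = word_map v" using conv by (simp add: conv_def)
  qed (use c h S X_word_in_F[OF h(2)] in \<open>simp_all add: standard_form_powers_at potential_contraction_iff potential_cancellation_iff\<close>)
  ultimately show ?thesis by blast
qed

lemma normal_form_unique:
  assumes "normal_form_of g w" "normal_form_of g w'" shows "w = w'"
proof -
  obtain f ps where f: "w = f @ Y_word_of ps" "word_map w = g" "standard_form f ps"
    "\<not> potential_contraction ps" "\<not> potential_cancellation ps" "X_word f" "F_normal_form f"
    using assms(1) unfolding normal_form_of_def by blast
  obtain f' ps' where f': "w' = f' @ Y_word_of ps'" "word_map w' = g" "standard_form f' ps'"
    "\<not> potential_contraction ps'" "\<not> potential_cancellation ps'" "X_word f'" "F_normal_form f'"
    using assms(2) unfolding normal_form_of_def by blast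
  obtain c where c: "powers_at [] c = ps" using standard_form_tree[OF f(3)] by blast
  obtain c' where c': "powers_at [] c' = ps'" using standard_form_tree[OF f'(3)] by blast
  have red: "reduced c" "contracted c" "reduced c'" "contracted c'"
    using f f' potential_contraction_iff potential_cancellation_iff c c' by auto
  have eq: "word_map (f @ tree_word [] c) = word_map (f' @ tree_word [] c')"
    using f f' c c' by (simp add: tree_word_def)
  have "label c = label c'"
    by (rule tree_label_unique[OF red f(6) f'(6) eq])
  then have "set (powers_at [] c) = set (powers_at [] c')"
    by (auto simp: powers_at_iff)
  then have ps: "powers_at [] c = powers_at [] c'"
    using sorted_wrt_unique[OF _ powers_at_sorted powers_at_sorted] index_less_asym by blast
  \<comment> \<open>With equal Y-parts, which are bijections applied last, the F-parts must be equal
    maps, and the uniqueness of their normal forms applies.\<close>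
  have "word_map (tree_word [] c) (word_map f \<eta>) = word_map (tree_word [] c) (word_map f' \<eta>)" for \<eta>
    using fun_cong[OF eq, of \<eta>] ps by (simp add: word_map_append tree_word_def)
  then have "word_map f \<eta> = word_map f' \<eta>" for \<eta>
    using bij_word_map[of "tree_word [] c"] by (meson bij_is_inj injD)
  then have "f = f'" using F_normal_form_unique f f' by blast
  then show ?thesis using ps c c' f(1) f'(1) by simp
qed

theorem theorem4p4:
  assumes "g \<in> group_G"
  shows "(\<exists>!w. normal_form_of g w) \<and>
    (\<forall>v w. S_word v \<and> word_map v = g \<and> normal_form_of g w \<longrightarrow> converts_to v w)"
proof -
  obtain v where v: "S_word v" "word_map v = g" using group_G_word[OF assms] by blast
  have "\<exists>!w. normal_form_of g w"
    using normal_form_exists[OF v(1)] v(2) normal_form_unique by blast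
  moreover have "converts_to v w" if "S_word v" "word_map v = g" "normal_form_of g w" for v w
    using normal_form_exists[OF that(1)] that normal_form_unique by blast
  ultimately show ?thesis by blast
qed

end
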